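(* Let $H_0$ be a maximal accumulative operator on a complex separable Hilbert space, let $0\le V=V^*\in S^1$, and let $H=H_0-iV$. Then the perturbation determinant ${\det}_{H/H_0}(z)$ is an outer function in $\mathbb{C}_+$. Moreover, $$ {\det}_{H/H_0}(z)=\exp\left(\frac{1}{\pi i}\int_{\mathbb{R}}\frac{\zeta(\lambda)}{\lambda-z}\,d\lambda\right),\quad z\in\mathbb{C}_+, $$ where $$ \zeta(\lambda)=\lim_{\varepsilon\to0^+}\log\big|{\det}_{H/H_0}(\lambda+i\varepsilon)\big|\ge 0\quad\text{for a.e. }\lambda\in\mathbb{R}, $$ with $$ \|\zeta\|_{L^1(\mathbb{R})}=\pi\,\mathrm{tr}(V). $$
   Context: $\mathbb{C}_\pm=\{z\in\mathbb{C}:\pm\mathrm{Im}(z)>0\}$; $S^1$ is the trace class. A closed densely defined operator $A$ is called accumulative if $\mathrm{Im}\langle Ah,h\rangle\le 0$ for every $h$ in its domain; it is maximal accumulative if it has no proper accumulative extension, which guarantees that $\mathbb{C}_+$ is contained in the resolvent set of $A$. The perturbation determinant is the Fredholm determinant ${\det}_{H/H_0}(z)=\det\big((H-z)(H_0-z)^{-1}\big)=\det\big(I-iV(H_0-z)^{-1}\big)$ for $z$ in the resolvent set $\rho(H_0)$. Outer function: $F$ is an outer function (in $\mathbb{C}_+$) if $F$ is analytic on $\mathbb{C}_+$, $|F|$ has finite boundary values $|F(\lambda+i0)|$ for a.e. $\lambda\in\mathbb{R}$, $\log|F|\in L^1\big(\mathbb{R};\frac{d\lambda}{1+\lambda^2}\big)$,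 and for some $\theta\in\mathbb{R}$, $$F(z)=e^{i\theta}\exp\left(\frac{1}{\pi i}\int_{\mathbb{R}}\left(\frac{1}{\lambda-z}-\frac{\lambda}{1+\lambda^2}\right)\log|F(\lambda+i0)|\,d\lambda\right),\quad z\in\mathbb{C}_+.$$ *)

theory Defs
  imports "HOL-Analysis.Analysis"
begin

section \<open>Complex Hilbert spaces\<close>

text \<open>The inner product is linear in its \<^emph>\<open>first\<close> argument. This matters: with the opposite
  convention the sign of \<open>Im \<langle>A h, h\<rangle>\<close> changes, and accumulative operators become dissipative.\<close>

class complex_hilbert = banach +
  fixes scaleC :: "complex \<Rightarrow> 'a \<Rightarrow> 'a" (infixr "*\<^sub>C" 75)
    and cinner :: "'a \<Rightarrow> 'a \<Rightarrow> complex"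
  assumes scaleC_add_right: "c *\<^sub>C (x + y) = c *\<^sub>C x + c *\<^sub>C y"
    and scaleC_add_left: "(c + d) *\<^sub>C x = c *\<^sub>C x + d *\<^sub>C x"
    and scaleC_scaleC: "c *\<^sub>C d *\<^sub>C x = (c * d) *\<^sub>C x"
    and scaleC_of_real: "complex_of_real r *\<^sub>C x = r *\<^sub>R x"
    and cinner_add_left: "cinner (x + y) z = cinner x z + cinner y z"
    and cinner_scaleC_left: "cinner (c *\<^sub>C x) y = c * cinner x y"
    and cinner_commute: "cinner x y = cnj (cinner y x)"
    and cinner_self: "cinner x x = complex_of_real ((norm x)\<^sup>2)"

text \<open>A Hilbert basis: a maximal orthonormal set.\<close>

definition orthonormal_basis :: "'a::complex_hilbert set \<Rightarrow> bool" where
  "orthonormal_basis B \<longleftrightarrow>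
     (\<forall>e\<in>B. \<forall>f\<in>B. cinner e f = (if e = f then 1 else 0)) \<and>
     (\<forall>x. (\<forall>e\<in>B. cinner x e = 0) \<longrightarrow> x = 0)"

definition some_onb :: "'a::complex_hilbert set" where
  "some_onb = (SOME B. orthonormal_basis B)"


section \<open>Bounded operators and the trace class\<close>

definition bounded_clinear :: "('a::complex_hilbert \<Rightarrow> 'a) \<Rightarrow> bool" where
  "bounded_clinear T \<longleftrightarrow> bounded_linear T \<and> (\<forall>c x. T (c *\<^sub>C x) = c *\<^sub>C T x)"

definition self_adjoint_op :: "('a::complex_hilbert \<Rightarrow> 'a) \<Rightarrow> bool" where
  "self_adjoint_op T \<longleftrightarrow> bounded_clinear T \<and> (\<forall>x y. cinner (T x) y = cinner x (T y))"

definition positive_op :: "('a::complex_hilbert \<Rightarrow> 'a) \<Rightarrow> bool" where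
  "positive_op T \<longleftrightarrow> bounded_clinear T \<and> (\<forall>x. cinner (T x) x \<in> \<real>\<^sub>\<ge>\<^sub>0)"

text \<open>\<open>P = |T|\<close>, the positive square root of \<open>T\<^sup>* T\<close>; the last condition says \<open>P\<^sup>2 = T\<^sup>* T\<close>.\<close>

definition is_abs_op :: "('a::complex_hilbert \<Rightarrow> 'a) \<Rightarrow> ('a \<Rightarrow> 'a) \<Rightarrow> bool" where
  "is_abs_op P T \<longleftrightarrow> positive_op P \<and> (\<forall>x y. cinner (P (P x)) y = cinner (T x) (T y))"

text \<open>\<open>tr |T| < \<infinity>\<close>. The value of the sum does not depend on the basis, since \<open>|T| \<ge> 0\<close>.\<close>

definition trace_class :: "('a::complex_hilbert \<Rightarrow> 'a) \<Rightarrow> bool" where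
  "trace_class T \<longleftrightarrow> bounded_clinear T \<and>
     (\<exists>P. is_abs_op P T \<and> (\<exists>B. orthonormal_basis B \<and> (\<lambda>e. cinner (P e) e) summable_on B))"

definition op_trace :: "('a::complex_hilbert \<Rightarrow> 'a) \<Rightarrow> complex" where
  "op_trace T = (\<Sum>\<^sub>\<infinity>e\<in>some_onb. cinner (T e) e)"


section \<open>The Fredholm determinant\<close>

text \<open>The trace of the exterior power \<open>\<Lambda>\<^sup>k T\<close>, evaluated in the orthonormal basis
  \<open>e\<^sub>1 \<and> \<dots> \<and> e\<^sub>k\<close> of the exterior power of the space, where \<open>S = {e\<^sub>1, \<dots>, e\<^sub>k}\<close> runs over the
  \<open>k\<close>-element subsets of an orthonormal basis. The diagonal matrix entry for \<open>S\<close> is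
  \<open>det (\<langle>T e, f\<rangle>)\<close> with \<open>e, f\<close> in \<open>S\<close>, written out by the Leibniz formula.\<close>

definition ext_power_trace :: "nat \<Rightarrow> ('a::complex_hilbert \<Rightarrow> 'a) \<Rightarrow> complex" where
  "ext_power_trace k T =
     (\<Sum>\<^sub>\<infinity>S\<in>{S. S \<subseteq> some_onb \<and> finite S \<and> card S = k}.
        \<Sum>p | p permutes S. of_int (sign p) * (\<Prod>e\<in>S. cinner (T e) (p e)))"

text \<open>For \<open>A = I + T\<close> with \<open>T\<close> of trace class, \<open>det A = \<Sum>\<^sub>k tr (\<Lambda>\<^sup>k T)\<close>.\<close>

definition fredholm_det :: "('a::complex_hilbert \<Rightarrow> 'a) \<Rightarrow> complex" where
  "fredholm_det A = (\<Sum>k. ext_power_trace k (\<lambda>x. A x - x))"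


section \<open>Unbounded operators\<close>

text \<open>An unbounded operator is given by its domain \<open>D\<close> and a function \<open>A\<close>, whose values outside
  \<open>D\<close> are irrelevant.\<close>

definition linear_operator :: "'a::complex_hilbert set \<Rightarrow> ('a \<Rightarrow> 'a) \<Rightarrow> bool" where
  "linear_operator D A \<longleftrightarrow> 0 \<in> D \<and>
     (\<forall>x\<in>D. \<forall>y\<in>D. x + y \<in> D \<and> A (x + y) = A x + A y) \<and>
     (\<forall>c. \<forall>x\<in>D. c *\<^sub>C x \<in> D \<and> A (c *\<^sub>C x) = c *\<^sub>C A x)"

definition closed_operator :: "'a::complex_hilbert set \<Rightarrow> ('a \<Rightarrow> 'a) \<Rightarrow> bool" where
  "closed_operator D A \<longleftrightarrow> closed ((\<lambda>x. (x, A x)) ` D)"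

definition accumulative :: "'a::complex_hilbert set \<Rightarrow> ('a \<Rightarrow> 'a) \<Rightarrow> bool" where
  "accumulative D A \<longleftrightarrow>
     linear_operator D A \<and> closed_operator D A \<and> closure D = UNIV \<and>
     (\<forall>h\<in>D. Im (cinner (A h) h) \<le> 0)"

definition maximal_accumulative :: "'a::complex_hilbert set \<Rightarrow> ('a \<Rightarrow> 'a) \<Rightarrow> bool" where
  "maximal_accumulative D A \<longleftrightarrow> accumulative D A \<and>
     (\<forall>D' A'. accumulative D' A' \<and> D \<subseteq> D' \<and> (\<forall>h\<in>D. A' h = A h) \<longrightarrow> D' = D)"

definition resolvent :: "'a::complex_hilbert set \<Rightarrow> ('a \<Rightarrow> 'a) \<Rightarrow> complex \<Rightarrow> 'a \<Rightarrow> 'a" where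
  "resolvent D A z = inv_into D (\<lambda>h. A h - z *\<^sub>C h)"

definition resolvent_set :: "'a::complex_hilbert set \<Rightarrow> ('a \<Rightarrow> 'a) \<Rightarrow> complex set" where
  "resolvent_set D A =
     {z. bij_betw (\<lambda>h. A h - z *\<^sub>C h) D UNIV \<and> bounded_clinear (resolvent D A z)}"

text \<open>\<open>det ((H - z) (H\<^sub>0 - z)\<^sup>-\<^sup>1)\<close> for operators \<open>H\<close>, \<open>H\<^sub>0\<close> with common domain \<open>D\<close>. It is
  meaningful on the resolvent set of \<open>H\<^sub>0\<close> only; elsewhere the value \<open>0\<close> is a dummy.\<close>

definition perturbation_det ::
  "'a::complex_hilbert set \<Rightarrow> ('a \<Rightarrow> 'a) \<Rightarrow> ('a \<Rightarrow> 'a) \<Rightarrow> complex \<Rightarrow> complex" where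
  "perturbation_det D H H0 z =
     (if z \<in> resolvent_set D H0
      then fredholm_det (\<lambda>x. H (resolvent D H0 z x) - z *\<^sub>C resolvent D H0 z x)
      else 0)"


section \<open>Outer functions in the upper half-plane\<close>

definition upper_half_plane :: "complex set" where
  "upper_half_plane = {z. Im z > 0}"

text \<open>The function \<open>g\<close> is \<open>|F(\<lambda> + i0)|\<close>. Since \<open>ln 0 = 0\<close> here, the condition \<open>g > 0\<close> almost
  everywhere, which is part of \<open>log |F| \<in> L\<^sup>1\<close>, has to be spelled out.\<close>

definition outer_function :: "(complex \<Rightarrow> complex) \<Rightarrow> bool" where
  "outer_function F \<longleftrightarrow> F analytic_on upper_half_plane \<and>
     (\<exists>g::real \<Rightarrow> real.
        (AE t in lborel. ((\<lambda>\<epsilon>. cmod (F (Complex t \<epsilon>))) \<longlongrightarrow> g t) (at_right 0)) \<and>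
        (AE t in lborel. 0 < g t) \<and>
        integrable lborel (\<lambda>t. ln (g t) / (1 + t\<^sup>2)) \<and>
        (\<exists>\<theta>::real. \<forall>z\<in>upper_half_plane.
           F z = exp (\<i> * of_real \<theta>) *
             exp (1 / (of_real pi * \<i>) *
               (LINT t|lborel. (1 / (of_real t - z) - of_real (t / (1 + t\<^sup>2))) * of_real (ln (g t))))))"

end

theory Submission
  imports Defs "HOL-Complex_Analysis.Complex_Analysis" "Jordan_Normal_Form.Determinant"
begin

text \<open>Why the theorem holds. Write \<open>R(z) = (H\<^sub>0 - z)\<^sup>-\<^sup>1\<close> for \<open>Im z > 0\<close>, and consider first a perturbation of rank
  one, \<open>V = \<langle>\<cdot>, \<psi>\<rangle> \<psi>\<close>. The determinant is then the scalar function \<open>M(z) = 1 - \<i> \<langle>R(z) \<psi>, \<psi>\<rangle>\<close>, and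
  accumulativity gives \<open>Im \<langle>R(z) \<psi>, \<psi>\<rangle> \<ge> 0\<close>, hence \<open>Re M \<ge> 1\<close> on the upper half-plane. So \<open>log \<bar>M\<bar>\<close>
  is a positive harmonic function. Since \<open>y (M(\<i> y) - 1) \<rightarrow> \<parallel>\<psi>\<parallel>\<^sup>2\<close> as \<open>y \<rightarrow> \<infinity>\<close>, its integral
  over every horizontal line is \<open>\<pi> \<parallel>\<psi>\<parallel>\<^sup>2\<close>. The same computation for the positive harmonic function
  \<open>Re \<surd>M - 1\<close>, which dominates a multiple of \<open>(log \<bar>M\<bar>)\<^sup>2\<close>, shows that \<open>log \<bar>M\<bar>\<close> is uniformly bounded in \<open>L\<^sup>2\<close>
  of these lines. Therefore it is the Poisson integral of a function
  \<open>\<zeta> \<ge> 0\<close> without any singular part, and \<open>M = exp ((1 / \<pi>\<i>) \<integral> \<zeta>(t) / (t - z) dt)\<close> with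
  \<open>\<integral> \<zeta> = \<pi> \<parallel>\<psi>\<parallel>\<^sup>2\<close> (lemma \<open>outer_representation\<close>).

  For general \<open>V\<close>, a Cholesky decomposition along the orthonormal basis that defines the determinant
  gives \<open>V = \<Sum>n. \<langle>\<cdot>, \<psi>\<^sub>n\<rangle> \<psi>\<^sub>n\<close> with \<open>\<Sum>n. \<parallel>\<psi>\<^sub>n\<parallel>\<^sup>2 = tr V\<close> (lemma \<open>trace_class_cholesky\<close>). Adding
  the summands one at a time, all intermediate operators stay accumulative and have the upper half-plane
  in their resolvent sets, and the determinant is the product of the rank-one determinants of the steps
  (theorem \<open>perturbation_det_product\<close>). All exponents have non-negative densities \<open>\<zeta>\<^sub>n\<close> with \<open>\<Sum>n. \<integral> \<zeta>\<^sub>n = \<pi> tr V\<close>, so \<open>\<zeta> = \<Sum>n. \<zeta>\<^sub>n\<close>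
  converges in \<open>L\<^sup>1\<close> and represents the whole determinant. The Poisson integral of an integrable
  function converges to it almost everywhere along vertical lines (lemma \<open>Fatou_Poisson\<close>), which
  identifies \<open>\<zeta>\<close> with the boundary value of the logarithm of the modulus.

  The product formula rests on two facts about the series of principal minors. A Hadamard-type bound for
  determinants of semi-inner products (lemma \<open>Hadamard_form\<close>) makes the series converge absolutely,
  uniformly over the finite-rank truncations of \<open>V\<close>. For the truncations it is a limit of finite
  determinants \<open>det (I + X Y) = det (I + Y X)\<close>, and the right-hand side factors step by step.\<close>


section \<open>Complex Hilbert spaces\<close>

lemma scaleC_zero_left [simp]: "0 *\<^sub>C x = (0::'a::complex_hilbert)"
  using scaleC_of_real[of 0 x] by simp

lemma scaleC_zero_right [simp]: "c *\<^sub>C 0 = (0::'a::complex_hilbert)"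
  using scaleC_add_right[of c 0 "0::'a"] by simp

lemma scaleC_one [simp]: "1 *\<^sub>C x = (x::'a::complex_hilbert)"
  using scaleC_of_real[of 1 x] by simp

lemma scaleC_minus_left: "(- c) *\<^sub>C x = - (c *\<^sub>C (x::'a::complex_hilbert))"
  using scaleC_add_left[of c "-c" x] by (simp add: eq_neg_iff_add_eq_0 add.commute)

lemma scaleC_minus_right: "c *\<^sub>C (- x) = - (c *\<^sub>C (x::'a::complex_hilbert))"
  using scaleC_add_right[of c x "-x"] by (simp add: eq_neg_iff_add_eq_0 add.commute)

lemma scaleC_diff_right: "c *\<^sub>C (x - y) = c *\<^sub>C x - c *\<^sub>C (y::'a::complex_hilbert)"
  using scaleC_add_right[of c x "-y"] by (simp add: scaleC_minus_right)

lemma scaleC_diff_left: "(c - d) *\<^sub>C x = c *\<^sub>C x - d *\<^sub>C (x::'a::complex_hilbert)"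
  using scaleC_add_left[of c "-d" x] by (simp add: scaleC_minus_left)

lemma scaleR_scaleC: "r *\<^sub>R x = complex_of_real r *\<^sub>C (x::'a::complex_hilbert)"
  by (simp add: scaleC_of_real)

lemma scaleC_sum_right: "c *\<^sub>C (\<Sum>i\<in>I. f i) = (\<Sum>i\<in>I. c *\<^sub>C (f i::'a::complex_hilbert))"
  by (induction I rule: infinite_finite_induct) (auto simp: scaleC_add_right)

lemma cinner_add_right: "cinner x (y + z) = cinner x y + cinner (x::'a::complex_hilbert) z"
  by (metis cinner_add_left cinner_commute complex_cnj_add)

lemma cinner_scaleC_right: "cinner x (c *\<^sub>C y) = cnj c * cinner (x::'a::complex_hilbert) y"
  by (metis cinner_scaleC_left cinner_commute complex_cnj_mult)

lemma cinner_zero_left [simp]: "cinner 0 (x::'a::complex_hilbert) = 0"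
  using cinner_add_left[of 0 0 x] by simp

lemma cinner_zero_right [simp]: "cinner (x::'a::complex_hilbert) 0 = 0"
  using cinner_add_right[of x 0 0] by simp

lemma cinner_minus_left: "cinner (- x) y = - cinner (x::'a::complex_hilbert) y"
  using cinner_add_left[of x "-x" y] by (simp add: eq_neg_iff_add_eq_0 add.commute)

lemma cinner_minus_right: "cinner x (- y) = - cinner (x::'a::complex_hilbert) y"
  using cinner_add_right[of x y "-y"] by (simp add: eq_neg_iff_add_eq_0 add.commute)

lemma cinner_diff_left: "cinner (x - y) z = cinner x z - cinner (y::'a::complex_hilbert) z"
  using cinner_add_left[of x "-y" z] by (simp add: cinner_minus_left)

lemma cinner_diff_right: "cinner x (y - z) = cinner x y - cinner (x::'a::complex_hilbert) z"
  using cinner_add_right[of x y "-z"] by (simp add: cinner_minus_right)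

lemma cinner_sum_left: "cinner (\<Sum>i\<in>I. f i) y = (\<Sum>i\<in>I. cinner (f i::'a::complex_hilbert) y)"
  by (induction I rule: infinite_finite_induct) (auto simp: cinner_add_left)

lemma cinner_sum_right: "cinner y (\<Sum>i\<in>I. f i) = (\<Sum>i\<in>I. cinner y (f i::'a::complex_hilbert))"
  by (induction I rule: infinite_finite_induct) (auto simp: cinner_add_right)

lemmas cinner_simps = cinner_add_left cinner_add_right cinner_diff_left cinner_diff_right
  cinner_minus_left cinner_minus_right cinner_scaleC_left cinner_scaleC_right

lemma Re_cinner_self [simp]: "Re (cinner x x) = (norm (x::'a::complex_hilbert))\<^sup>2"
  and Im_cinner_self [simp]: "Im (cinner x x) = 0"
  by (simp_all add: cinner_self)

lemma norm_scaleC: "norm (c *\<^sub>C x) = cmod c * norm (x::'a::complex_hilbert)"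
proof -
  have "complex_of_real ((norm (c *\<^sub>C x))\<^sup>2) = c * cnj c * cinner x x"
    unfolding cinner_self[symmetric] by (simp add: cinner_scaleC_left cinner_scaleC_right)
  also have "\<dots> = complex_of_real ((cmod c * norm x)\<^sup>2)"
    by (simp add: cinner_self power_mult_distrib complex_norm_square[symmetric] del: of_real_power)
  finally have "(norm (c *\<^sub>C x))\<^sup>2 = (cmod c * norm x)\<^sup>2"
    using of_real_eq_iff by blast
  then show ?thesis by (simp add: power2_eq_iff_nonneg)
qed

subsection \<open>Bounded operators\<close>

lemma bounded_clinear_linear:
  assumes "bounded_clinear T"
  shows "T (x + y) = T x + T y" "T (c *\<^sub>C x) = c *\<^sub>C T x" "T 0 = 0" "T (x - y) = T x - T y"
    "T (- x) = - T x" "T (\<Sum>i\<in>I. f i) = (\<Sum>i\<in>I. T (f i))"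
proof -
  interpret bounded_linear T using assms by (simp add: bounded_clinear_def)
  show "T (x + y) = T x + T y" "T (c *\<^sub>C x) = c *\<^sub>C T x" "T 0 = 0" "T (x - y) = T x - T y"
    "T (- x) = - T x" "T (\<Sum>i\<in>I. f i) = (\<Sum>i\<in>I. T (f i))"
    using assms by (auto simp: bounded_clinear_def add diff zero neg sum)
qed

lemma bounded_clinear_bound:
  assumes "bounded_clinear T"
  obtains K where "K > 0" "\<And>x. norm (T x) \<le> K * norm x"
proof -
  interpret bounded_linear T using assms by (simp add: bounded_clinear_def)
  from pos_bounded obtain K where "K > 0" "\<And>x. norm (T x) \<le> norm x * K" by auto
  then show ?thesis using that[of K] by (simp add: mult.commute)
qed

lemma bounded_clinearI:
  assumes "\<And>x y. T (x + y) = T x + T y" "\<And>c x. T (c *\<^sub>C x) = c *\<^sub>C T x" "\<And>x. norm (T x) \<le> K * norm x"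
  shows "bounded_clinear T"
  unfolding bounded_clinear_def
proof (intro conjI allI)
  show "bounded_linear T"
    by (rule bounded_linear_intro[where K = K])
       (use assms in \<open>auto simp: scaleR_scaleC mult.commute\<close>)
qed (use assms in auto)

lemma positive_op_nonneg: "positive_op W \<Longrightarrow> 0 \<le> Re (cinner (W x) x)"
  and positive_op_real: "positive_op W \<Longrightarrow> Im (cinner (W x) x) = 0"
  by (auto simp: positive_op_def complex_nonneg_Reals_iff)

lemma positive_op_clinear: "positive_op W \<Longrightarrow> bounded_clinear W"
  by (simp add: positive_op_def)

text \<open>Polarization: over the complex numbers a form with real diagonal values is Hermitian.\<close>

lemma positive_op_commute:
  assumes W: "positive_op W"
  shows "cinner (W x) y = cnj (cinner (W y) x)"
proof -
  note lin = bounded_clinear_linear[OF positive_op_clinear[OF W]]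
  have "Im (cinner (W (x + y)) (x + y)) = 0" "Im (cinner (W (x + \<i> *\<^sub>C y)) (x + \<i> *\<^sub>C y)) = 0"
    "Im (cinner (W x) x) = 0" "Im (cinner (W y) y) = 0"
    using positive_op_real[OF W] by auto
  then show ?thesis
    by (auto simp: lin cinner_simps complex_eq_iff algebra_simps)
qed

lemma positive_op_commute':
  assumes W: "positive_op W"
  shows "cinner (W x) y = cinner x (W y)"
  using positive_op_commute[OF W, of x y] cinner_commute[of x "W y"] by simp

text \<open>The quadratic form of \<open>W\<close> along the line in direction \<open>\<langle>W x, y\<rangle> y\<close>. Positivity for all \<open>t\<close>
  yields Cauchy--Schwarz; for \<open>W = I\<close> the same expansion gives orthogonality to a nearest point.\<close>

lemma Re_form_expand:
  assumes W: "positive_op W"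
  shows "Re (cinner (W (x - (complex_of_real t * cinner (W x) y) *\<^sub>C y)) (x - (complex_of_real t * cinner (W x) y) *\<^sub>C y))
     = Re (cinner (W x) x) - 2 * t * (cmod (cinner (W x) y))\<^sup>2 + t\<^sup>2 * (cmod (cinner (W x) y))\<^sup>2 * Re (cinner (W y) y)"
proof -
  note lin = bounded_clinear_linear[OF positive_op_clinear[OF W]]
  define a where "a = cinner (W x) y"
  have yx: "cinner (W y) x = cnj a"
    unfolding a_def using positive_op_commute[OF W, of y x] by simp
  show ?thesis
    unfolding a_def[symmetric]
    by (simp add: lin cinner_simps yx a_def[symmetric] positive_op_real[OF W] cmod_power2)
       (simp add: algebra_simps power2_eq_square)
qed

lemma quadratic_vanish:
  fixes p s q :: real
  assumes "\<And>t. 0 \<le> p - 2 * t * s + t\<^sup>2 * s * q" "0 \<le> s" "0 \<le> q"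
  shows "s \<le> p * q"
proof (cases "q = 0")
  case True
  have "s = 0"
  proof (rule ccontr)
    assume "s \<noteq> 0"
    with assms(1)[of "(p + 1) / (2 * s)"] True show False by (simp add: field_simps)
  qed
  with True show ?thesis by simp
next
  case False
  \<comment> \<open>\<open>1 / q\<close> is the minimizer of the quadratic polynomial.\<close>
  with assms(1)[of "1 / q"] \<open>0 \<le> q\<close> show ?thesis
    by (simp add: field_simps power2_eq_square)
qed

lemma form_Cauchy_Schwarz:
  assumes W: "positive_op W"
  shows "(cmod (cinner (W x) y))\<^sup>2 \<le> Re (cinner (W x) x) * Re (cinner (W y) y)"
proof (rule quadratic_vanish)
  show "0 \<le> Re (cinner (W x) x) - 2 * t * (cmod (cinner (W x) y))\<^sup>2 + t\<^sup>2 * (cmod (cinner (W x) y))\<^sup>2 * Re (cinner (W y) y)" for t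
    unfolding Re_form_expand[OF W, symmetric] by (rule positive_op_nonneg[OF W])
qed (use positive_op_nonneg[OF W] in auto)

lemma positive_op_id: "positive_op (\<lambda>x::'a::complex_hilbert. x)"
  by (auto simp: positive_op_def complex_nonneg_Reals_iff intro!: bounded_clinearI[where K=1])

lemma cinner_Cauchy_Schwarz: "cmod (cinner x y) \<le> norm (x::'a::complex_hilbert) * norm y"
  by (rule power2_le_imp_le)
     (use form_Cauchy_Schwarz[OF positive_op_id, of x y] in \<open>simp_all add: power_mult_distrib\<close>)

lemma cinner_right_eqI:
  assumes "\<And>y. cinner x y = cinner (x'::'a::complex_hilbert) y"
  shows "x = x'"
proof -
  have "cinner (x - x') (x - x') = 0" using assms[of "x - x'"] by (simp add: cinner_diff_left)
  then show ?thesis by (simp add: cinner_self)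
qed

lemma bounded_linear_cinner_left: "bounded_linear (\<lambda>x. cinner x (y::'a::complex_hilbert))"
  by (rule bounded_linear_intro[where K = "norm y"])
     (auto simp: cinner_simps scaleR_scaleC scaleR_conv_of_real cinner_Cauchy_Schwarz)

lemmas tendsto_cinner_left = bounded_linear.tendsto[OF bounded_linear_cinner_left]

lemma tendsto_scaleC_left:
  "(f \<longlongrightarrow> c) F \<Longrightarrow> ((\<lambda>n. f n *\<^sub>C (y::'a::complex_hilbert)) \<longlongrightarrow> c *\<^sub>C y) F"
  by (rule bounded_linear.tendsto[where f = "\<lambda>c. c *\<^sub>C y"])
     (rule bounded_linear_intro[where K = "norm y"],
       auto simp: scaleC_add_left scaleR_scaleC scaleC_scaleC norm_scaleC scaleR_conv_of_real)

lemma bounded_linear_scaleC_right: "bounded_linear (\<lambda>x::'a::complex_hilbert. c *\<^sub>C x)"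
  by (rule bounded_linear_intro[where K = "cmod c"])
     (auto simp: scaleC_add_right scaleR_scaleC scaleC_scaleC norm_scaleC mult.commute)

lemmas tendsto_scaleC_right = bounded_linear.tendsto[OF bounded_linear_scaleC_right]

lemma parallelogram:
  "(norm (x + y))\<^sup>2 + (norm (x - y))\<^sup>2 = 2 * (norm (x::'a::complex_hilbert))\<^sup>2 + 2 * (norm y)\<^sup>2"
proof -
  have "Re (cinner (x + y) (x + y)) + Re (cinner (x - y) (x - y)) = 2 * Re (cinner x x) + 2 * Re (cinner y y)"
    by (simp only: cinner_simps) simp
  then show ?thesis by simp
qed

text \<open>The projection theorem: a vector outside minus its nearest point in the subspace, which exists since
  minimizing sequences are Cauchy by the parallelogram law.\<close>

lemma exists_orthogonal:
  fixes R :: "'a::complex_hilbert set"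
  assumes "closed R" "0 \<in> R" "R \<noteq> UNIV"
    and add: "\<And>x y. x \<in> R \<Longrightarrow> y \<in> R \<Longrightarrow> x + y \<in> R"
    and scale: "\<And>c x. x \<in> R \<Longrightarrow> c *\<^sub>C x \<in> R"
  obtains y where "y \<noteq> 0" "\<And>r. r \<in> R \<Longrightarrow> cinner r y = 0"
proof -
  obtain x where x: "x \<notin> R" using \<open>R \<noteq> UNIV\<close> by auto
  define d where "d = infdist x R"
  have d_le: "d \<le> norm (x - r)" if "r \<in> R" for r
    using infdist_le[OF that, of x] by (simp add: d_def dist_norm)
  have d0: "d \<ge> 0" by (simp add: d_def infdist_nonneg)
  have "\<exists>r\<in>R. norm (x - r) < d + 1 / real (Suc n)" for n
  proof (rule ccontr)
    assume "\<not> ?thesis"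
    then have "d + 1 / real (Suc n) \<le> d"
      unfolding d_def using \<open>0 \<in> R\<close>
      by (subst (2) infdist_notempty) (auto intro!: cINF_greatest simp: dist_norm not_less d_def)
    then show False by simp
  qed
  then obtain r where rR: "\<And>n. r n \<in> R" and rd: "\<And>n. norm (x - r n) < d + 1 / real (Suc n)" by metis
  have lim: "(\<lambda>n. norm (x - r n)) \<longlonglongrightarrow> d"
  proof (rule tendsto_sandwich[where f = "\<lambda>_. d" and h = "\<lambda>n. d + 1 / real (Suc n)"])
    show "(\<lambda>n. d + 1 / real (Suc n)) \<longlonglongrightarrow> d"
      using tendsto_add[OF tendsto_const[of d] LIMSEQ_inverse_real_of_nat] by (simp add: inverse_eq_divide)
  qed (use d_le rR rd in \<open>auto intro!: always_eventually less_imp_le\<close>)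
  have par: "(norm (r m - r n))\<^sup>2 \<le> 2 * ((norm (x - r m))\<^sup>2 - d\<^sup>2) + 2 * ((norm (x - r n))\<^sup>2 - d\<^sup>2)" for m n
  proof -
    have mid: "(1/2) *\<^sub>C (r m + r n) \<in> R" using rR by (intro scale add)
    have "(x - r m) + (x - r n) = 2 *\<^sub>C (x - (1/2) *\<^sub>C (r m + r n))"
      by (simp add: scaleC_diff_right scaleC_scaleC)
         (metis add_diff_add one_add_one scaleC_add_left scaleC_one)
    then have "norm ((x - r m) + (x - r n)) = 2 * norm (x - (1/2) *\<^sub>C (r m + r n))"
      by (simp add: norm_scaleC)
    then have "2 * d \<le> norm ((x - r m) + (x - r n))" using d_le[OF mid] by simp
    then have "(2 * d)\<^sup>2 \<le> (norm ((x - r m) + (x - r n)))\<^sup>2" using d0 by (intro power_mono) auto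
    moreover have "norm ((x - r m) - (x - r n)) = norm (r m - r n)" by (simp add: norm_minus_commute)
    ultimately show ?thesis using parallelogram[of "x - r m" "x - r n"] by (simp add: power2_eq_square)
  qed
  have "Cauchy r"
  proof (rule CauchyI)
    fix e :: real assume "e > 0"
    have "(\<lambda>n. (norm (x - r n))\<^sup>2 - d\<^sup>2) \<longlonglongrightarrow> d\<^sup>2 - d\<^sup>2" by (intro tendsto_intros lim)
    then have "\<forall>\<^sub>F n in sequentially. (norm (x - r n))\<^sup>2 - d\<^sup>2 < e\<^sup>2 / 4"
      using \<open>e > 0\<close> by (intro order_tendstoD) auto
    then obtain N where N: "\<And>n. n \<ge> N \<Longrightarrow> (norm (x - r n))\<^sup>2 - d\<^sup>2 < e\<^sup>2 / 4"
      by (auto simp: eventually_sequentially)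
    show "\<exists>M. \<forall>m\<ge>M. \<forall>n\<ge>M. norm (r m - r n) < e"
    proof (intro exI allI impI)
      fix m n assume "m \<ge> N" "n \<ge> N"
      then have "(norm (x - r m))\<^sup>2 - d\<^sup>2 < e\<^sup>2 / 4" "(norm (x - r n))\<^sup>2 - d\<^sup>2 < e\<^sup>2 / 4"
        using N by auto
      then have "(norm (r m - r n))\<^sup>2 < e\<^sup>2" using par[of m n] by (simp add: field_simps)
      then show "norm (r m - r n) < e" using \<open>e > 0\<close> by (simp add: power_less_imp_less_base)
    qed
  qed
  then obtain l where l: "r \<longlonglongrightarrow> l" using Cauchy_convergent convergent_def by blast
  have lR: "l \<in> R" using \<open>closed R\<close> l rR closed_sequentially by blast
  have nl: "norm (x - l) = d"
    using LIMSEQ_unique[OF tendsto_norm[OF tendsto_diff[OF tendsto_const l]] lim] .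
  show ?thesis
  proof
    show "x - l \<noteq> 0" using x lR by auto
    fix s assume s: "s \<in> R"
    have "(cmod (cinner (x - l) s))\<^sup>2 \<le> 0 * (norm s)\<^sup>2"
    proof (rule quadratic_vanish)
      fix t
      define c where "c = complex_of_real t * cinner (x - l) s"
      have "d \<le> norm (x - (l + c *\<^sub>C s))" by (intro d_le add scale lR s)
      then have "d\<^sup>2 \<le> (norm (x - l - c *\<^sub>C s))\<^sup>2" using d0 by (simp add: diff_diff_add power_mono)
      also have "\<dots> = d\<^sup>2 - 2 * t * (cmod (cinner (x - l) s))\<^sup>2 + t\<^sup>2 * (cmod (cinner (x - l) s))\<^sup>2 * (norm s)\<^sup>2"
        using Re_form_expand[OF positive_op_id, of "x - l" t s] nl by (simp add: c_def)
      finally show "0 \<le> 0 - 2 * t * (cmod (cinner (x - l) s))\<^sup>2 + t\<^sup>2 * (cmod (cinner (x - l) s))\<^sup>2 * (norm s)\<^sup>2" by simp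
    qed auto
    then have "cinner (x - l) s = 0" by simp
    then show "cinner s (x - l) = 0" using cinner_commute[of s "x - l"] by simp
  qed
qed


section \<open>Maximal accumulative operators and their resolvents\<close>

text \<open>A working form of maximality: solvability of \<open>(A - z) h = y\<close> for \<open>Im z > 0\<close> instead of the absence of
  extensions. It passes to rank-one perturbations by an explicit solution of the perturbed equation.\<close>

definition m_accumulative :: "'a::complex_hilbert set \<Rightarrow> ('a \<Rightarrow> 'a) \<Rightarrow> bool" where
  "m_accumulative D A \<longleftrightarrow> linear_operator D A \<and> (\<forall>h\<in>D. Im (cinner (A h) h) \<le> 0) \<and>
     (\<forall>z y. Im z > 0 \<longrightarrow> (\<exists>h\<in>D. A h - z *\<^sub>C h = y))"

lemma linear_operatorD:
  assumes "linear_operator D A"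
  shows "0 \<in> D" "x \<in> D \<Longrightarrow> y \<in> D \<Longrightarrow> x + y \<in> D" "x \<in> D \<Longrightarrow> y \<in> D \<Longrightarrow> A (x + y) = A x + A y"
    "x \<in> D \<Longrightarrow> c *\<^sub>C x \<in> D" "x \<in> D \<Longrightarrow> A (c *\<^sub>C x) = c *\<^sub>C A x"
    "x \<in> D \<Longrightarrow> y \<in> D \<Longrightarrow> x - y \<in> D" "x \<in> D \<Longrightarrow> y \<in> D \<Longrightarrow> A (x - y) = A x - A y" "A 0 = 0"
proof -
  show 1: "0 \<in> D" "x \<in> D \<Longrightarrow> y \<in> D \<Longrightarrow> x + y \<in> D" "x \<in> D \<Longrightarrow> y \<in> D \<Longrightarrow> A (x + y) = A x + A y"
    "x \<in> D \<Longrightarrow> c *\<^sub>C x \<in> D" "x \<in> D \<Longrightarrow> A (c *\<^sub>C x) = c *\<^sub>C A x" for x y c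
    using assms by (auto simp: linear_operator_def)
  have m: "- y = (-1) *\<^sub>C y" for y :: 'a by (simp add: scaleC_minus_left)
  show "x \<in> D \<Longrightarrow> y \<in> D \<Longrightarrow> x - y \<in> D" "x \<in> D \<Longrightarrow> y \<in> D \<Longrightarrow> A (x - y) = A x - A y"
    using 1(2,3)[of x "-y"] 1(4,5)[of y "-1"] by (simp_all add: scaleC_minus_left)
  show "A 0 = 0" using 1(5)[of 0 0] 1(1) by simp
qed

lemma accumulative_lower_bound:
  assumes "linear_operator D A" "\<And>h. h \<in> D \<Longrightarrow> Im (cinner (A h) h) \<le> 0" "Im z > 0" "h \<in> D"
  shows "Im z * norm h \<le> norm (A h - z *\<^sub>C h)"
proof (cases "h = 0")
  case False
  have "Im z * (norm h)\<^sup>2 \<le> - Im (cinner (A h - z *\<^sub>C h) h)"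
    using assms(2)[OF \<open>h \<in> D\<close>] by (simp add: cinner_simps)
  also have "\<dots> \<le> cmod (cinner (A h - z *\<^sub>C h) h)"
    using abs_Im_le_cmod[of "cinner (A h - z *\<^sub>C h) h"] by linarith
  also have "\<dots> \<le> norm (A h - z *\<^sub>C h) * norm h" by (rule cinner_Cauchy_Schwarz)
  finally show ?thesis using False by (simp add: power2_eq_square)
qed simp

text \<open>If \<open>A - z\<close> missed a direction, a vector \<open>y\<close> orthogonal to its range could be added to the
  domain with \<open>A y = cnj z *\<^sub>C y\<close>. The cross terms of the quadratic form are then real, and the new
  diagonal term has negative imaginary part, so the extension is still accumulative.\<close>

lemma maximal_accumulative_imp_m_accumulative:
  assumes max: "maximal_accumulative D A"
  shows "m_accumulative D A"
proof -
  have acc: "accumulative D A" using max by (simp add: maximal_accumulative_def)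
  then have lin: "linear_operator D A" and clo: "closed ((\<lambda>x. (x, A x)) ` D)" and dense: "closure D = UNIV"
    and Im_le: "\<And>h. h \<in> D \<Longrightarrow> Im (cinner (A h) h) \<le> 0"
    by (auto simp: accumulative_def closed_operator_def)
  note linD = linear_operatorD[OF lin]
  have graph: "l \<in> D \<and> A l = w"
    if "\<And>n. h n \<in> D" "h \<longlonglongrightarrow> l" "(\<lambda>n. A (h n)) \<longlonglongrightarrow> w" for h :: "nat \<Rightarrow> 'a" and l w
  proof -
    have "(\<lambda>n. (h n, A (h n))) \<longlonglongrightarrow> (l, w)" using that by (intro tendsto_Pair)
    then have "(l, w) \<in> (\<lambda>x. (x, A x)) ` D"
      by (rule closed_sequentially[OF clo, rotated]) (use that(1) in auto)
    then show ?thesis by auto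
  qed
  have surj: "\<exists>h\<in>D. A h - z *\<^sub>C h = y0" if z: "Im z > 0" for z y0
  proof -
    define R where "R = (\<lambda>h. A h - z *\<^sub>C h) ` D"
    note lower = accumulative_lower_bound[OF lin Im_le z]
    have conv: "\<exists>l. f \<longlonglongrightarrow> l"
      if f: "\<And>n. f n \<in> D" and g: "Cauchy (\<lambda>n. A (f n) - z *\<^sub>C f n)" for f :: "nat \<Rightarrow> 'a"
    proof -
      have "Cauchy f"
      proof (rule CauchyI)
        fix e :: real assume "e > 0"
        then have "e * Im z > 0" using z by simp
        with g obtain M where M: "\<And>m n. m \<ge> M \<Longrightarrow> n \<ge> M \<Longrightarrow>
            norm ((A (f m) - z *\<^sub>C f m) - (A (f n) - z *\<^sub>C f n)) < e * Im z"
          unfolding Cauchy_iff by meson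
        show "\<exists>M. \<forall>m\<ge>M. \<forall>n\<ge>M. norm (f m - f n) < e"
        proof (intro exI allI impI)
          fix m n assume "m \<ge> M" "n \<ge> M"
          have "Im z * norm (f m - f n) \<le> norm (A (f m - f n) - z *\<^sub>C (f m - f n))"
            by (intro lower linD f)
          also have "\<dots> = norm ((A (f m) - z *\<^sub>C f m) - (A (f n) - z *\<^sub>C f n))"
            by (simp add: linD f scaleC_diff_right algebra_simps)
          also have "\<dots> < e * Im z" using M \<open>m \<ge> M\<close> \<open>n \<ge> M\<close> .
          finally show "norm (f m - f n) < e" using z by simp
        qed
      qed
      then show ?thesis using Cauchy_convergent convergent_def by blast
    qed
    have "closed R"
      unfolding closed_sequential_limits
    proof (intro allI impI, elim conjE)
      fix g l assume "\<forall>n. g n \<in> R" and gl: "g \<longlonglongrightarrow> l"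
      then obtain f where f: "\<And>n. f n \<in> D" "\<And>n. g n = A (f n) - z *\<^sub>C f n" unfolding R_def image_iff by metis
      have "Cauchy (\<lambda>n. A (f n) - z *\<^sub>C f n)" using LIMSEQ_imp_Cauchy[OF gl] by (simp add: f(2)[abs_def])
      from conv[OF f(1) this] obtain k where k: "f \<longlonglongrightarrow> k" by auto
      have "(\<lambda>n. g n + z *\<^sub>C f n) \<longlonglongrightarrow> l + z *\<^sub>C k"
        by (intro tendsto_add gl tendsto_scaleC_right k)
      then have "(\<lambda>n. A (f n)) \<longlonglongrightarrow> l + z *\<^sub>C k" by (simp add: f(2))
      from graph[OF f(1) k this] show "l \<in> R" unfolding R_def by (intro image_eqI[of _ _ k]) auto
    qed
    have "R = UNIV"
    proof (rule ccontr)
      assume "R \<noteq> UNIV"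
      moreover have "0 \<in> R" unfolding R_def by (rule image_eqI[of _ _ 0]) (simp_all add: linD)
      moreover have "a + b \<in> R" if "a \<in> R" "b \<in> R" for a b
      proof -
        from that obtain f g where "f \<in> D" "g \<in> D" "a = A f - z *\<^sub>C f" "b = A g - z *\<^sub>C g"
          by (auto simp: R_def)
        then show ?thesis unfolding R_def
          by (intro image_eqI[of _ _ "f + g"]) (simp_all add: linD scaleC_add_right)
      qed
      moreover have "c *\<^sub>C a \<in> R" if "a \<in> R" for a c
      proof -
        from that obtain f where "f \<in> D" "a = A f - z *\<^sub>C f" by (auto simp: R_def)
        then show ?thesis unfolding R_def
          by (intro image_eqI[of _ _ "c *\<^sub>C f"])
             (simp_all add: linD scaleC_diff_right scaleC_scaleC mult.commute)
      qed
      ultimately obtain y where y0: "y \<noteq> 0" and yR: "\<And>r. r \<in> R \<Longrightarrow> cinner r y = 0"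
        using exists_orthogonal[OF \<open>closed R\<close>] by metis
      have y_orth: "cinner (A h) y = z * cinner h y" if "h \<in> D" for h
        using yR[of "A h - z *\<^sub>C h"] that by (auto simp: R_def cinner_simps)
      \<comment> \<open>Otherwise \<open>\<langle>A y, y\<rangle> = z \<parallel>y\<parallel>\<^sup>2\<close> would have positive imaginary part.\<close>
      have yD: "y \<notin> D"
      proof
        assume "y \<in> D"
        from Im_le[OF this] y_orth[OF this] have "Im z * (norm y)\<^sup>2 \<le> 0"
          by (simp add: cinner_self)
        then show False using z y0 by (simp add: mult_le_0_iff)
      qed
      define D' where "D' = (\<lambda>(h, c). h + c *\<^sub>C y) ` (D \<times> UNIV)"
      have uniq: "h = h' \<and> c = c'" if "h + c *\<^sub>C y = h' + c' *\<^sub>C y" "h \<in> D" "h' \<in> D" for h h' c c'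
      proof -
        have eq: "(c - c') *\<^sub>C y = h' - h" using that(1) by (simp add: scaleC_diff_left algebra_simps)
        have "c = c'"
        proof (rule ccontr)
          assume "c \<noteq> c'"
          then have "y = inverse (c - c') *\<^sub>C (h' - h)" unfolding eq[symmetric] by (simp add: scaleC_scaleC)
          then show False using yD that by (metis linD(4) linD(6))
        qed
        then show ?thesis using that by simp
      qed
      define A' where "A' = (\<lambda>x. let p = (SOME p. fst p \<in> D \<and> x = fst p + snd p *\<^sub>C y) in A (fst p) + (snd p * cnj z) *\<^sub>C y)"
      have A': "A' (h + c *\<^sub>C y) = A h + (c * cnj z) *\<^sub>C y" if "h \<in> D" for h c
      proof -
        have "(SOME p. fst p \<in> D \<and> h + c *\<^sub>C y = fst p + snd p *\<^sub>C y) = (h, c)"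
        proof (rule some_equality)
          fix p assume "fst p \<in> D \<and> h + c *\<^sub>C y = fst p + snd p *\<^sub>C y"
          with uniq[of h c "fst p" "snd p"] that show "p = (h, c)" by (simp add: prod_eq_iff)
        qed (use that in simp)
        then show ?thesis by (simp add: A'_def Let_def)
      qed
      have D'E: "\<exists>h c. h \<in> D \<and> x = h + c *\<^sub>C y" if "x \<in> D'" for x using that by (auto simp: D'_def)
      have D'I: "h + c *\<^sub>C y \<in> D'" if "h \<in> D" for h c using that by (auto simp: D'_def)
      have sub: "D \<subseteq> D'" using D'I[of _ 0] by auto
      have ext: "A' h = A h" if "h \<in> D" for h using A'[OF that, of 0] by simp
      have lin': "linear_operator D' A'"
        unfolding linear_operator_def
      proof (intro conjI ballI allI)
        show "0 \<in> D'" using sub linD by auto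
        fix x v assume "x \<in> D'" "v \<in> D'"
        then obtain h c k d where e: "h \<in> D" "k \<in> D" "x = h + c *\<^sub>C y" "v = k + d *\<^sub>C y" using D'E by metis
        have s: "x + v = (h + k) + (c + d) *\<^sub>C y" by (simp add: e scaleC_add_left)
        show "x + v \<in> D'" unfolding s by (intro D'I linD e)
        show "A' (x + v) = A' x + A' v" unfolding s
          using A'[OF linD(2)[OF e(1,2)], of "c + d"] A'[OF e(1)] A'[OF e(2)]
          by (simp add: linD e distrib_right) (simp add: scaleC_add_left)
      next
        fix c x assume "x \<in> D'"
        then obtain h d where e: "h \<in> D" "x = h + d *\<^sub>C y" using D'E by metis
        have s: "c *\<^sub>C x = c *\<^sub>C h + (c * d) *\<^sub>C y" by (simp add: e scaleC_add_right scaleC_scaleC)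
        show "c *\<^sub>C x \<in> D'" unfolding s by (intro D'I linD e)
        show "A' (c *\<^sub>C x) = c *\<^sub>C A' x" unfolding s
          using A'[OF linD(4)[OF e(1)], of c "c * d"] A'[OF e(1)]
          by (simp add: linD e) (simp add: scaleC_add_right scaleC_scaleC mult.assoc)
      qed
      have Im': "Im (cinner (A' x) x) \<le> 0" if "x \<in> D'" for x
      proof -
        from D'E[OF that] obtain h c where e: "h \<in> D" "x = h + c *\<^sub>C y" by metis
        have yh: "cinner y h = cnj (cinner h y)" by (rule cinner_commute)
        have "cinner (A' x) x = cinner (A h) h + (cnj c * z * cinner h y + cnj (cnj c * z * cinner h y))
            + complex_of_real ((cmod c)\<^sup>2 * (norm y)\<^sup>2) * cnj z"
          unfolding e(2) A'[OF e(1)]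
          by (simp add: cinner_simps y_orth[OF e(1)] yh cinner_self complex_norm_square algebra_simps del: of_real_power)
        then have "Im (cinner (A' x) x) = Im (cinner (A h) h) - (cmod c)\<^sup>2 * (norm y)\<^sup>2 * Im z"
          by (simp add: algebra_simps)
        moreover have "0 \<le> (cmod c)\<^sup>2 * (norm y)\<^sup>2 * Im z" using z by simp
        ultimately show ?thesis using Im_le[OF e(1)] by linarith
      qed
      have "closed ((\<lambda>x. (x, A' x)) ` D')"
        unfolding closed_sequential_limits
      proof (intro allI impI, elim conjE)
        fix g :: "nat \<Rightarrow> 'a \<times> 'a" and l assume g: "\<forall>n. g n \<in> (\<lambda>x. (x, A' x)) ` D'" and gl: "g \<longlonglongrightarrow> l"
        obtain x w where l: "l = (x, w)" by force
        have "\<exists>h c. h \<in> D \<and> g n = (h + c *\<^sub>C y, A h + (c * cnj z) *\<^sub>C y)" for n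
          using g[rule_format, of n] D'E A' by (metis (no_types, lifting) imageE)
        then obtain h c where hD: "\<And>n. h n \<in> D" and gn: "\<And>n. g n = (h n + c n *\<^sub>C y, A (h n) + (c n * cnj z) *\<^sub>C y)"
          by metis
        have x: "(\<lambda>n. h n + c n *\<^sub>C y) \<longlonglongrightarrow> x" and w: "(\<lambda>n. A (h n) + (c n * cnj z) *\<^sub>C y) \<longlonglongrightarrow> w"
          using tendsto_fst[OF gl] tendsto_snd[OF gl] by (simp_all add: gn l)
        \<comment> \<open>The two components of \<open>(A' - z) (h + c y)\<close> are orthogonal, so they converge separately.\<close>
        have diff: "(\<lambda>n. (A (h n) - z *\<^sub>C h n) + (c n * (cnj z - z)) *\<^sub>C y) \<longlonglongrightarrow> w - z *\<^sub>C x"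
          using tendsto_diff[OF w tendsto_scaleC_right[OF x, of z]]
          by (simp add: scaleC_add_right scaleC_diff_left scaleC_scaleC algebra_simps)
        have "(\<lambda>n. cinner ((A (h n) - z *\<^sub>C h n) + (c n * (cnj z - z)) *\<^sub>C y) y) \<longlonglongrightarrow> cinner (w - z *\<^sub>C x) y"
          by (rule tendsto_cinner_left[OF diff])
        then have "(\<lambda>n. c n * ((cnj z - z) * cinner y y)) \<longlonglongrightarrow> cinner (w - z *\<^sub>C x) y"
          using y_orth hD by (simp add: cinner_simps mult.assoc)
        moreover have nz: "(cnj z - z) * cinner y y \<noteq> 0"
          using z y0 by (auto simp: cinner_self complex_eq_iff)
        ultimately have "(\<lambda>n. c n * ((cnj z - z) * cinner y y) / ((cnj z - z) * cinner y y))
            \<longlonglongrightarrow> cinner (w - z *\<^sub>C x) y / ((cnj z - z) * cinner y y)" by (intro tendsto_divide tendsto_const)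
        then obtain c0 where c0: "c \<longlonglongrightarrow> c0" using nz by (auto simp del: mult_eq_0_iff)
        have h: "h \<longlonglongrightarrow> x - c0 *\<^sub>C y"
          using tendsto_diff[OF x tendsto_scaleC_left[OF c0, of y]] by simp
        have "(\<lambda>n. (c n * cnj z) *\<^sub>C y) \<longlonglongrightarrow> (c0 * cnj z) *\<^sub>C y"
          by (intro tendsto_scaleC_left tendsto_mult c0 tendsto_const)
        from tendsto_diff[OF w this] have Ah: "(\<lambda>n. A (h n)) \<longlonglongrightarrow> w - (c0 * cnj z) *\<^sub>C y" by simp
        from graph[OF hD h Ah] have 1: "x - c0 *\<^sub>C y \<in> D" "A (x - c0 *\<^sub>C y) = w - (c0 * cnj z) *\<^sub>C y" by auto
        then show "l \<in> (\<lambda>x. (x, A' x)) ` D'"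
          unfolding l using D'I[OF 1(1), of c0] A'[OF 1(1), of c0] by (intro image_eqI[of _ _ x]) auto
      qed
      moreover have "closure D' = UNIV" using dense closure_mono[OF sub] by auto
      ultimately have "accumulative D' A'"
        using lin' Im' by (auto simp: accumulative_def closed_operator_def)
      with max sub ext have "D' = D" unfolding maximal_accumulative_def by blast
      moreover have "y \<in> D'" using D'I[of 0 1] linD by auto
      ultimately show False using yD by simp
    qed
    then have "y0 \<in> R" by simp
    then show ?thesis by (auto simp: R_def)
  qed
  then show ?thesis using lin Im_le by (auto simp: m_accumulative_def)
qed

subsection \<open>The resolvent in the upper half-plane\<close>

locale m_accumulative_operator =
  fixes D :: "'a::complex_hilbert set" and A :: "'a \<Rightarrow> 'a"
  assumes m_acc: "m_accumulative D A"
begin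

abbreviation "R \<equiv> resolvent D A"

lemma lin: "linear_operator D A" and Im_le: "h \<in> D \<Longrightarrow> Im (cinner (A h) h) \<le> 0"
  and range: "Im z > 0 \<Longrightarrow> \<exists>h\<in>D. A h - z *\<^sub>C h = y"
  using m_acc by (auto simp: m_accumulative_def)

lemmas linD = linear_operatorD[OF lin]

lemma lower_bound: "Im z > 0 \<Longrightarrow> h \<in> D \<Longrightarrow> Im z * norm h \<le> norm (A h - z *\<^sub>C h)"
  using accumulative_lower_bound[OF lin] Im_le by blast

lemma inj: assumes "Im z > 0" shows "inj_on (\<lambda>h. A h - z *\<^sub>C h) D"
proof (rule inj_onI)
  fix x y assume xy: "x \<in> D" "y \<in> D" "A x - z *\<^sub>C x = A y - z *\<^sub>C y"
  have "A (x - y) - z *\<^sub>C (x - y) = (A x - z *\<^sub>C x) - (A y - z *\<^sub>C y)"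
    by (simp add: linD xy(1,2) scaleC_diff_right)
  also have "\<dots> = 0" using xy(3) by simp
  finally have "Im z * norm (x - y) \<le> 0" using lower_bound[OF assms linD(6)[OF xy(1,2)]] by simp
  then show "x = y" using assms by (simp add: mult_le_0_iff)
qed

lemma bij: assumes "Im z > 0" shows "bij_betw (\<lambda>h. A h - z *\<^sub>C h) D UNIV"
  unfolding bij_betw_def using inj[OF assms] range[OF assms] by (auto simp: image_iff) metis

lemma resolvent_in: "Im z > 0 \<Longrightarrow> R z y \<in> D"
  using bij_betwE[OF bij_betw_inv_into[OF bij]] by (auto simp: resolvent_def)

lemma resolvent_eq: "Im z > 0 \<Longrightarrow> A (R z y) - z *\<^sub>C R z y = y"
  using bij_betw_inv_into_right[OF bij, of z y] by (simp add: resolvent_def)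

lemma resolvent_unique: "Im z > 0 \<Longrightarrow> h \<in> D \<Longrightarrow> A h - z *\<^sub>C h = y \<Longrightarrow> R z y = h"
  using inv_into_f_f[OF inj, of z h] by (simp add: resolvent_def)

lemma resolvent_bound: "Im z > 0 \<Longrightarrow> norm (R z y) \<le> norm y / Im z"
  using lower_bound[of z "R z y"] resolvent_in[of z y] resolvent_eq[of z y]
  by (simp add: field_simps)

lemma resolvent_clinear: assumes "Im z > 0" shows "bounded_clinear (R z)"
proof (rule bounded_clinearI)
  note in' = resolvent_in[OF assms] and eq = resolvent_eq[OF assms]
  show "R z (x + y) = R z x + R z y" for x y
    by (rule resolvent_unique[OF assms])
       (use eq[of x] eq[of y] in \<open>simp_all add: linD in' scaleC_add_right algebra_simps\<close>)
  show "R z (c *\<^sub>C x) = c *\<^sub>C R z x" for c x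
  proof (rule resolvent_unique[OF assms])
    have "A (c *\<^sub>C R z x) - z *\<^sub>C c *\<^sub>C R z x = c *\<^sub>C (A (R z x) - z *\<^sub>C R z x)"
      by (simp add: linD in' scaleC_diff_right scaleC_scaleC mult.commute)
    then show "A (c *\<^sub>C R z x) - z *\<^sub>C c *\<^sub>C R z x = c *\<^sub>C x" by (simp add: eq)
  qed (simp add: linD in')
  show "norm (R z x) \<le> (1 / Im z) * norm x" for x using resolvent_bound[OF assms, of x] by simp
qed

lemmas resolvent_linear = bounded_clinear_linear[OF resolvent_clinear]

lemma in_resolvent_set: "Im z > 0 \<Longrightarrow> z \<in> resolvent_set D A"
  using bij resolvent_clinear by (simp add: resolvent_set_def)

lemma resolvent_identity:
  assumes "Im z > 0" "Im w > 0"
  shows "R z y - R w y = (z - w) *\<^sub>C R z (R w y)"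
proof -
  have "R z y = R w y + (z - w) *\<^sub>C R z (R w y)"
  proof (rule resolvent_unique[OF assms(1)])
    let ?u = "R w y"
    have "A (?u + (z - w) *\<^sub>C R z ?u) - z *\<^sub>C (?u + (z - w) *\<^sub>C R z ?u)
        = (A ?u - z *\<^sub>C ?u) + (z - w) *\<^sub>C (A (R z ?u) - z *\<^sub>C R z ?u)"
      by (simp add: linD resolvent_in assms scaleC_add_right scaleC_diff_right scaleC_scaleC mult.commute)
    also have "\<dots> = (A ?u - w *\<^sub>C ?u)"
      by (simp add: resolvent_eq assms scaleC_diff_left)
    finally show "A (?u + (z - w) *\<^sub>C R z ?u) - z *\<^sub>C (?u + (z - w) *\<^sub>C R z ?u) = y"
      by (simp add: resolvent_eq assms)
  qed (simp add: linD resolvent_in assms)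
  then show ?thesis by simp
qed

text \<open>With \<open>h = R z y\<close>, \<open>\<langle>R z y, y\<rangle> = \<langle>h, (A - z) h\<rangle>\<close>, and conjugating reverses the sign of the
  imaginary part.\<close>

lemma Im_resolvent_nonneg:
  assumes "Im z > 0" shows "0 \<le> Im (cinner (R z y) y)"
proof -
  let ?h = "R z y"
  have "Im (cinner ?h (A ?h - z *\<^sub>C ?h)) = - Im (cinner (A ?h) ?h) + Im z * (norm ?h)\<^sup>2"
    using cinner_commute[of ?h "A ?h"] by (simp add: cinner_simps cinner_self)
  moreover have "0 \<le> Im z * (norm ?h)\<^sup>2" using assms by simp
  ultimately show ?thesis using Im_le[OF resolvent_in[OF assms, of y]] by (simp add: resolvent_eq assms)
qed

text \<open>The perturbation determinant of the rank-one step \<open>A - \<i> \<langle>\<cdot>, \<psi>\<rangle> \<psi>\<close>.\<close>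

definition rank_one_det :: "'a \<Rightarrow> complex \<Rightarrow> complex" where
  "rank_one_det \<psi> z = 1 - \<i> * cinner (R z \<psi>) \<psi>"

lemma Re_rank_one_det: "Im z > 0 \<Longrightarrow> 1 \<le> Re (rank_one_det \<psi> z)"
  using Im_resolvent_nonneg[of z \<psi>] by (simp add: rank_one_det_def)

lemma rank_one_det_bound:
  assumes "Im z > 0" shows "cmod (rank_one_det \<psi> z - 1) \<le> (norm \<psi>)\<^sup>2 / Im z"
proof -
  have "cmod (rank_one_det \<psi> z - 1) = cmod (cinner (R z \<psi>) \<psi>)"
    by (simp add: rank_one_det_def norm_mult)
  also have "\<dots> \<le> norm (R z \<psi>) * norm \<psi>" by (rule cinner_Cauchy_Schwarz)
  also have "\<dots> \<le> norm \<psi> / Im z * norm \<psi>" by (intro mult_right_mono resolvent_bound assms) auto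
  finally show ?thesis by (simp add: power2_eq_square)
qed

lemma rank_one_det_holomorphic: "rank_one_det \<psi> holomorphic_on {z. Im z > 0}"
proof -
  have "((\<lambda>z. cinner (R z \<psi>) \<psi>) has_field_derivative cinner (R w (R w \<psi>)) \<psi>) (at w)" if w: "Im w > 0" for w
    unfolding has_field_derivative_iff
  proof (rule Lim_transform_eventually)
    have ev: "\<forall>\<^sub>F z in at w. Im z > Im w / 2"
    proof -
      have "\<forall>\<^sub>F z in nhds w. z \<in> {z. Im z > Im w / 2}"
        by (rule eventually_nhds_in_open[OF open_halfspace_Im_gt]) (use w in simp)
      then show ?thesis by (auto simp: eventually_at_filter elim: eventually_mono)
    qed
    show "\<forall>\<^sub>F z in at w. cinner (R z (R w \<psi>)) \<psi> = (cinner (R z \<psi>) \<psi> - cinner (R w \<psi>) \<psi>) / (z - w)"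
      using ev eventually_neq_at_within[of w w UNIV]
    proof eventually_elim
      case (elim z)
      then have "cinner (R z \<psi> - R w \<psi>) \<psi> = (z - w) * cinner (R z (R w \<psi>)) \<psi>"
        using w by (subst resolvent_identity) (auto simp: cinner_scaleC_left)
      then show ?case using elim by (simp add: cinner_simps field_simps)
    qed
    show "((\<lambda>z. cinner (R z (R w \<psi>)) \<psi>) \<longlongrightarrow> cinner (R w (R w \<psi>)) \<psi>) (at w)"
    proof (rule tendsto_cinner_left, rule LIM_zero_cancel, rule Lim_null_comparison)
      let ?y = "R w \<psi>"
      show "\<forall>\<^sub>F z in at w. norm (R z ?y - R w ?y) \<le> cmod (z - w) * (norm (R w ?y) / (Im w / 2))"
        using ev
      proof eventually_elim
        case (elim z)
        then have "Im z > 0" using w by linarith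
        then have "norm (R z ?y - R w ?y) = cmod (z - w) * norm (R z (R w ?y))"
          using w by (subst resolvent_identity) (auto simp: norm_scaleC)
        also have "\<dots> \<le> cmod (z - w) * (norm (R w ?y) / Im z)"
          by (intro mult_left_mono resolvent_bound) (use \<open>Im z > 0\<close> in auto)
        also have "\<dots> \<le> cmod (z - w) * (norm (R w ?y) / (Im w / 2))"
          by (intro mult_left_mono divide_left_mono) (use elim w \<open>Im z > 0\<close> in auto)
        finally show ?case by simp
      qed
      have "((\<lambda>z. cmod (z - w) * (norm (R w ?y) / (Im w / 2))) \<longlongrightarrow> cmod (w - w) * (norm (R w ?y) / (Im w / 2))) (at w)"
        by (intro tendsto_intros)
      then show "((\<lambda>z. cmod (z - w) * (norm (R w ?y) / (Im w / 2))) \<longlongrightarrow> 0) (at w)" by simp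
    qed
  qed
  then have "(\<lambda>z. cinner (R z \<psi>) \<psi>) holomorphic_on {z. Im z > 0}"
    by (auto simp: holomorphic_on_def field_differentiable_def intro: has_field_derivative_at_within)
  then show ?thesis unfolding rank_one_det_def by (intro holomorphic_intros)
qed

text \<open>For \<open>\<psi>\<close> in the domain, \<open>-\<i> y R(\<i> y) \<psi> = \<psi> - R(\<i> y) A \<psi>\<close>; density and the uniform bound
  \<open>\<parallel>y R(\<i> y)\<parallel> \<le> 1\<close> extend the limit to all vectors.\<close>

lemma rank_one_det_asymptotics:
  assumes dense: "closure D = UNIV"
  shows "((\<lambda>y. y *\<^sub>R (rank_one_det \<psi> (\<i> * complex_of_real y) - 1)) \<longlongrightarrow> complex_of_real ((norm \<psi>)\<^sup>2)) at_top"
proof -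
  define T where "T = (\<lambda>y x. (- \<i> * complex_of_real y) *\<^sub>C R (\<i> * complex_of_real y) x)"
  have T_bound: "norm (T y x) \<le> norm x" if "y > 0" for y x
    using resolvent_bound[of "\<i> * complex_of_real y" x] that
    by (simp add: T_def norm_scaleC norm_mult field_simps)
  have T_diff: "T y (x - x') = T y x - T y x'" if "y > 0" for y x x'
    using that by (simp add: T_def resolvent_linear scaleC_diff_right)
  have TD: "((\<lambda>y. T y x) \<longlongrightarrow> x) at_top" if x: "x \<in> D" for x
  proof (rule LIM_zero_cancel, rule Lim_null_comparison)
    show "\<forall>\<^sub>F y in at_top. norm (T y x - x) \<le> norm (A x) / y"
      using eventually_gt_at_top[of "0::real"]
    proof eventually_elim
      case (elim y)
      let ?z = "\<i> * complex_of_real y"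
      have z: "Im ?z > 0" using elim by simp
      have "x = R ?z (A x - ?z *\<^sub>C x)" using resolvent_unique[OF z x] by simp
      also have "\<dots> = R ?z (A x) + T y x"
        using z by (simp add: resolvent_linear T_def scaleC_minus_left)
      finally have "T y x - x = - R ?z (A x)" by (simp add: algebra_simps)
      then show ?case using resolvent_bound[OF z, of "A x"] elim by simp
    qed
    have "((\<lambda>y. norm (A x) * inverse y) \<longlongrightarrow> norm (A x) * 0) at_top"
      by (intro tendsto_intros tendsto_inverse_0_at_top filterlim_ident)
    then show "((\<lambda>y. norm (A x) / y) \<longlongrightarrow> 0) at_top" by (simp add: field_simps)
  qed
  have T: "((\<lambda>y. T y \<psi>) \<longlongrightarrow> \<psi>) at_top"
  proof (rule tendstoI)
    fix e :: real assume "e > 0"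
    then obtain x where x: "x \<in> D" "dist x \<psi> < e / 3"
      using dense closure_approachable[of \<psi> D] by (metis UNIV_I divide_pos_pos zero_less_numeral)
    have "\<forall>\<^sub>F y in at_top. dist (T y x) x < e / 3" using TD[OF x(1)] \<open>e > 0\<close> by (intro tendstoD) auto
    then show "\<forall>\<^sub>F y in at_top. dist (T y \<psi>) \<psi> < e"
      using eventually_gt_at_top[of "0::real"]
    proof eventually_elim
      case (elim y)
      have "dist (T y \<psi>) (T y x) \<le> dist x \<psi>"
        using T_bound[OF elim(2), of "\<psi> - x"] T_diff[OF elim(2), of \<psi> x]
        by (simp add: dist_norm norm_minus_commute)
      then show ?case using x elim dist_triangle[of "T y \<psi>" \<psi> "T y x"] dist_triangle[of "T y x" \<psi> x] by linarith
    qed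
  qed
  have "((\<lambda>y. cinner (T y \<psi>) \<psi>) \<longlongrightarrow> cinner \<psi> \<psi>) at_top" by (rule tendsto_cinner_left[OF T])
  then show ?thesis
    by (simp add: T_def rank_one_det_def cinner_simps cinner_self scaleR_conv_of_real algebra_simps)
qed

text \<open>The equation \<open>(A - \<i> \<langle>\<cdot>, \<psi>\<rangle> \<psi> - z) x = y\<close> reduces to a scalar one with coefficient
  \<open>rank_one_det \<psi> z\<close>, which does not vanish.\<close>

lemma rank_one_perturbation:
  "m_accumulative D (\<lambda>h. A h - (\<i> * cinner h \<psi>) *\<^sub>C \<psi>)"
  unfolding m_accumulative_def
proof (intro conjI allI impI ballI)
  show "linear_operator D (\<lambda>h. A h - (\<i> * cinner h \<psi>) *\<^sub>C \<psi>)"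
    unfolding linear_operator_def
    by (auto simp: linD cinner_simps distrib_left scaleC_add_left scaleC_diff_right scaleC_scaleC algebra_simps)
  fix h assume h: "h \<in> D"
  have "cinner \<psi> h = cnj (cinner h \<psi>)" by (rule cinner_commute)
  then have "Im (cinner (A h - (\<i> * cinner h \<psi>) *\<^sub>C \<psi>) h) = Im (cinner (A h) h) - (cmod (cinner h \<psi>))\<^sup>2"
    unfolding cmod_power2 by (simp add: cinner_simps power2_eq_square)
  then show "Im (cinner (A h - (\<i> * cinner h \<psi>) *\<^sub>C \<psi>) h) \<le> 0"
    using Im_le[OF h] zero_le_power2[of "cmod (cinner h \<psi>)"] by linarith
next
  fix z y assume z: "0 < Im z"
  have nz: "rank_one_det \<psi> z \<noteq> 0" using Re_rank_one_det[OF z, of \<psi>] by auto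
  define b where "b = cinner (R z y) \<psi> / rank_one_det \<psi> z"
  define x where "x = R z y + (\<i> * b) *\<^sub>C R z \<psi>"
  have "b * rank_one_det \<psi> z = cinner (R z y) \<psi>" using nz by (simp add: b_def)
  then have bx: "cinner x \<psi> = b"
    by (simp add: x_def cinner_simps rank_one_det_def algebra_simps)
  have "A x - z *\<^sub>C x = (A (R z y) - z *\<^sub>C R z y) + (\<i> * b) *\<^sub>C (A (R z \<psi>) - z *\<^sub>C R z \<psi>)"
    by (simp add: x_def linD resolvent_in z scaleC_add_right scaleC_diff_right scaleC_scaleC mult_ac)
  also have "\<dots> = y + (\<i> * b) *\<^sub>C \<psi>" by (simp add: resolvent_eq z)
  finally have "A x - (\<i> * cinner x \<psi>) *\<^sub>C \<psi> - z *\<^sub>C x = y" by (simp add: bx algebra_simps)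
  moreover have "x \<in> D" by (simp add: x_def linD resolvent_in z)
  ultimately show "\<exists>h\<in>D. A h - (\<i> * cinner h \<psi>) *\<^sub>C \<psi> - z *\<^sub>C h = y" by blast
qed

end


section \<open>Principal minors\<close>

text \<open>A determinant by the Leibniz formula over an arbitrary finite index set: the summand of
  \<open>ext_power_trace\<close>.\<close>

definition minor :: "'i set \<Rightarrow> ('i \<Rightarrow> 'i \<Rightarrow> complex) \<Rightarrow> complex" where
  "minor S f = (\<Sum>p | p permutes S. of_int (sign p) * (\<Prod>e\<in>S. f e (p e)))"

lemma minor_cong: "(\<And>i j. i \<in> S \<Longrightarrow> j \<in> S \<Longrightarrow> f i j = g i j) \<Longrightarrow> minor S f = minor S g"
  unfolding minor_def
  by (intro sum.cong prod.cong arg_cong2[of _ _ _ _ "(*)"] refl) (auto simp: permutes_in_image)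

lemma minor_eq_det: "minor {..<n} f = Determinant.det (Matrix.mat n n (\<lambda>(i, j). f i j))"
proof -
  have "Determinant.det (Matrix.mat n n (\<lambda>(i, j). f i j))
      = (\<Sum>p | p permutes {0..<n}. of_int (sign p) * (\<Prod>i = 0..<n. Matrix.mat n n (\<lambda>(i, j). f i j) $$ (i, p i)))"
    by (subst det_def'[of _ n]) auto
  also have "\<dots> = minor {..<n} f"
    unfolding minor_def atLeast0LessThan
  proof (intro sum.cong prod.cong arg_cong2[of _ _ _ _ "(*)"] refl)
    fix p i assume "p \<in> {p. p permutes {..<n}}" "i \<in> {..<n}"
    then show "Matrix.mat n n (\<lambda>(i, j). f i j) $$ (i, p i) = f i (p i)"
      using permutes_in_image[of p "{..<n}" i] by simp
  qed
  finally show ?thesis by simp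
qed

lemma minor_reindex:
  assumes "inj_on h S" "finite S"
  shows "minor (h ` S) f = minor S (\<lambda>i j. f (h i) (h j))"
  unfolding minor_def
proof (rule sum.reindex_bij_witness[where i = "map_permutation S h"
      and j = "map_permutation (h ` S) (inv_into S h)"])
  have bij: "bij_betw h S (h ` S)" using assms(1) by (simp add: bij_betw_def)
  have bij': "bij_betw (inv_into S h) (h ` S) S" by (rule bij_betw_inv_into[OF bij])
  fix p
  {
    assume p: "p \<in> {p. p permutes S}"
    then show "map_permutation S h p \<in> {p. p permutes h ` S}"
      using map_permutation_permutes[OF bij] by auto
    show "map_permutation (h ` S) (inv_into S h) (map_permutation S h p) = p"
      by (rule map_permutation_compose_inv[OF bij]) (use p assms in auto)
  }
  assume p: "p \<in> {p. p permutes h ` S}"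
  then show "map_permutation (h ` S) (inv_into S h) p \<in> {p. p permutes S}"
    using map_permutation_permutes[OF bij'] by auto
  show "map_permutation S h (map_permutation (h ` S) (inv_into S h) p) = p"
    by (rule map_permutation_compose_inv[OF bij']) (use p assms in \<open>auto simp: f_inv_into_f\<close>)
  let ?q = "map_permutation (h ` S) (inv_into S h) p"
  have "sign ?q = sign p"
    by (rule sign_map_permutation) (use p assms in \<open>auto intro: inj_on_inv_into\<close>)
  moreover have "(\<Prod>e\<in>S. f (h e) (h (?q e))) = (\<Prod>e\<in>h ` S. f e (p e))"
    unfolding prod.reindex[OF assms(1)] o_def
  proof (rule prod.cong[OF refl])
    fix e assume e: "e \<in> S"
    have "?q (inv_into S h (h e)) = inv_into S h (p (h e))"
      by (rule map_permutation_apply) (use e assms in \<open>auto intro: inj_on_inv_into\<close>)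
    moreover have "p (h e) \<in> h ` S" using p e by (auto simp: permutes_in_image)
    ultimately show "f (h e) (h (?q e)) = f (h e) (p (h e))" using e assms
      by (simp add: f_inv_into_f)
  qed
  ultimately show "of_int (sign ?q) * (\<Prod>e\<in>S. f (h e) (h (?q e)))
      = of_int (sign p) * (\<Prod>e\<in>h ` S. f e (p e))" by simp
qed

text \<open>Expanding the product of the entries \<open>\<delta> + f\<close> selects a set \<open>S\<close> of factors \<open>f\<close>; the other factors vanish
  unless the permutation fixes the complement of \<open>S\<close>, so that it is a permutation of \<open>S\<close>.\<close>

lemma sum_minors:
  assumes "finite F"
  shows "(\<Sum>S\<in>Pow F. minor S f) = minor F (\<lambda>i j. (if i = j then 1 else 0) + f i j)"
proof -
  have "minor F (\<lambda>i j. (if i = j then 1 else 0) + f i j)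
      = (\<Sum>p | p permutes F. \<Sum>S\<in>Pow F. of_int (sign p) * ((\<Prod>i\<in>S. f i (p i)) * (\<Prod>i\<in>F - S. if i = p i then 1 else 0)))"
    unfolding minor_def
    by (subst add.commute) (simp only: prod_add[OF assms] sum_distrib_left)
  also have "\<dots> = (\<Sum>S\<in>Pow F. \<Sum>p | p permutes F. of_int (sign p) * ((\<Prod>i\<in>S. f i (p i)) * (\<Prod>i\<in>F - S. if i = p i then 1 else 0)))"
    by (rule sum.swap)
  also have "\<dots> = (\<Sum>S\<in>Pow F. minor S f)"
  proof (rule sum.cong[OF refl])
    fix S assume S: "S \<in> Pow F"
    then have fS: "finite S" using assms finite_subset by auto
    have "(\<Sum>p | p permutes F. of_int (sign p) * ((\<Prod>i\<in>S. f i (p i)) * (\<Prod>i\<in>F - S. if i = p i then 1 else 0)))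
        = (\<Sum>p | p permutes S. of_int (sign p) * ((\<Prod>i\<in>S. f i (p i)) * (\<Prod>i\<in>F - S. if i = p i then 1 else 0)))"
    proof (rule sum.mono_neutral_right)
      show "finite {p. p permutes F}" by (rule finite_permutations[OF assms])
      show "{p. p permutes S} \<subseteq> {p. p permutes F}" using S by (auto intro: permutes_subset)
      show "\<forall>p\<in>{p. p permutes F} - {p. p permutes S}.
          of_int (sign p) * ((\<Prod>i\<in>S. f i (p i)) * (\<Prod>i\<in>F - S. if i = p i then 1 else 0)) = 0"
      proof
        fix p assume p: "p \<in> {p. p permutes F} - {p. p permutes S}"
        have "\<exists>i\<in>F - S. i \<noteq> p i"
        proof (rule ccontr)
          assume "\<not> ?thesis"
          have "p permutes S" by (rule permutes_superset[of p F]) (use p \<open>\<not> (\<exists>i\<in>F - S. i \<noteq> p i)\<close> in auto)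
          with p show False by auto
        qed
        then have "(\<Prod>i\<in>F - S. if i = p i then 1 else (0::complex)) = 0"
          using assms by (intro prod_zero) auto
        then show "of_int (sign p) * ((\<Prod>i\<in>S. f i (p i)) * (\<Prod>i\<in>F - S. if i = p i then 1 else 0)) = 0"
          by simp
      qed
    qed
    also have "\<dots> = minor S f"
      unfolding minor_def
    proof (rule sum.cong[OF refl])
      fix p assume "p \<in> {p. p permutes S}"
      then have "(\<Prod>i\<in>F - S. if i = p i then 1 else (0::complex)) = 1"
        by (intro prod.neutral) (auto simp: permutes_not_in)
      then show "of_int (sign p) * ((\<Prod>i\<in>S. f i (p i)) * (\<Prod>i\<in>F - S. if i = p i then 1 else 0))
          = of_int (sign p) * (\<Prod>e\<in>S. f e (p e))" by simp
    qed
    finally show "(\<Sum>p | p permutes F. of_int (sign p) * ((\<Prod>i\<in>S. f i (p i)) * (\<Prod>i\<in>F - S. if i = p i then 1 else 0))) = minor S f" .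
  qed
  finally show ?thesis by simp
qed

subsection \<open>Row operations and block factorizations\<close>

text \<open>Adding to each row a combination of later rows, or to each row a combination of earlier rows, is
  multiplication from the left by a unitriangular matrix.\<close>

lemma det_unitriangular_rows:
  fixes f N :: "nat \<Rightarrow> nat \<Rightarrow> complex"
  assumes "(\<forall>i<n. \<forall>l<n. N i l \<noteq> 0 \<longrightarrow> i < l) \<or> (\<forall>i<n. \<forall>l<n. N i l \<noteq> 0 \<longrightarrow> l < i)"
  shows "Determinant.det (Matrix.mat n n (\<lambda>(i, j). f i j + (\<Sum>l<n. N i l * f l j)))
       = Determinant.det (Matrix.mat n n (\<lambda>(i, j). f i j))"
proof -
  define L where "L = Matrix.mat n n (\<lambda>(i, j). (if i = j then 1 else 0) + N i j)"
  have L: "L \<in> carrier_mat n n" by (simp add: L_def)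
  have diag: "N i i = 0" if "i < n" for i using assms that by blast
  have "prod_list (diag_mat L) = 1"
    by (simp add: prod_list_diag_prod L_def diag)
  then have det: "Determinant.det L = 1"
    using assms
  proof (elim disjE)
    assume *: "\<forall>i<n. \<forall>l<n. N i l \<noteq> 0 \<longrightarrow> i < l" and 1: "prod_list (diag_mat L) = 1"
    have "upper_triangular L" using * by (auto simp: upper_triangular_def L_def) (meson less_asym less_trans)
    from det_upper_triangular[OF this L] 1 show ?thesis by simp
  next
    assume *: "\<forall>i<n. \<forall>l<n. N i l \<noteq> 0 \<longrightarrow> l < i" and 1: "prod_list (diag_mat L) = 1"
    have "L $$ (i, j) = 0" if "i < j" "j < n" for i j
      using * that by (auto simp: L_def) (meson less_asym less_trans)
    from det_lower_triangular[OF this L] 1 show ?thesis by simp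
  qed
  have "Matrix.mat n n (\<lambda>(i, j). f i j + (\<Sum>l<n. N i l * f l j)) = L * Matrix.mat n n (\<lambda>(i, j). f i j)"
    by (rule eq_matI)
       (auto simp: L_def scalar_prod_def distrib_right sum.distrib if_distrib[of "\<lambda>x. x * _"] lessThan_atLeast0
         cong: if_cong)
  then show ?thesis using det by (simp add: det_mult[OF L])
qed

text \<open>Sylvester's identity, from two factorizations of the block matrix \<open>[I, -X; Y, I]\<close> into triangular ones.\<close>

lemma det_one_plus_commute:
  fixes X Y :: "nat \<Rightarrow> nat \<Rightarrow> complex"
  shows "Determinant.det (Matrix.mat M M (\<lambda>(i, j). (if i = j then 1 else 0) + (\<Sum>n<N. X i n * Y n j)))
       = Determinant.det (Matrix.mat N N (\<lambda>(n, m). (if n = m then 1 else 0) + (\<Sum>i<M. Y n i * X i m)))"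
proof -
  define X' where "X' = Matrix.mat M N (\<lambda>(i, n). X i n)"
  define Y' where "Y' = Matrix.mat N M (\<lambda>(n, i). Y n i)"
  have X': "X' \<in> carrier_mat M N" and Y': "Y' \<in> carrier_mat N M" by (simp_all add: X'_def Y'_def)
  have 1: "Matrix.mat M M (\<lambda>(i, j). (if i = j then 1 else 0) + (\<Sum>n<N. X i n * Y n j)) = 1\<^sub>m M + X' * Y'"
    by (rule eq_matI) (auto simp: X'_def Y'_def scalar_prod_def lessThan_atLeast0)
  have 2: "Matrix.mat N N (\<lambda>(n, m). (if n = m then 1 else 0) + (\<Sum>i<M. Y n i * X i m)) = 1\<^sub>m N + Y' * X'"
    by (rule eq_matI) (auto simp: X'_def Y'_def scalar_prod_def lessThan_atLeast0)
  define Z where "Z = four_block_mat (1\<^sub>m M) (- X') Y' (1\<^sub>m N)"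
  have XY: "X' * Y' \<in> carrier_mat M M" and YX: "Y' * X' \<in> carrier_mat N N" using X' Y' by auto
  have nX: "- X' \<in> carrier_mat M N" using X' by auto
  have "Z = four_block_mat (1\<^sub>m M) (0\<^sub>m M N) Y' (1\<^sub>m N) * four_block_mat (1\<^sub>m M) (- X') (0\<^sub>m N M) (1\<^sub>m N + Y' * X')"
    unfolding Z_def
    by (subst mult_four_block_mat[where ?nr1.0 = M and ?n1.0 = M and ?n2.0 = N and ?nr2.0 = N and ?nc1.0 = M and ?nc2.0 = N])
       (use X' Y' YX nX in \<open>auto intro!: arg_cong4[where f = four_block_mat] eq_matI simp: comm_add_mat\<close>)
  then have d1: "Determinant.det Z = Determinant.det (1\<^sub>m N + Y' * X')"
    using X' Y' YX nX
    by (simp add: det_mult[where n = "M + N"] det_four_block_mat_upper_right_zero[where n = M and m = N]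
        det_four_block_mat_lower_left_zero[where n = M and m = N])
  have "Z = four_block_mat (1\<^sub>m M + X' * Y') (- X') (0\<^sub>m N M) (1\<^sub>m N) * four_block_mat (1\<^sub>m M) (0\<^sub>m M N) Y' (1\<^sub>m N)"
    unfolding Z_def
    by (subst mult_four_block_mat[where ?nr1.0 = M and ?n1.0 = M and ?n2.0 = N and ?nr2.0 = N and ?nc1.0 = M and ?nc2.0 = N])
       (use X' Y' XY nX in \<open>auto intro!: arg_cong4[where f = four_block_mat] eq_matI simp: comm_add_mat\<close>)
  then have d2: "Determinant.det Z = Determinant.det (1\<^sub>m M + X' * Y')"
    using X' Y' XY nX
    by (simp add: det_mult[where n = "M + N"] det_four_block_mat_upper_right_zero[where n = M and m = N]
        det_four_block_mat_lower_left_zero[where n = M and m = N])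
  show ?thesis unfolding 1 2 using d1 d2 by simp
qed

lemma det_last_row_zero:
  fixes f :: "nat \<Rightarrow> nat \<Rightarrow> complex"
  assumes "\<And>j. j < k \<Longrightarrow> f k j = 0"
  shows "Determinant.det (Matrix.mat (Suc k) (Suc k) (\<lambda>(i, j). f i j))
    = f k k * Determinant.det (Matrix.mat k k (\<lambda>(i, j). f i j))"
proof -
  let ?M = "Matrix.mat (Suc k) (Suc k) (\<lambda>(i, j). f i j)"
  have "Determinant.det ?M = (\<Sum>j<Suc k. ?M $$ (k, j) * cofactor ?M k j)"
    by (rule laplace_expansion_row) auto
  also have "\<dots> = f k k * cofactor ?M k k" using assms by simp
  also have "mat_delete ?M k k = Matrix.mat k k (\<lambda>(i, j). f i j)"
    by (rule eq_matI) (auto simp: mat_delete_def)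
  then have "cofactor ?M k k = Determinant.det (Matrix.mat k k (\<lambda>(i, j). f i j))"
    by (simp add: cofactor_def)
  finally show ?thesis .
qed

subsection \<open>A Hadamard-type bound for determinants of a semi-inner product\<close>

text \<open>These are the terms of the expanded product that contain exactly one factor \<open>a j\<close>.\<close>

lemma sum_prod_remove_le:
  fixes a b :: "'i \<Rightarrow> real"
  assumes "finite J" "\<And>j. j \<in> J \<Longrightarrow> 0 \<le> a j" "\<And>j. j \<in> J \<Longrightarrow> 0 \<le> b j"
  shows "(\<Sum>j\<in>J. a j * (\<Prod>l\<in>J - {j}. b l)) \<le> (\<Prod>j\<in>J. a j + b j)"
  using assms
proof (induction J rule: finite_induct)
  case (insert m J)
  have "(\<Sum>j\<in>insert m J. a j * (\<Prod>l\<in>insert m J - {j}. b l))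
      = a m * (\<Prod>l\<in>J. b l) + (\<Sum>j\<in>J. a j * (\<Prod>l\<in>insert m J - {j}. b l))"
    using insert by simp
  also have "(\<Sum>j\<in>J. a j * (\<Prod>l\<in>insert m J - {j}. b l)) = (\<Sum>j\<in>J. b m * (a j * (\<Prod>l\<in>J - {j}. b l)))"
  proof (rule sum.cong[OF refl])
    fix j assume "j \<in> J"
    then have "insert m J - {j} = insert m (J - {j})" using insert by auto
    then show "a j * (\<Prod>l\<in>insert m J - {j}. b l) = b m * (a j * (\<Prod>l\<in>J - {j}. b l))"
      using insert by simp
  qed
  also have "a m * (\<Prod>l\<in>J. b l) + (\<Sum>j\<in>J. b m * (a j * (\<Prod>l\<in>J - {j}. b l)))
      \<le> a m * (\<Prod>j\<in>J. a j + b j) + b m * (\<Prod>j\<in>J. a j + b j)"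
    unfolding sum_distrib_left[symmetric]
    by (intro add_mono mult_left_mono prod_mono insert.IH) (use insert in auto)
  finally show ?case using insert by (simp add: distrib_right)
qed simp

lemma prod_skip:
  fixes g :: "nat \<Rightarrow> 'b::comm_monoid_mult"
  assumes "j \<le> k"
  shows "(\<Prod>l<k. g (if l < j then l else Suc l)) = (\<Prod>l\<in>{..<Suc k} - {j}. g l)"
proof -
  have inj: "inj_on (\<lambda>l. if l < j then l else Suc l) {..<k}" by (auto simp: inj_on_def)
  have "l \<in> (\<lambda>l. if l < j then l else Suc l) ` {..<k}" if "l < Suc k" "l \<noteq> j" for l
    using that assms by (intro image_eqI[of _ _ "if l < j then l else l - 1"]) auto
  then have im: "(\<lambda>l. if l < j then l else Suc l) ` {..<k} = {..<Suc k} - {j}" using assms by auto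
  show ?thesis unfolding im[symmetric] prod.reindex[OF inj] by simp
qed

text \<open>The factor \<open>k!\<close>, absent from Hadamard's inequality proper, allows a short induction and is harmless:
  sums over \<open>k\<close>-element sets contribute \<open>1 / k!\<close>, and \<open>C ^ k * sqrt (k!) / k!\<close> is summable.
  In the induction step the last row's vector is projected out of the other rows, the determinant is
  expanded along the last row, and Cauchy--Schwarz is applied to the expansion. The squares
  \<open>q (y j) - q (r (y j))\<close> and \<open>q (r (y j))\<close> of the components of \<open>y j\<close> recombine to \<open>q (y j)\<close>.\<close>

lemma Hadamard_form:
  fixes W :: "'a::complex_hilbert \<Rightarrow> 'a" and x y :: "nat \<Rightarrow> 'a"
  assumes W: "positive_op W"
  defines "q \<equiv> \<lambda>x. Re (cinner (W x) x)"
  shows "(cmod (Determinant.det (Matrix.mat k k (\<lambda>(i, j). cinner (W (x i)) (y j)))))\<^sup>2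
     \<le> fact k * ((\<Prod>i<k. q (x i)) * (\<Prod>j<k. q (y j)))"
proof (induction k arbitrary: x y)
  case 0
  then show ?case by (simp add: det_dim_zero)
next
  case (Suc k)
  note lin = bounded_clinear_linear[OF positive_op_clinear[OF W]]
  have q0: "0 \<le> q v" for v unfolding q_def by (rule positive_op_nonneg[OF W])
  define a where "a = x k"
  let ?M = "Matrix.mat (Suc k) (Suc k) (\<lambda>(i, j). cinner (W (x i)) (y j))"
  show ?case
  proof (cases "q a = 0")
    case True
    have "cinner (W a) v = 0" for v
      using form_Cauchy_Schwarz[OF W, of a v] True by (simp add: q_def)
    then have "Determinant.det ?M = 0"
      by (subst laplace_expansion_row[of _ "Suc k" k]) (auto simp: a_def)
    then show ?thesis by (auto intro!: mult_nonneg_nonneg prod_nonneg q0)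
  next
    case False
    with q0[of a] have qa: "q a > 0" by simp
    define c where "c = (\<lambda>v. complex_of_real (1 / q a) * cinner (W v) a)"
    define r where "r = (\<lambda>v. v - c v *\<^sub>C a)"
    have qr: "q (r v) = q v - (cmod (cinner (W v) a))\<^sup>2 / q a" for v
      unfolding r_def c_def q_def Re_form_expand[OF W]
      using qa by (simp add: q_def[symmetric] field_simps power2_eq_square)
    then have qr_le: "q (r v) \<le> q v" for v using qa by simp
    have aa: "cinner (W a) a = complex_of_real (q a)"
      by (simp add: q_def complex_eq_iff positive_op_real[OF W])
    have ra: "cinner (W (r v)) a = 0" for v
      using qa by (simp add: r_def c_def lin cinner_simps aa)
    \<comment> \<open>Rows orthogonal to \<open>a\<close> see only the components of the \<open>y j\<close> orthogonal to \<open>a\<close>.\<close>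
    have rr: "cinner (W (r u)) (r v) = cinner (W (r u)) v" for u v
      by (subst (2) r_def) (simp add: cinner_simps ra)
    define x' where "x' = (\<lambda>i. if i < k then r (x i) else a)"
    let ?M' = "Matrix.mat (Suc k) (Suc k) (\<lambda>(i, j). cinner (W (x' i)) (y j))"
    have "Determinant.det ?M' = Determinant.det ?M"
    proof -
      have "?M' = Matrix.mat (Suc k) (Suc k) (\<lambda>(i, j). cinner (W (x i)) (y j)
         + (\<Sum>l<Suc k. (if i < k \<and> l = k then - c (x i) else 0) * cinner (W (x l)) (y j)))"
        by (rule eq_matI) (auto simp: x'_def r_def a_def lin cinner_simps less_Suc_eq)
      also have "Determinant.det \<dots> = Determinant.det ?M"
        by (rule det_unitriangular_rows) auto
      finally show ?thesis .
    qed
    also have "Determinant.det ?M' = (\<Sum>j<Suc k. ?M' $$ (k, j) * cofactor ?M' k j)"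
      by (rule laplace_expansion_row) auto
    finally have "cmod (Determinant.det ?M) \<le> (\<Sum>j<Suc k. cmod (?M' $$ (k, j)) * cmod (cofactor ?M' k j))"
      by (metis (no_types, lifting) norm_mult norm_sum sum.cong)
    then have "(cmod (Determinant.det ?M))\<^sup>2 \<le> (\<Sum>j<Suc k. 1 * (cmod (?M' $$ (k, j)) * cmod (cofactor ?M' k j)))\<^sup>2"
      by (simp add: power_mono)
    also have "\<dots> \<le> (\<Sum>j<Suc k. 1\<^sup>2) * (\<Sum>j<Suc k. (cmod (?M' $$ (k, j)) * cmod (cofactor ?M' k j))\<^sup>2)"
      by (rule Cauchy_Schwarz_ineq_sum)
    also have "\<dots> \<le> real (Suc k) * (\<Sum>j<Suc k. fact k * (q a * (\<Prod>i<k. q (x i))) *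
        ((q (y j) - q (r (y j))) * (\<Prod>l\<in>{..<Suc k} - {j}. q (r (y l)))))"
    proof (simp only: power_one sum_constant card_lessThan mult_1_right, intro mult_left_mono sum_mono)
      fix j assume j: "j \<in> {..<Suc k}"
      let ?s = "\<lambda>l. if l < j then l else Suc l"
      have "mat_delete ?M' k j = Matrix.mat k k (\<lambda>(i, l). cinner (W (r (x i))) (r (y (?s l))))"
        by (rule eq_matI) (auto simp: mat_delete_def x'_def rr)
      then have "(cmod (cofactor ?M' k j))\<^sup>2
          = (cmod (Determinant.det (Matrix.mat k k (\<lambda>(i, l). cinner (W (r (x i))) (r (y (?s l)))))))\<^sup>2"
        by (simp add: cofactor_def norm_mult norm_power)
      also have "\<dots> \<le> fact k * ((\<Prod>i<k. q (r (x i))) * (\<Prod>l<k. q (r (y (?s l)))))"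
        by (rule Suc.IH)
      also have "(\<Prod>l<k. q (r (y (?s l)))) = (\<Prod>l\<in>{..<Suc k} - {j}. q (r (y l)))"
        using j by (intro prod_skip[of j k "\<lambda>l. q (r (y l))"]) auto
      also have "fact k * ((\<Prod>i<k. q (r (x i))) * (\<Prod>l\<in>{..<Suc k} - {j}. q (r (y l))))
          \<le> fact k * ((\<Prod>i<k. q (x i)) * (\<Prod>l\<in>{..<Suc k} - {j}. q (r (y l))))"
        by (intro mult_left_mono mult_right_mono prod_mono prod_nonneg conjI q0 qr_le) (auto intro: q0)
      finally have cof: "(cmod (cofactor ?M' k j))\<^sup>2 \<le> fact k * ((\<Prod>i<k. q (x i)) * (\<Prod>l\<in>{..<Suc k} - {j}. q (r (y l))))" .
      have "cmod (cinner (W a) (y j)) = cmod (cinner (W (y j)) a)"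
        using positive_op_commute[OF W, of a "y j"] by simp
      then have ent: "(cmod (?M' $$ (k, j)))\<^sup>2 = q a * (q (y j) - q (r (y j)))"
        using j qa by (simp add: x'_def qr)
      have "0 \<le> q a * (q (y j) - q (r (y j)))" using qa qr_le[of "y j"] by simp
      from mult_left_mono[OF cof this]
      show "(cmod (?M' $$ (k, j)) * cmod (cofactor ?M' k j))\<^sup>2 \<le> fact k * (q a * (\<Prod>i<k. q (x i))) *
        ((q (y j) - q (r (y j))) * (\<Prod>l\<in>{..<Suc k} - {j}. q (r (y l))))"
        unfolding power_mult_distrib ent by (simp only: mult_ac)
    qed simp
    also have "\<dots> = fact (Suc k) * ((\<Prod>i<Suc k. q (x i)) *
       (\<Sum>j<Suc k. (q (y j) - q (r (y j))) * (\<Prod>l\<in>{..<Suc k} - {j}. q (r (y l)))))"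
      unfolding sum_distrib_left[symmetric] by (simp add: a_def)
    also have "\<dots> \<le> fact (Suc k) * ((\<Prod>i<Suc k. q (x i)) * (\<Prod>j<Suc k. (q (y j) - q (r (y j))) + q (r (y j))))"
      by (intro mult_left_mono sum_prod_remove_le prod_nonneg) (auto intro: q0 simp: qr_le)
    finally show ?thesis by simp
  qed
qed

lemma minor_form_bound:
  fixes W :: "'a::complex_hilbert \<Rightarrow> 'a" and u v :: "'i \<Rightarrow> 'a"
  assumes W: "positive_op W" and S: "finite S"
  shows "(cmod (minor S (\<lambda>i j. cinner (W (u i)) (v j))))\<^sup>2
     \<le> fact (card S) * ((\<Prod>i\<in>S. Re (cinner (W (u i)) (u i))) * (\<Prod>i\<in>S. Re (cinner (W (v i)) (v i))))"
proof -
  obtain h where h: "bij_betw h {0..<card S} S" using ex_bij_betw_nat_finite[OF S] by auto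
  then have inj: "inj_on h {..<card S}" and im: "S = h ` {..<card S}"
    by (auto simp: bij_betw_def lessThan_atLeast0)
  have "minor S (\<lambda>i j. cinner (W (u i)) (v j)) = minor {..<card S} (\<lambda>i j. cinner (W (u (h i))) (v (h j)))"
    by (subst im, rule minor_reindex[OF inj]) simp
  also have "\<dots> = Determinant.det (Matrix.mat (card S) (card S) (\<lambda>(i, j). cinner (W (u (h i))) (v (h j))))"
    by (rule minor_eq_det)
  also have "(cmod \<dots>)\<^sup>2 \<le> fact (card S) * ((\<Prod>i<card S. Re (cinner (W (u (h i))) (u (h i)))) * (\<Prod>i<card S. Re (cinner (W (v (h i))) (v (h i)))))"
    by (rule Hadamard_form[OF W])
  also have "(\<Prod>i<card S. Re (cinner (W (u (h i))) (u (h i)))) = (\<Prod>i\<in>S. Re (cinner (W (u i)) (u i)))"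
    by (subst (2) im, subst prod.reindex[OF inj]) simp
  also have "(\<Prod>i<card S. Re (cinner (W (v (h i))) (v (h i)))) = (\<Prod>i\<in>S. Re (cinner (W (v i)) (v i)))"
    by (subst (2) im, subst prod.reindex[OF inj]) simp
  finally show ?thesis .
qed


section \<open>Orthonormal bases and traces\<close>

text \<open>An orthonormal basis enumerated by all natural numbers; surplus indices carry the zero
  vector, so that the finite-dimensional case needs no separate treatment.\<close>

definition padded_basis :: "(nat \<Rightarrow> 'a::complex_hilbert) \<Rightarrow> bool" where
  "padded_basis e \<longleftrightarrow> (\<forall>i j. cinner (e i) (e j) = (if i = j \<and> e i \<noteq> 0 then 1 else 0)) \<and>
     (\<forall>x. (\<forall>i. cinner x (e i) = 0) \<longrightarrow> x = 0)"

text \<open>Distinct basis vectors have distance \<open>\<surd>2\<close>, so a dense set has different points near them.\<close>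

lemma orthonormal_basis_countable:
  fixes B :: "'a::complex_hilbert set"
  assumes sep: "separable_space (euclidean :: 'a topology)" and B: "orthonormal_basis B"
  shows "countable B"
proof -
  obtain C :: "'a set" where C: "countable C" "closure C = UNIV"
    using sep by (auto simp: separable_space_def)
  have "\<exists>c\<in>C. dist c x < 1/2" for x
  proof -
    have "\<forall>r>0. \<exists>c\<in>C. dist c x < r" using C(2) closure_approachable[of x C] by simp
    then show ?thesis by (rule allE[of _ "1/2"]) simp
  qed
  then obtain g where g: "\<And>x. g x \<in> C" "\<And>x. dist (g x) x < 1/2" by metis
  have "inj_on g B"
  proof (rule inj_onI, rule ccontr)
    fix e f assume ef: "e \<in> B" "f \<in> B" "g e = g f" "e \<noteq> f"
    have "dist e f < 1"
      using dist_triangle[of e f "g e"] g(2)[of e] g(2)[of f] ef(3) by (simp add: dist_commute)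
    moreover have "cinner (e - f) (e - f) = 2"
      using B ef by (simp add: orthonormal_basis_def cinner_simps)
    then have "(norm (e - f))\<^sup>2 = 2" using Re_cinner_self[of "e - f"] by simp
    ultimately show False using power_strict_mono[of "norm (e - f)" 1 2] by (simp add: dist_norm)
  qed
  then show ?thesis using C(1) g(1) countable_image_inj_on countable_subset
    by (metis image_subsetI)
qed

lemma padded_basis_exists:
  fixes B :: "'a::complex_hilbert set"
  assumes sep: "separable_space (euclidean :: 'a topology)" and B: "orthonormal_basis B"
  obtains e where "padded_basis e" "bij_betw e {n. e n \<noteq> 0} B"
proof -
  have count: "countable B" by (rule orthonormal_basis_countable[OF assms])
  define e where "e = (\<lambda>n. if n \<in> to_nat_on B ` B then inv_into B (to_nat_on B) n else 0)"
  have inj: "inj_on (to_nat_on B) B" using count by (rule inj_on_to_nat_on)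
  have orth: "\<And>b c. b \<in> B \<Longrightarrow> c \<in> B \<Longrightarrow> cinner b c = (if b = c then 1 else 0)"
    and compl: "\<And>x. (\<And>b. b \<in> B \<Longrightarrow> cinner x b = 0) \<Longrightarrow> x = 0"
    using B by (auto simp: orthonormal_basis_def)
  have nz: "b \<noteq> 0" if "b \<in> B" for b using orth[OF that that] by auto
  have eb: "e (to_nat_on B b) = b" if "b \<in> B" for b using that inj by (simp add: e_def)
  have e_in: "e n \<in> B \<and> to_nat_on B (e n) = n" if "e n \<noteq> 0" for n
  proof -
    have "n \<in> to_nat_on B ` B" using that by (auto simp: e_def split: if_splits)
    then obtain b where "b \<in> B" "n = to_nat_on B b" by auto
    then show ?thesis using eb by simp
  qed
  have "padded_basis e"
    unfolding padded_basis_def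
  proof (intro conjI allI impI)
    fix i j
    show "cinner (e i) (e j) = (if i = j \<and> e i \<noteq> 0 then 1 else 0)"
    proof (cases "e i \<noteq> 0 \<and> e j \<noteq> 0")
      case True
      then have "e i \<in> B" "e j \<in> B" "e i = e j \<longleftrightarrow> i = j" using e_in by metis+
      then show ?thesis using True orth by simp
    qed auto
  next
    fix x assume "\<forall>i. cinner x (e i) = 0"
    then show "x = 0" using compl eb by metis
  qed
  moreover have "bij_betw e {n. e n \<noteq> 0} B"
    by (rule bij_betwI[where g = "to_nat_on B"]) (use e_in eb nz in auto)
  ultimately show ?thesis using that by blast
qed

lemma norm_square_cinner: "(norm (x::'a::complex_hilbert))\<^sup>2 = Re (cinner x x)" by simp

context
  fixes e :: "nat \<Rightarrow> 'a::complex_hilbert"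
  assumes basis: "padded_basis e"
begin

lemma basis_cinner: "cinner (e i) (e j) = (if i = j \<and> e i \<noteq> 0 then 1 else 0)"
  and basis_complete: "(\<And>i. cinner x (e i) = 0) \<Longrightarrow> x = 0"
  using basis unfolding padded_basis_def by blast+

lemma norm_basis_sum:
  assumes "finite F"
  shows "(norm (\<Sum>j\<in>F. cinner x (e j) *\<^sub>C e j))\<^sup>2 = (\<Sum>j\<in>F. (cmod (cinner x (e j)))\<^sup>2)"
    and "cinner x (\<Sum>j\<in>F. cinner x (e j) *\<^sub>C e j) = (\<Sum>j\<in>F. complex_of_real ((cmod (cinner x (e j)))\<^sup>2))"
    and "cinner (\<Sum>j\<in>F. cinner x (e j) *\<^sub>C e j) (e i) = (if i \<in> F then cinner x (e i) else 0)"
proof -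
  show 3: "cinner (\<Sum>j\<in>F. cinner x (e j) *\<^sub>C e j) (e i) = (if i \<in> F then cinner x (e i) else 0)" for i
  proof -
    have "cinner (\<Sum>j\<in>F. cinner x (e j) *\<^sub>C e j) (e i) = (\<Sum>j\<in>F. if i = j then cinner x (e i) else 0)"
      unfolding cinner_sum_left
      by (rule sum.cong[OF refl]) (auto simp: cinner_scaleC_left basis_cinner)
    then show ?thesis using assms by simp
  qed
  show 2: "cinner x (\<Sum>j\<in>F. cinner x (e j) *\<^sub>C e j) = (\<Sum>j\<in>F. complex_of_real ((cmod (cinner x (e j)))\<^sup>2))"
    by (simp add: cinner_sum_right cinner_scaleC_right complex_norm_square mult.commute del: of_real_power)
  have "cinner (\<Sum>j\<in>F. cinner x (e j) *\<^sub>C e j) (\<Sum>j\<in>F. cinner x (e j) *\<^sub>C e j)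
      = (\<Sum>j\<in>F. complex_of_real ((cmod (cinner x (e j)))\<^sup>2))"
    by (subst cinner_sum_right) (simp add: cinner_scaleC_right 3 complex_norm_square mult.commute del: of_real_power)
  then show "(norm (\<Sum>j\<in>F. cinner x (e j) *\<^sub>C e j))\<^sup>2 = (\<Sum>j\<in>F. (cmod (cinner x (e j)))\<^sup>2)"
    unfolding norm_square_cinner by (simp del: of_real_power)
qed

lemma Bessel: "finite F \<Longrightarrow> (\<Sum>j\<in>F. (cmod (cinner x (e j)))\<^sup>2) \<le> (norm x)\<^sup>2"
proof -
  assume F: "finite F"
  let ?s = "\<Sum>j\<in>F. cinner x (e j) *\<^sub>C e j"
  have "0 \<le> Re (cinner (x - ?s) (x - ?s))" by simp
  also have "\<dots> = (norm x)\<^sup>2 - 2 * Re (cinner x ?s) + (norm ?s)\<^sup>2"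
    using cinner_commute[of ?s x] by (simp add: cinner_diff_left cinner_diff_right)
  finally show ?thesis by (simp add: norm_basis_sum[OF F] del: of_real_power)
qed

lemma basis_expansion: "(\<lambda>M. \<Sum>j<M. cinner x (e j) *\<^sub>C e j) \<longlonglongrightarrow> x"
proof -
  define s where "s = (\<lambda>M. \<Sum>j<M. cinner x (e j) *\<^sub>C e j)"
  define b where "b = (\<lambda>M. \<Sum>j<M. (cmod (cinner x (e j)))\<^sup>2)"
  have "summable (\<lambda>j. (cmod (cinner x (e j)))\<^sup>2)"
    by (rule summableI_nonneg_bounded[where x = "(norm x)\<^sup>2"]) (auto intro: Bessel)
  then have "Cauchy b" unfolding b_def by (metis LIMSEQ_imp_Cauchy summable_LIMSEQ)
  have s_diff: "(norm (s n - s m))\<^sup>2 = b n - b m" if "m \<le> n" for m n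
  proof -
    have split: "{..<n} = {..<m} \<union> {m..<n}" using that by auto
    have "s n - s m = (\<Sum>j\<in>{m..<n}. cinner x (e j) *\<^sub>C e j)"
      unfolding s_def split by (subst sum.union_disjoint) auto
    moreover have "b n - b m = (\<Sum>j\<in>{m..<n}. (cmod (cinner x (e j)))\<^sup>2)"
      unfolding b_def split by (subst sum.union_disjoint) auto
    ultimately show ?thesis by (simp add: norm_basis_sum)
  qed
  have "Cauchy s"
  proof (rule CauchyI)
    fix r :: real assume "r > 0"
    with \<open>Cauchy b\<close> obtain K where K: "\<And>m n. m \<ge> K \<Longrightarrow> n \<ge> K \<Longrightarrow> norm (b m - b n) < r\<^sup>2"
      unfolding Cauchy_iff by (metis zero_less_power)
    have *: "norm (s n - s m) < r" if "m \<ge> K" "m \<le> n" for m n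
    proof -
      have "(norm (s n - s m))\<^sup>2 < r\<^sup>2" unfolding s_diff[OF that(2)] using K[of n m] that by simp
      then show ?thesis using \<open>r > 0\<close> by (simp add: power_less_imp_less_base)
    qed
    show "\<exists>M. \<forall>m\<ge>M. \<forall>n\<ge>M. norm (s m - s n) < r"
    proof (intro exI allI impI)
      fix m n assume "m \<ge> K" "n \<ge> K"
      then show "norm (s m - s n) < r" using *[of m n] *[of n m] by (cases "m \<le> n") (auto simp: norm_minus_commute)
    qed
  qed
  then obtain l where l: "s \<longlonglongrightarrow> l" using Cauchy_convergent convergent_def by blast
  have "cinner (x - l) (e i) = 0" for i
  proof -
    have "(\<lambda>M. cinner (s M) (e i)) \<longlonglongrightarrow> cinner l (e i)" by (rule tendsto_cinner_left[OF l])
    moreover have "(\<lambda>M. cinner (s M) (e i)) \<longlonglongrightarrow> cinner x (e i)"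
      by (rule tendsto_eventually, rule eventually_sequentiallyI[of "Suc i"])
         (auto simp: s_def norm_basis_sum)
    ultimately show ?thesis using LIMSEQ_unique by (fastforce simp: cinner_diff_left)
  qed
  then have "x - l = 0" by (rule basis_complete)
  then show ?thesis using l by (simp add: s_def)
qed

lemma Parseval: "(\<lambda>j. (cmod (cinner x (e j)))\<^sup>2) sums (norm x)\<^sup>2"
proof -
  have "(\<lambda>M. (norm (\<Sum>j<M. cinner x (e j) *\<^sub>C e j))\<^sup>2) \<longlonglongrightarrow> (norm x)\<^sup>2"
    by (intro tendsto_intros basis_expansion)
  then show ?thesis by (simp add: sums_def norm_basis_sum)
qed

end

subsection \<open>Cholesky decomposition of a positive operator\<close>

text \<open>The vector \<open>d\<close> for which \<open>T - \<langle>\<cdot>, d\<rangle> d\<close> annihilates \<open>v\<close>. If \<open>\<langle>T v, v\<rangle> = 0\<close>, then \<open>T v = 0\<close> already,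
  and division by zero gives \<open>d = 0\<close> as it should.\<close>

definition chol_dir :: "('a::complex_hilbert \<Rightarrow> 'a) \<Rightarrow> 'a \<Rightarrow> 'a" where
  "chol_dir T v = complex_of_real (1 / sqrt (Re (cinner (T v) v))) *\<^sub>C T v"

text \<open>The remainders after successive removal of the rank-one parts at \<open>e 0, e 1, \<dots>\<close>: Gaussian elimination
  on the infinite matrix of \<open>T\<close>.\<close>

primrec chol_rem :: "('a::complex_hilbert \<Rightarrow> 'a) \<Rightarrow> (nat \<Rightarrow> 'a) \<Rightarrow> nat \<Rightarrow> 'a \<Rightarrow> 'a" where
  "chol_rem T e 0 = T"
| "chol_rem T e (Suc n) = (\<lambda>x. chol_rem T e n x -
     cinner x (chol_dir (chol_rem T e n) (e n)) *\<^sub>C chol_dir (chol_rem T e n) (e n))"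

definition chol_vec :: "('a::complex_hilbert \<Rightarrow> 'a) \<Rightarrow> (nat \<Rightarrow> 'a) \<Rightarrow> nat \<Rightarrow> 'a" where
  "chol_vec T e n = chol_dir (chol_rem T e n) (e n)"

lemma chol_step:
  fixes T :: "'a::complex_hilbert \<Rightarrow> 'a" and v :: 'a
  assumes T: "positive_op T"
  defines "d \<equiv> chol_dir T v"
  defines "T' \<equiv> \<lambda>x. T x - cinner x d *\<^sub>C d"
  shows "positive_op T'" "T' v = 0" "T u = 0 \<Longrightarrow> T' u = 0"
proof -
  note lin = bounded_clinear_linear[OF positive_op_clinear[OF T]]
  define q where "q = Re (cinner (T v) v)"
  have q0: "0 \<le> q" unfolding q_def by (rule positive_op_nonneg[OF T])
  have vv: "cinner (T v) v = complex_of_real q" by (simp add: q_def complex_eq_iff positive_op_real[OF T])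
  have d: "d = complex_of_real (1 / sqrt q) *\<^sub>C T v" by (simp add: d_def chol_dir_def q_def)
  have xd: "cinner x d = complex_of_real (1 / sqrt q) * cinner (T x) v" for x
    by (simp add: d cinner_scaleC_right positive_op_commute'[OF T])
  have T0: "T v = 0" if "q = 0"
  proof -
    have "cinner (T v) (T v) = 0" using form_Cauchy_Schwarz[OF T, of v "T v"] that by (simp add: q_def)
    then show ?thesis by (simp add: cinner_self)
  qed
  show "T' v = 0"
  proof (cases "q = 0")
    case False
    then have "complex_of_real (1 / sqrt q) * complex_of_real q * complex_of_real (1 / sqrt q) = 1"
      unfolding of_real_mult[symmetric] using q0 by (simp add: field_simps)
    then show ?thesis unfolding T'_def xd vv by (simp add: d scaleC_scaleC)
  qed (simp add: T'_def d T0)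
  show "T' u = 0" if "T u = 0"
    using that by (simp add: T'_def xd)
  obtain K where K: "K > 0" "\<And>x. norm (T x) \<le> K * norm x" using bounded_clinear_bound[OF positive_op_clinear[OF T]] by metis
  have "bounded_clinear T'"
  proof (rule bounded_clinearI)
    show "T' (x + y) = T' x + T' y" for x y by (simp add: T'_def lin cinner_simps scaleC_add_left)
    show "T' (c *\<^sub>C x) = c *\<^sub>C T' x" for c x by (simp add: T'_def lin cinner_simps scaleC_diff_right scaleC_scaleC)
    show "norm (T' x) \<le> (K + norm d * norm d) * norm x" for x
    proof -
      have "norm (T' x) \<le> norm (T x) + cmod (cinner x d) * norm d"
        unfolding T'_def by (metis norm_scaleC norm_triangle_ineq4)
      also have "\<dots> \<le> K * norm x + (norm x * norm d) * norm d"
        by (intro add_mono K mult_right_mono cinner_Cauchy_Schwarz) auto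
      finally show ?thesis by (simp add: algebra_simps)
    qed
  qed
  moreover have "cinner (T' x) x \<in> \<real>\<^sub>\<ge>\<^sub>0" for x
  proof -
    have dx: "cinner d x = cnj (cinner x d)" by (rule cinner_commute)
    have eq: "cinner (T' x) x = cinner (T x) x - complex_of_real ((cmod (cinner x d))\<^sup>2)"
      by (simp add: T'_def cinner_simps dx complex_norm_square del: of_real_power)
    have "(cmod (cinner x d))\<^sup>2 = (cmod (cinner (T x) v))\<^sup>2 / q"
      using q0 by (simp add: xd norm_mult norm_divide power_divide)
    also have "\<dots> \<le> Re (cinner (T x) x)"
    proof (cases "q = 0")
      case False
      then show ?thesis using form_Cauchy_Schwarz[OF T, of x v] q0 by (simp add: q_def field_simps)
    qed (simp add: positive_op_nonneg[OF T])
    finally show ?thesis using positive_op_real[OF T, of x]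
      by (simp add: complex_nonneg_Reals_iff eq del: of_real_power)
  qed
  ultimately show "positive_op T'" by (simp add: positive_op_def)
qed

lemma chol_rem_Suc: "chol_rem T e (Suc n) x = chol_rem T e n x - cinner x (chol_vec T e n) *\<^sub>C chol_vec T e n"
  by (simp add: chol_vec_def)

context
  fixes T :: "'a::complex_hilbert \<Rightarrow> 'a" and e :: "nat \<Rightarrow> 'a"
  assumes T: "positive_op T"
begin

lemma chol_rem_positive: "positive_op (chol_rem T e n)"
  by (induction n) (auto simp: T intro: chol_step(1))

lemma chol_rem_kills: "k < n \<Longrightarrow> chol_rem T e n (e k) = 0"
proof (induction n)
  case (Suc n)
  then show ?case
    using chol_step(2)[OF chol_rem_positive, of n "e n"] chol_step(3)[OF chol_rem_positive, of n "e k" "e n"]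
    by (cases "k = n") auto
qed simp

lemma chol_rem_eq: "T x = chol_rem T e n x + (\<Sum>k<n. cinner x (chol_vec T e k) *\<^sub>C chol_vec T e k)"
proof (induction n)
  case (Suc n)
  then show ?case by (simp add: chol_rem_Suc del: chol_rem.simps)
qed simp

text \<open>The decomposition is triangular: an entry in column \<open>j\<close> involves only the first
  \<open>j + 1\<close> Cholesky vectors.\<close>

lemma chol_entry:
  assumes "j < n"
  shows "cinner (T x) (e j) = (\<Sum>k<n. cinner x (chol_vec T e k) * cinner (chol_vec T e k) (e j))"
proof -
  have "cinner (chol_rem T e n x) (e j) = 0"
    using positive_op_commute'[OF chol_rem_positive, of n x "e j"] chol_rem_kills[OF assms] by simp
  then show ?thesis by (subst chol_rem_eq[of x n]) (simp add: cinner_simps cinner_sum_left)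
qed

lemma chol_diag: "Re (cinner (T x) x) = Re (cinner (chol_rem T e n x) x) + (\<Sum>k<n. (cmod (cinner x (chol_vec T e k)))\<^sup>2)"
proof -
  have "cinner (chol_vec T e k) x = cnj (cinner x (chol_vec T e k))" for k by (rule cinner_commute)
  then have "cinner x (chol_vec T e k) * cinner (chol_vec T e k) x = complex_of_real ((cmod (cinner x (chol_vec T e k)))\<^sup>2)" for k
    by (simp add: complex_norm_square del: of_real_power)
  then show ?thesis by (subst chol_rem_eq[of x n]) (simp add: cinner_simps cinner_sum_left del: of_real_power)
qed

text \<open>The quadratic form of the remainder tends to \<open>0\<close>: the remainder annihilates the partial sums \<open>s M\<close> of \<open>x\<close>,
  so Cauchy--Schwarz bounds it by the form of \<open>T\<close> at \<open>x - s M\<close>.\<close>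

lemma chol_diag_sums:
  assumes basis: "padded_basis e"
  shows "(\<lambda>k. (cmod (cinner x (chol_vec T e k)))\<^sup>2) sums Re (cinner (T x) x)"
proof -
  define s where "s = (\<lambda>M. \<Sum>j<M. cinner x (e j) *\<^sub>C e j)"
  define p where "p = (\<lambda>M. Re (cinner (T (x - s M)) (x - s M)) * Re (cinner (T x) x))"
  have rem: "(cmod (cinner (chol_rem T e n x) x))\<^sup>2 \<le> p M" if "M \<le> n" for n M
  proof -
    note lin = bounded_clinear_linear[OF positive_op_clinear[OF chol_rem_positive]]
    have "chol_rem T e n (s M) = 0"
      unfolding s_def lin using chol_rem_kills that by (intro sum.neutral) auto
    then have "chol_rem T e n x = chol_rem T e n (x - s M)" by (simp add: lin)
    then have "(cmod (cinner (chol_rem T e n x) x))\<^sup>2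
        \<le> Re (cinner (chol_rem T e n (x - s M)) (x - s M)) * Re (cinner (chol_rem T e n x) x)"
      using form_Cauchy_Schwarz[OF chol_rem_positive, of n "x - s M" x] by simp
    also have "\<dots> \<le> p M"
      unfolding p_def using chol_diag[of _ n]
      by (intro mult_mono positive_op_nonneg T chol_rem_positive) (auto intro: sum_nonneg)
    finally show ?thesis .
  qed
  have "p \<longlonglongrightarrow> 0"
  proof -
    interpret bounded_linear T using T by (simp add: positive_op_def bounded_clinear_def)
    have s: "s \<longlonglongrightarrow> x" unfolding s_def by (rule basis_expansion[OF basis])
    have "(\<lambda>M. norm (T (x - s M)) * norm (x - s M) * Re (cinner (T x) x)) \<longlonglongrightarrow> norm (T (x - x)) * norm (x - x) * Re (cinner (T x) x)"
      by (intro tendsto_intros s tendsto)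
    then have lim: "(\<lambda>M. norm (T (x - s M)) * norm (x - s M) * Re (cinner (T x) x)) \<longlonglongrightarrow> 0" by simp
    have "norm (p M) \<le> norm (T (x - s M)) * norm (x - s M) * Re (cinner (T x) x)" for M
      unfolding p_def real_norm_def abs_mult
      by (intro mult_mono order_trans[OF abs_Re_le_cmod cinner_Cauchy_Schwarz])
         (auto simp: positive_op_nonneg[OF T])
    then show ?thesis by (intro Lim_null_comparison[OF _ lim] always_eventually) auto
  qed
  have "(\<lambda>n. (cmod (cinner (chol_rem T e n x) x))\<^sup>2) \<longlonglongrightarrow> 0"
    by (rule Lim_null_comparison[OF _ \<open>p \<longlonglongrightarrow> 0\<close>]) (auto intro: always_eventually rem)
  then have "(\<lambda>n. cmod (cinner (chol_rem T e n x) x)) \<longlonglongrightarrow> 0" 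
    using tendsto_real_sqrt by fastforce
  then have "(\<lambda>n. Re (cinner (chol_rem T e n x) x)) \<longlonglongrightarrow> 0"
    by (rule Lim_null_comparison[rotated]) (auto intro!: always_eventually abs_Re_le_cmod)
  then have "(\<lambda>n. Re (cinner (T x) x) - Re (cinner (chol_rem T e n x) x)) \<longlonglongrightarrow> Re (cinner (T x) x) - 0"
    by (intro tendsto_intros)
  moreover have "Re (cinner (T x) x) - Re (cinner (chol_rem T e n x) x) = (\<Sum>k<n. (cmod (cinner x (chol_vec T e k)))\<^sup>2)" for n
    using chol_diag[of x n] by simp
  ultimately show ?thesis by (simp add: sums_def)
qed

text \<open>Both sides are the double sum of \<open>\<bar>\<langle>e' j, \<psi> k\<rangle>\<bar>\<^sup>2\<close>. The right-hand side is independent of \<open>e'\<close>, and so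
  is therefore the trace.\<close>

lemma chol_trace:
  assumes "padded_basis e" "padded_basis e'"
  shows "(\<Sum>j. ennreal (Re (cinner (T (e' j)) (e' j)))) = (\<Sum>k. ennreal ((norm (chol_vec T e k))\<^sup>2))"
proof -
  let ?c = "\<lambda>j k. ennreal ((cmod (cinner (e' j) (chol_vec T e k)))\<^sup>2)"
  have "(\<Sum>j. ennreal (Re (cinner (T (e' j)) (e' j)))) = (\<Sum>j. \<Sum>k. ?c j k)"
    by (intro suminf_cong suminf_ennreal_eq[symmetric] chol_diag_sums assms) auto
  also have "\<dots> = (\<Sum>k. \<Sum>j. ?c j k)"
  proof -
    have "(\<Sum>j. \<Sum>k. ?c j k) = (\<integral>\<^sup>+ j. (\<Sum>k. ?c j k) \<partial>count_space UNIV)"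
      by (rule nn_integral_count_space_nat[symmetric])
    also have "\<dots> = (\<Sum>k. \<integral>\<^sup>+ j. ?c j k \<partial>count_space UNIV)" by (rule nn_integral_suminf) simp
    also have "\<dots> = (\<Sum>k. \<Sum>j. ?c j k)" by (simp only: nn_integral_count_space_nat)
    finally show ?thesis .
  qed
  also have "\<dots> = (\<Sum>k. ennreal ((norm (chol_vec T e k))\<^sup>2))"
  proof (intro suminf_cong suminf_ennreal_eq)
    fix k
    have "cmod (cinner (e' j) (chol_vec T e k)) = cmod (cinner (chol_vec T e k) (e' j))" for j
      by (subst cinner_commute) simp
    then show "(\<lambda>j. (cmod (cinner (e' j) (chol_vec T e k)))\<^sup>2) sums (norm (chol_vec T e k))\<^sup>2"
      using Parseval[OF assms(2), of "chol_vec T e k"] by simp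
  qed auto
  finally show ?thesis .
qed

end

subsection \<open>Uniqueness of the positive square root\<close>

text \<open>If \<open>P\<^sup>2 = Q\<^sup>2\<close>, then \<open>X = P - Q\<close> satisfies \<open>P X + X Q = 0\<close>. An approximate eigenvector of
  \<open>X\<close> for a value \<open>\<lambda> \<noteq> 0\<close> would make both \<open>\<langle>P x, x\<rangle>\<close> and \<open>\<langle>Q x, x\<rangle>\<close> small, whereas their
  difference is close to \<open>\<lambda>\<close>. So \<open>X \<mp> \<parallel>X\<parallel>\<close> are bounded below; this contradicts
  \<open>\<parallel>X\<^sup>2 x - \<parallel>X\<parallel>\<^sup>2 x\<parallel>\<^sup>2 \<le> \<parallel>X\<parallel>\<^sup>2 (\<parallel>X\<parallel>\<^sup>2 \<parallel>x\<parallel>\<^sup>2 - \<parallel>X x\<parallel>\<^sup>2)\<close>.\<close>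

lemma positive_square_root_unique:
  fixes P Q :: "'a::complex_hilbert \<Rightarrow> 'a"
  assumes P: "positive_op P" and Q: "positive_op Q"
    and eq: "\<And>x y. cinner (P (P x)) y = cinner (Q x) (Q y)"
  shows "P = Q"
proof (rule ccontr)
  assume ne: "P \<noteq> Q"
  note lin = bounded_clinear_linear[OF positive_op_clinear[OF P]] bounded_clinear_linear[OF positive_op_clinear[OF Q]]
  have sq: "P (P x) = Q (Q x)" for x
    by (rule cinner_right_eqI) (simp add: eq positive_op_commute'[OF Q])
  define X where "X = (\<lambda>x. P x - Q x)"
  obtain KP where KP: "KP > 0" "\<And>x. norm (P x) \<le> KP * norm x" using bounded_clinear_bound[OF positive_op_clinear[OF P]] by metis
  obtain KQ where KQ: "KQ > 0" "\<And>x. norm (Q x) \<le> KQ * norm x" using bounded_clinear_bound[OF positive_op_clinear[OF Q]] by metis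
  have "bounded_clinear X"
  proof (rule bounded_clinearI)
    show "norm (X x) \<le> (KP + KQ) * norm x" for x
      unfolding X_def using norm_triangle_ineq4[of "P x" "Q x"] KP(2)[of x] KQ(2)[of x] by (simp add: distrib_right)
  qed (simp_all add: X_def lin scaleC_diff_right)
  then interpret X: bounded_linear X by (simp add: bounded_clinear_def)
  have Xc: "X (c *\<^sub>C x) = c *\<^sub>C X x" for c x by (simp add: X_def lin scaleC_diff_right)
  have Xsa: "cinner (X x) y = cinner x (X y)" for x y
    by (simp add: X_def cinner_simps positive_op_commute'[OF P] positive_op_commute'[OF Q])
  define d where "d = onorm X"
  have X_le: "norm (X x) \<le> d * norm x" for x unfolding d_def by (rule onorm[OF X.bounded_linear_axioms])
  have d: "d > 0"
  proof -
    obtain x where "P x \<noteq> Q x" using ne by auto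
    then show ?thesis unfolding d_def onorm_pos_lt[OF X.bounded_linear_axioms] by (auto simp: X_def)
  qed
  define C where "C = KP + KQ + d"
  have C: "C > 0" using KP KQ d by (simp add: C_def)
  define \<kappa> where "\<kappa> = d\<^sup>2 / C"
  have \<kappa>: "\<kappa> > 0" using d C by (simp add: \<kappa>_def)
  have below: "\<kappa> * norm x \<le> norm (X x - l *\<^sub>R x)" if l: "\<bar>l\<bar> = d" for l x
  proof (cases "x = 0")
    case False
    define r where "r = X x - l *\<^sub>R x"
    define p where "p = Re (cinner (P x) x) + Re (cinner (Q x) x)"
    have Xx: "X x = complex_of_real l *\<^sub>C x + r" by (simp add: r_def scaleR_scaleC)
    have "P (X x) + X (Q x) = 0" by (simp add: X_def lin sq)
    then have "cinner (P (X x) + X (Q x)) x = 0" by simp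
    then have "0 = cinner (X x) (P x) + cinner (Q x) (X x)"
      by (simp add: cinner_simps positive_op_commute'[OF P, of "X x" x] Xsa)
    also have "\<dots> = complex_of_real l * (cinner x (P x) + cinner (Q x) x) + (cinner r (P x) + cinner (Q x) r)"
      by (simp add: Xx cinner_simps algebra_simps)
    finally have "complex_of_real l * (cinner x (P x) + cinner (Q x) x) = - (cinner r (P x) + cinner (Q x) r)"
      by (metis eq_neg_iff_add_eq_0)
    then have "Re (complex_of_real l * (cinner x (P x) + cinner (Q x) x)) = - Re (cinner r (P x) + cinner (Q x) r)" by simp
    then have "l * p = - Re (cinner r (P x) + cinner (Q x) r)"
      by (simp add: p_def positive_op_commute'[OF P])
    then have "\<bar>l * p\<bar> \<le> cmod (cinner r (P x) + cinner (Q x) r)"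
      using abs_Re_le_cmod[of "cinner r (P x) + cinner (Q x) r"] by simp
    then have "d * \<bar>p\<bar> \<le> cmod (cinner r (P x) + cinner (Q x) r)" using l by (simp add: abs_mult)
    also have "\<dots> \<le> norm r * norm (P x) + norm (Q x) * norm r"
      by (rule norm_triangle_le) (intro add_mono cinner_Cauchy_Schwarz)
    also have "\<dots> \<le> norm r * (KP * norm x) + (KQ * norm x) * norm r"
      by (intro add_mono mult_left_mono mult_right_mono KP KQ) auto
    finally have 1: "d * p \<le> (KP + KQ) * norm r * norm x"
      using d by (simp add: algebra_simps) (metis abs_ge_self mult_left_mono less_imp_le order_trans)
    have "l * (norm x)\<^sup>2 = Re (cinner (X x - r) x)"
      by (simp add: r_def scaleR_scaleC cinner_simps)
    also have "\<dots> = Re (cinner (P x) x) - Re (cinner (Q x) x) - Re (cinner r x)"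
      by (simp add: X_def cinner_simps)
    finally have "\<bar>l * (norm x)\<^sup>2\<bar> \<le> p + \<bar>Re (cinner r x)\<bar>"
      using positive_op_nonneg[OF P, of x] positive_op_nonneg[OF Q, of x] unfolding p_def by linarith
    also have "\<bar>Re (cinner r x)\<bar> \<le> norm r * norm x"
      using abs_Re_le_cmod cinner_Cauchy_Schwarz order_trans by blast
    finally have "d * (norm x)\<^sup>2 \<le> p + norm r * norm x" using l by (simp add: abs_mult)
    then have "d * (d * (norm x)\<^sup>2) \<le> d * (p + norm r * norm x)" using d by (intro mult_left_mono) auto
    also have "\<dots> \<le> C * norm r * norm x" using 1 by (simp add: C_def algebra_simps)
    finally have "(d\<^sup>2 * norm x) * norm x \<le> (C * norm r) * norm x" by (simp add: power2_eq_square mult_ac)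
    then have "d\<^sup>2 * norm x \<le> C * norm r" using False by simp
    then show ?thesis using C by (simp add: \<kappa>_def r_def field_simps)
  qed simp
  have main: "(norm (X x))\<^sup>2 \<le> (d\<^sup>2 - \<kappa>^4 / d\<^sup>2) * (norm x)\<^sup>2" for x
  proof -
    have "\<kappa> * (\<kappa> * norm x) \<le> \<kappa> * norm (X x - (- d) *\<^sub>R x)"
      using below[of "- d" x] \<kappa> d by (intro mult_left_mono) auto
    also have "\<dots> \<le> norm (X (X x + d *\<^sub>R x) - d *\<^sub>R (X x + d *\<^sub>R x))"
      using below[of d "X x + d *\<^sub>R x"] d by simp
    also have "X (X x + d *\<^sub>R x) - d *\<^sub>R (X x + d *\<^sub>R x) = X (X x) - complex_of_real (d\<^sup>2) *\<^sub>C x"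
      by (simp add: X.add Xc scaleR_scaleC scaleC_add_right scaleC_scaleC power2_eq_square)
    finally have "(\<kappa> * (\<kappa> * norm x))\<^sup>2 \<le> (norm (X (X x) - complex_of_real (d\<^sup>2) *\<^sub>C x))\<^sup>2"
      using \<kappa> by (intro power_mono) auto
    also have "\<dots> = (norm (X (X x)))\<^sup>2 - 2 * d\<^sup>2 * Re (cinner (X (X x)) x) + d^4 * (norm x)\<^sup>2"
      using cinner_commute[of x "X (X x)"]
      unfolding norm_square_cinner by (simp add: cinner_simps power2_eq_square power4_eq_xxxx algebra_simps)
    also have "Re (cinner (X (X x)) x) = (norm (X x))\<^sup>2" by (subst Xsa) simp
    also have "(norm (X (X x)))\<^sup>2 \<le> (d * norm (X x))\<^sup>2" by (intro power_mono X_le) auto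
    finally have "\<kappa>^4 * (norm x)\<^sup>2 \<le> d\<^sup>2 * (d\<^sup>2 * (norm x)\<^sup>2 - (norm (X x))\<^sup>2)"
      by (simp add: power_mult_distrib power2_eq_square power4_eq_xxxx algebra_simps)
    then have "\<kappa>^4 * (norm x)\<^sup>2 / d\<^sup>2 \<le> d\<^sup>2 * (norm x)\<^sup>2 - (norm (X x))\<^sup>2"
      using d by (simp add: divide_le_eq mult.commute)
    then show ?thesis by (simp add: algebra_simps)
  qed
  define d' where "d' = sqrt \<bar>d\<^sup>2 - \<kappa>^4 / d\<^sup>2\<bar>"
  have "norm (X x) \<le> d' * norm x" for x
  proof (rule power2_le_imp_le)
    have "(d\<^sup>2 - \<kappa>^4 / d\<^sup>2) * (norm x)\<^sup>2 \<le> \<bar>d\<^sup>2 - \<kappa>^4 / d\<^sup>2\<bar> * (norm x)\<^sup>2" by (intro mult_right_mono) auto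
    with main[of x] show "(norm (X x))\<^sup>2 \<le> (d' * norm x)\<^sup>2" by (simp add: power_mult_distrib d'_def)
  qed (simp add: d'_def)
  then have "d \<le> d'" unfolding d_def by (intro onorm_bound) (auto simp: d'_def)
  moreover have pos: "0 \<le> d\<^sup>2 - \<kappa>^4 / d\<^sup>2"
  proof -
    obtain x where "P x \<noteq> Q x" using ne by auto
    then have "0 < (norm (X x))\<^sup>2" by (simp add: X_def)
    then have "0 < (d\<^sup>2 - \<kappa>^4 / d\<^sup>2) * (norm x)\<^sup>2" using main[of x] by linarith
    then show ?thesis by (simp add: zero_less_mult_iff)
  qed
  ultimately have "d\<^sup>2 \<le> d\<^sup>2 - \<kappa>^4 / d\<^sup>2" using d power_mono[of d d' 2] by (simp add: d'_def)
  moreover have "\<kappa>^4 / d\<^sup>2 > 0" using \<kappa> d by simp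
  ultimately show False by simp
qed


subsection \<open>The trace of a positive trace-class operator\<close>

lemma infsum_basis_sums:
  fixes e :: "nat \<Rightarrow> 'a::complex_hilbert"
  assumes e: "padded_basis e" "bij_betw e {n. e n \<noteq> 0} B" and W: "positive_op W"
  shows "(\<lambda>b. cinner (W b) b) summable_on B \<Longrightarrow> summable (\<lambda>n. Re (cinner (W (e n)) (e n)))"
    and "summable (\<lambda>n. Re (cinner (W (e n)) (e n))) \<Longrightarrow>
      (\<Sum>\<^sub>\<infinity>b\<in>B. cinner (W b) b) = complex_of_real (\<Sum>n. Re (cinner (W (e n)) (e n)))"
proof -
  have W0: "W 0 = 0" using bounded_clinear_linear(3)[OF positive_op_clinear[OF W]] .
  have real: "cinner (W b) b = complex_of_real (Re (cinner (W b) b))" for b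
    by (simp add: complex_eq_iff positive_op_real[OF W])
  have reindex: "((\<lambda>b. cinner (W b) b) has_sum s) B \<longleftrightarrow> ((\<lambda>n. cinner (W (e n)) (e n)) has_sum s) UNIV" for s
  proof -
    have "((\<lambda>b. cinner (W b) b) has_sum s) B \<longleftrightarrow> ((\<lambda>n. cinner (W (e n)) (e n)) has_sum s) {n. e n \<noteq> 0}"
      using has_sum_reindex_bij_betw[OF e(2), of "\<lambda>b. cinner (W b) b" s] by simp
    also have "\<dots> \<longleftrightarrow> ((\<lambda>n. cinner (W (e n)) (e n)) has_sum s) UNIV"
      by (rule has_sum_cong_neutral) (auto simp: W0)
    finally show ?thesis .
  qed
  show "summable (\<lambda>n. Re (cinner (W (e n)) (e n)))" if "(\<lambda>b. cinner (W b) b) summable_on B"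
  proof -
    from that obtain s where "((\<lambda>b. cinner (W b) b) has_sum s) B" by (auto simp: summable_on_def)
    then have "(\<lambda>n. cinner (W (e n)) (e n)) sums s" unfolding reindex by (rule has_sum_imp_sums)
    then show ?thesis by (metis sums_Re sums_summable)
  qed
  assume s: "summable (\<lambda>n. Re (cinner (W (e n)) (e n)))"
  have "((\<lambda>n. Re (cinner (W (e n)) (e n))) has_sum (\<Sum>n. Re (cinner (W (e n)) (e n)))) UNIV"
    by (rule sums_nonneg_imp_has_sum[OF summable_sums[OF s]]) (rule positive_op_nonneg[OF W])
  then have "((\<lambda>n. complex_of_real (Re (cinner (W (e n)) (e n)))) has_sum complex_of_real (\<Sum>n. Re (cinner (W (e n)) (e n)))) UNIV"
    by (rule has_sum_of_real)
  then have "((\<lambda>b. cinner (W b) b) has_sum complex_of_real (\<Sum>n. Re (cinner (W (e n)) (e n)))) B"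
    unfolding reindex real[symmetric] .
  then show "(\<Sum>\<^sub>\<infinity>b\<in>B. cinner (W b) b) = complex_of_real (\<Sum>n. Re (cinner (W (e n)) (e n)))"
    by (rule infsumI)
qed

text \<open>Trace class is a condition on \<open>\<bar>V\<bar>\<close> in some basis. Uniqueness of the square root gives \<open>\<bar>V\<bar> = V\<close>, and
  \<open>chol_trace\<close> transports the sum to the chosen basis \<open>some_onb\<close>.\<close>

lemma trace_class_cholesky:
  fixes V :: "'a::complex_hilbert \<Rightarrow> 'a"
  assumes sep: "separable_space (euclidean :: 'a topology)"
    and V: "positive_op V" and tc: "trace_class V"
  obtains e where "padded_basis e" "bij_betw e {n. e n \<noteq> 0} (some_onb :: 'a set)"
    "summable (\<lambda>n. Re (cinner (V (e n)) (e n)))"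
    "(\<lambda>n. (norm (chol_vec V e n))\<^sup>2) sums Re (op_trace V)" "Im (op_trace V) = 0"
proof -
  from tc obtain P B where P: "is_abs_op P V" and B: "orthonormal_basis B"
    and sum: "(\<lambda>e. cinner (P e) e) summable_on B"
    unfolding trace_class_def by blast
  have "P = V"
    by (rule positive_square_root_unique[OF _ V]) (use P in \<open>auto simp: is_abs_op_def\<close>)
  have onb: "orthonormal_basis (some_onb :: 'a set)"
    unfolding some_onb_def using B by (rule someI)
  obtain b where b: "padded_basis b" "bij_betw b {n. b n \<noteq> 0} B" using padded_basis_exists[OF sep B] .
  obtain e where e: "padded_basis e" "bij_betw e {n. e n \<noteq> 0} (some_onb :: 'a set)"
    using padded_basis_exists[OF sep onb] .
  have nn: "0 \<le> Re (cinner (V x) x)" for x by (rule positive_op_nonneg[OF V])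
  have "summable (\<lambda>n. Re (cinner (V (b n)) (b n)))"
    using infsum_basis_sums(1)[OF b V] sum \<open>P = V\<close> by simp
  then have "(\<Sum>n. ennreal (Re (cinner (V (b n)) (b n)))) \<noteq> \<infinity>"
    by (simp add: ennreal_suminf_neq_top nn)
  then have fin: "(\<Sum>n. ennreal ((norm (chol_vec V e n))\<^sup>2)) \<noteq> \<infinity>"
    using chol_trace[OF V e(1) b(1)] by simp
  then have s1: "summable (\<lambda>n. (norm (chol_vec V e n))\<^sup>2)"
    by (intro summable_suminf_not_top) auto
  have s2: "summable (\<lambda>n. Re (cinner (V (e n)) (e n)))"
    using fin chol_trace[OF V e(1) e(1)] by (intro summable_suminf_not_top nn) auto
  have "(\<Sum>n. (norm (chol_vec V e n))\<^sup>2) = (\<Sum>n. Re (cinner (V (e n)) (e n)))"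
    using chol_trace[OF V e(1) e(1)]
    by (subst (asm) suminf_ennreal2[OF nn s2], subst (asm) suminf_ennreal2[OF _ s1])
       (auto simp: suminf_nonneg nn s1 s2)
  moreover have "op_trace V = complex_of_real (\<Sum>n. Re (cinner (V (e n)) (e n)))"
    unfolding op_trace_def by (rule infsum_basis_sums(2)[OF e V s2])
  ultimately show ?thesis using that[OF e s2] summable_sums[OF s1] by simp
qed


section \<open>The perturbation determinant as an infinite product\<close>

text \<open>Multiplying out \<open>(\<Sum>i\<in>F. c i) ^ k\<close> produces each product over a \<open>k\<close>-element set \<open>k!\<close> times.\<close>

lemma elementary_symmetric_le:
  fixes c :: "'i \<Rightarrow> real"
  assumes "finite F" "\<And>i. i \<in> F \<Longrightarrow> 0 \<le> c i"
  shows "(\<Sum>S | S \<subseteq> F \<and> card S = k. \<Prod>i\<in>S. c i) \<le> (\<Sum>i\<in>F. c i) ^ k / fact k"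
  using assms
proof (induction F arbitrary: k rule: finite_induct)
  case empty
  have "{S. S \<subseteq> ({}::'i set) \<and> card S = k} = (if k = 0 then {{}} else {})" by auto
  then show ?case by simp
next
  case (insert m F)
  let ?C = "\<Sum>i\<in>F. c i"
  have C0: "0 \<le> ?C" and cm: "0 \<le> c m" using insert by (auto intro: sum_nonneg)
  show ?case
  proof (cases k)
    case 0
    have "{S. S \<subseteq> insert m F \<and> card S = 0} = {{}}" using insert(1) by (auto dest: finite_subset simp: card_eq_0_iff)
    then show ?thesis using 0 by simp
  next
    case (Suc l)
    have split: "{S. S \<subseteq> insert m F \<and> card S = Suc l} = {S. S \<subseteq> F \<and> card S = Suc l} \<union> insert m ` {S. S \<subseteq> F \<and> card S = l}"
    proof (intro equalityI subsetI)
      fix S assume S: "S \<in> {S. S \<subseteq> insert m F \<and> card S = Suc l}"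
      then have fS: "finite S" using insert(1) by (auto intro: finite_subset)
      show "S \<in> {S. S \<subseteq> F \<and> card S = Suc l} \<union> insert m ` {S. S \<subseteq> F \<and> card S = l}"
      proof (cases "m \<in> S")
        case True
        then have "S = insert m (S - {m})" "S - {m} \<subseteq> F" "card (S - {m}) = l" using S fS by auto
        then show ?thesis by blast
      qed (use S in auto)
    next
      fix S assume "S \<in> {S. S \<subseteq> F \<and> card S = Suc l} \<union> insert m ` {S. S \<subseteq> F \<and> card S = l}"
      moreover have "card (insert m T) = Suc (card T)" if "T \<subseteq> F" for T
        using that insert(1,2) finite_subset[OF that] by (intro card_insert_disjoint) auto
      ultimately show "S \<in> {S. S \<subseteq> insert m F \<and> card S = Suc l}" by auto
    qed
    have inj: "inj_on (insert m) {S. S \<subseteq> F \<and> card S = l}"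
      using insert(2) by (auto simp: inj_on_def)
    have "(\<Sum>S | S \<subseteq> insert m F \<and> card S = Suc l. \<Prod>i\<in>S. c i)
        = (\<Sum>S | S \<subseteq> F \<and> card S = Suc l. \<Prod>i\<in>S. c i) + (\<Sum>S\<in>insert m ` {S. S \<subseteq> F \<and> card S = l}. \<Prod>i\<in>S. c i)"
      unfolding split using insert(1,2) by (intro sum.union_disjoint) auto
    also have "(\<Sum>S\<in>insert m ` {S. S \<subseteq> F \<and> card S = l}. \<Prod>i\<in>S. c i) = (\<Sum>S | S \<subseteq> F \<and> card S = l. c m * (\<Prod>i\<in>S. c i))"
      unfolding sum.reindex[OF inj] o_def
    proof (rule sum.cong[OF refl])
      fix S assume "S \<in> {S. S \<subseteq> F \<and> card S = l}"
      then have "finite S" "m \<notin> S" using insert(1,2) finite_subset by auto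
      then show "(\<Prod>i\<in>insert m S. c i) = c m * (\<Prod>i\<in>S. c i)" by simp
    qed
    also have "\<dots> = c m * (\<Sum>S | S \<subseteq> F \<and> card S = l. \<Prod>i\<in>S. c i)" by (simp add: sum_distrib_left)
    also have "(\<Sum>S | S \<subseteq> F \<and> card S = Suc l. \<Prod>i\<in>S. c i) + c m * (\<Sum>S | S \<subseteq> F \<and> card S = l. \<Prod>i\<in>S. c i)
        \<le> ?C ^ Suc l / fact (Suc l) + c m * (?C ^ l / fact l)"
      by (intro add_mono mult_left_mono insert.IH cm) (use insert in auto)
    also have "c m * (?C ^ l / fact l) = real (Suc l) * c m * ?C ^ l / fact (Suc l)"
      by (simp add: fact_Suc field_simps del: of_nat_Suc)
    also have "?C ^ Suc l / fact (Suc l) + real (Suc l) * c m * ?C ^ l / fact (Suc l)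
        = (?C ^ Suc l + real (Suc l) * c m * ?C ^ l) / fact (Suc l)"
      by (simp only: add_divide_distrib)
    also have "?C ^ Suc l + real (Suc l) * c m * ?C ^ l \<le> (c m + ?C) ^ Suc l"
    proof -
      have "?C ^ Suc l + real (Suc l) * c m * ?C ^ l \<le> (c m + ?C) ^ Suc l" for l
      proof (induction l)
        case (Suc l)
        have "?C ^ Suc (Suc l) + real (Suc (Suc l)) * c m * ?C ^ Suc l
            \<le> (c m + ?C) * (?C ^ Suc l + real (Suc l) * c m * ?C ^ l)"
          using cm C0 by (simp add: algebra_simps)
        also have "\<dots> \<le> (c m + ?C) * (c m + ?C) ^ Suc l"
          using cm C0 Suc by (intro mult_left_mono) auto
        finally show ?case by simp
      qed simp
      then show ?thesis .
    qed
    finally show ?thesis using insert Suc by (simp add: divide_right_mono)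
  qed
qed

text \<open>The majorant of the series of principal minors: after grouping by cardinality it is at most
  \<open>\<Sum>k. C ^ k / sqrt (k!)\<close>.\<close>

lemma weighted_products_summable:
  fixes c :: "nat \<Rightarrow> real"
  assumes c0: "\<And>i. 0 \<le> c i" and "summable c"
  shows "(\<lambda>S. sqrt (fact (card S)) * (\<Prod>i\<in>S. c i)) summable_on {S. finite S}"
proof (rule nonneg_bdd_above_summable_on)
  show "0 \<le> sqrt (fact (card S)) * (\<Prod>i\<in>S. c i)" for S :: "nat set"
    by (intro mult_nonneg_nonneg prod_nonneg c0) auto
  define C where "C = suminf c"
  have C0: "0 \<le> C" unfolding C_def by (intro suminf_nonneg assms)
  define r where "r = (\<lambda>k. C ^ k / sqrt (fact k))"
  have r0: "0 \<le> r k" for k using C0 by (simp add: r_def)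
  obtain K :: nat where K: "4 * C\<^sup>2 < real K" using reals_Archimedean2 by blast
  have "summable r"
  proof (rule summable_ratio_test)
    fix k assume "k \<ge> K"
    then have "(2 * C)\<^sup>2 \<le> real (Suc k)" using K by (simp add: power_mult_distrib)
    then have "2 * C \<le> sqrt (real (Suc k))" using real_le_rsqrt by blast
    then have "C / sqrt (real (Suc k)) \<le> 1/2" by (simp add: field_simps)
    then have "C / sqrt (real (Suc k)) * r k \<le> 1/2 * r k" by (intro mult_right_mono r0)
    moreover have "r (Suc k) = C / sqrt (real (Suc k)) * r k"
      by (simp add: r_def real_sqrt_mult)
    ultimately show "norm (r (Suc k)) \<le> 1/2 * norm (r k)" using r0[of k] r0[of "Suc k"] by simp
  qed simp
  have bound: "(\<Sum>S\<in>\<S>. sqrt (fact (card S)) * (\<Prod>i\<in>S. c i)) \<le> suminf r"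
    if \<S>: "\<S> \<subseteq> {S. finite S}" "finite \<S>" for \<S> :: "nat set set"
  proof -
    define F where "F = \<Union>\<S>"
    have F: "finite F" unfolding F_def by (rule finite_Union) (use \<S> in auto)
    have "(\<Sum>S\<in>\<S>. sqrt (fact (card S)) * (\<Prod>i\<in>S. c i)) \<le> (\<Sum>S\<in>Pow F. sqrt (fact (card S)) * (\<Prod>i\<in>S. c i))"
      by (intro sum_mono2) (use F in \<open>auto simp: F_def intro!: mult_nonneg_nonneg prod_nonneg c0\<close>)
    also have "\<dots> = (\<Sum>k\<le>card F. \<Sum>S | S \<in> Pow F \<and> card S = k. sqrt (fact (card S)) * (\<Prod>i\<in>S. c i))"
      by (rule sum.group[symmetric]) (use F in \<open>auto intro: card_mono\<close>)
    also have "\<dots> \<le> (\<Sum>k\<le>card F. r k)"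
    proof (rule sum_mono)
      fix k
      have "(\<Sum>S | S \<in> Pow F \<and> card S = k. sqrt (fact (card S)) * (\<Prod>i\<in>S. c i))
          = sqrt (fact k) * (\<Sum>S | S \<subseteq> F \<and> card S = k. \<Prod>i\<in>S. c i)"
        unfolding sum_distrib_left by (rule sum.cong) auto
      also have "\<dots> \<le> sqrt (fact k) * ((\<Sum>i\<in>F. c i) ^ k / fact k)"
        by (intro mult_left_mono elementary_symmetric_le F c0) auto
      also have "\<dots> \<le> sqrt (fact k) * (C ^ k / fact k)"
        unfolding C_def
        by (intro mult_left_mono divide_right_mono power_mono sum_le_suminf assms F sum_nonneg) (auto simp: c0)
      also have "\<dots> = r k"
      proof -
        have "sqrt (fact k) / fact k = 1 / sqrt (fact k :: real)"
          using real_sqrt_mult_self[of "fact k"] by (simp add: field_simps)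
        then show ?thesis by (simp add: r_def field_simps)
      qed
      finally show "(\<Sum>S | S \<in> Pow F \<and> card S = k. sqrt (fact (card S)) * (\<Prod>i\<in>S. c i)) \<le> r k" .
    qed
    also have "\<dots> \<le> suminf r" by (intro sum_le_suminf \<open>summable r\<close>) (auto simp: r0)
    finally show ?thesis .
  qed
  then show "bdd_above (sum (\<lambda>S. sqrt (fact (card S)) * (\<Prod>i\<in>S. c i)) ` {F. F \<subseteq> {S. finite S} \<and> finite F})"
    by (intro bdd_aboveI[where M = "suminf r"]) auto
qed

text \<open>Finite subsets of the basis correspond to finite sets of proper indices; a set with a surplus index
  contributes a minor with a zero row.\<close>

lemma ext_power_trace_sums:
  fixes T :: "'a::complex_hilbert \<Rightarrow> 'a"
  assumes e: "bij_betw e {n::nat. e n \<noteq> 0} (some_onb :: 'a set)" and T0: "T 0 = 0"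
    and abs: "(\<lambda>S. minor S (\<lambda>i j. cinner (T (e i)) (e j))) summable_on {S. finite S}"
  shows "(\<Sum>k. ext_power_trace k T) = (\<Sum>\<^sub>\<infinity>S\<in>{S. finite S}. minor S (\<lambda>i j. cinner (T (e i)) (e j)))"
proof -
  let ?J = "{n. e n \<noteq> 0}"
  define g where "g = (\<lambda>S. minor S (\<lambda>i j. cinner (T (e i)) (e j)))"
  have inj: "inj_on e ?J" and img: "e ` ?J = (some_onb :: 'a set)" using e by (auto simp: bij_betw_def)
  have bij: "bij_betw ((`) e) {S. S \<subseteq> ?J \<and> finite S \<and> card S = k} {S. S \<subseteq> (some_onb :: 'a set) \<and> finite S \<and> card S = k}" for k
  proof (rule bij_betw_imageI)
    show "inj_on ((`) e) {S. S \<subseteq> ?J \<and> finite S \<and> card S = k}"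
      by (rule inj_on_subset[OF inj_on_image_Pow[OF inj]]) auto
    show "(`) e ` {S. S \<subseteq> ?J \<and> finite S \<and> card S = k} = {S. S \<subseteq> (some_onb :: 'a set) \<and> finite S \<and> card S = k}"
    proof (intro equalityI subsetI)
      fix S assume "S \<in> (`) e ` {S. S \<subseteq> ?J \<and> finite S \<and> card S = k}"
      then obtain S' where S': "S' \<subseteq> ?J" "finite S'" "card S' = k" "S = e ` S'" by auto
      then show "S \<in> {S. S \<subseteq> (some_onb :: 'a set) \<and> finite S \<and> card S = k}"
        using img card_image[OF inj_on_subset[OF inj S'(1)]] by auto
    next
      fix S assume S: "S \<in> {S. S \<subseteq> (some_onb :: 'a set) \<and> finite S \<and> card S = k}"
      then obtain S' where S': "S' \<subseteq> ?J" "finite S'" "S = e ` S'" using img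
        by (metis (no_types, lifting) finite_subset_image mem_Collect_eq)
      then show "S \<in> (`) e ` {S. S \<subseteq> ?J \<and> finite S \<and> card S = k}"
        using S card_image[OF inj_on_subset[OF inj S'(1)]] by auto
    qed
  qed
  have ext: "ext_power_trace k T = infsum g {S. finite S \<and> card S = k}" for k
  proof -
    have "ext_power_trace k T = (\<Sum>\<^sub>\<infinity>S\<in>{S. S \<subseteq> (some_onb :: 'a set) \<and> finite S \<and> card S = k}. minor S (\<lambda>e f. cinner (T e) f))"
      by (simp add: ext_power_trace_def minor_def)
    also have "\<dots> = (\<Sum>\<^sub>\<infinity>S\<in>{S. S \<subseteq> ?J \<and> finite S \<and> card S = k}. minor (e ` S) (\<lambda>e f. cinner (T e) f))"
      by (rule infsum_reindex_bij_betw[OF bij, symmetric])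
    also have "\<dots> = infsum g {S. S \<subseteq> ?J \<and> finite S \<and> card S = k}"
      unfolding g_def by (intro infsum_cong minor_reindex) (auto intro: inj_on_subset[OF inj])
    also have "\<dots> = infsum g {S. finite S \<and> card S = k}"
    proof (rule infsum_cong_neutral)
      fix S assume "S \<in> {S. finite S \<and> card S = k} - {S. S \<subseteq> ?J \<and> finite S \<and> card S = k}"
      then obtain i where i: "i \<in> S" "e i = 0" "finite S" by auto
      have "(\<Prod>j\<in>S. cinner (T (e j)) (e (p j))) = 0" for p
        using i T0 by (intro prod_zero) (auto intro!: bexI[of _ i])
      then show "g S = 0" by (simp add: g_def minor_def)
    qed auto
    finally show ?thesis .
  qed
  have sum: "g summable_on {S. finite S}" using abs by (simp add: g_def)
  have "bij_betw snd (SIGMA k:UNIV. {S::nat set. finite S \<and> card S = k}) {S. finite S}"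
    by (rule bij_betwI[where g = "\<lambda>S. (card S, S)"]) auto
  from has_sum_reindex_bij_betw[OF this, of g] has_sum_infsum[OF sum]
  have "((\<lambda>p. g (snd p)) has_sum infsum g {S. finite S}) (SIGMA k:UNIV. {S. finite S \<and> card S = k})" by simp
  then have "((\<lambda>k. infsum g {S. finite S \<and> card S = k}) has_sum infsum g {S. finite S}) UNIV"
    by (rule has_sum_Sigma') (auto intro!: has_sum_infsum summable_on_subset[OF sum])
  then have "(\<lambda>k. ext_power_trace k T) sums infsum g {S. finite S}"
    unfolding ext[symmetric] by (rule has_sum_imp_sums)
  then show ?thesis by (simp add: sums_iff g_def)
qed

lemma infsum_dominated_convergence:
  fixes f :: "nat \<Rightarrow> 'i \<Rightarrow> complex"
  assumes g: "g summable_on A" and le: "\<And>n x. x \<in> A \<Longrightarrow> cmod (f n x) \<le> g x"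
    and lim: "\<And>x. x \<in> A \<Longrightarrow> (\<lambda>n. f n x) \<longlonglongrightarrow> h x"
  shows "(\<lambda>n. infsum (f n) A) \<longlonglongrightarrow> infsum h A" and "h summable_on A" and "\<And>n. f n summable_on A"
proof -
  have h_le: "cmod (h x) \<le> g x" if "x \<in> A" for x
    by (rule tendsto_upperbound[OF tendsto_norm[OF lim[OF that]]]) (auto simp: le that)
  have g0: "0 \<le> g x" if "x \<in> A" for x using order_trans[OF norm_ge_zero h_le[OF that]] .
  have abs: "(\<lambda>x. norm (k x)) summable_on A" if "\<And>x. x \<in> A \<Longrightarrow> cmod (k x) \<le> g x" for k :: "'i \<Rightarrow> complex"
    by (rule summable_on_comparison_test[OF g]) (use that in auto)
  have absg: "(\<lambda>x. norm (g x)) summable_on A"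
    using g by (rule summable_on_cong[THEN iffD1, rotated]) (simp add: g0)
  have eq: "infsum k A = integral\<^sup>L (count_space A) k" if "\<And>x. x \<in> A \<Longrightarrow> cmod (k x) \<le> g x" for k :: "'i \<Rightarrow> complex"
    using infsetsum_infsum[of k A] abs[OF that] by (simp add: abs_summable_equivalent infsetsum_def)
  have "(\<lambda>n. integral\<^sup>L (count_space A) (f n)) \<longlonglongrightarrow> integral\<^sup>L (count_space A) h"
  proof (rule integral_dominated_convergence[where w = g])
    have "Infinite_Set_Sum.abs_summable_on g A" using absg abs_summable_equivalent[of g A] by simp
    then show "integrable (count_space A) g" unfolding Infinite_Set_Sum.abs_summable_on_def .
  qed (auto simp: AE_count_space lim le)
  then show "(\<lambda>n. infsum (f n) A) \<longlonglongrightarrow> infsum h A" using eq[OF le] eq[OF h_le] by simp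
  show "h summable_on A" by (rule abs_summable_summable, rule abs, rule h_le)
  show "f n summable_on A" for n by (rule abs_summable_summable, rule abs, rule le)
qed

definition partial_op :: "(nat \<Rightarrow> 'a::complex_hilbert) \<Rightarrow> nat \<Rightarrow> 'a \<Rightarrow> 'a" where
  "partial_op \<psi> n x = (\<Sum>k<n. cinner x (\<psi> k) *\<^sub>C \<psi> k)"

definition partial_perturbation :: "('a \<Rightarrow> 'a) \<Rightarrow> (nat \<Rightarrow> 'a::complex_hilbert) \<Rightarrow> nat \<Rightarrow> 'a \<Rightarrow> 'a" where
  "partial_perturbation A \<psi> n h = A h - \<i> *\<^sub>C partial_op \<psi> n h"

abbreviation step_det :: "'a::complex_hilbert set \<Rightarrow> ('a \<Rightarrow> 'a) \<Rightarrow> (nat \<Rightarrow> 'a) \<Rightarrow> nat \<Rightarrow> complex \<Rightarrow> complex" where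
  "step_det D A \<psi> n \<equiv> m_accumulative_operator.rank_one_det D (partial_perturbation A \<psi> n) (\<psi> n)"

lemma partial_perturbation_m_accumulative:
  assumes "m_accumulative D A"
  shows "m_accumulative D (partial_perturbation A \<psi> n)"
proof (induction n)
  case 0
  have "partial_perturbation A \<psi> 0 = A" by (auto simp: partial_perturbation_def partial_op_def)
  then show ?case using assms by simp
next
  case (Suc n)
  interpret m_accumulative_operator D "partial_perturbation A \<psi> n" by unfold_locales (rule Suc)
  have "partial_perturbation A \<psi> (Suc n)
      = (\<lambda>h. partial_perturbation A \<psi> n h - (\<i> * cinner h (\<psi> n)) *\<^sub>C \<psi> n)"
    by (rule ext) (simp add: partial_perturbation_def partial_op_def scaleC_add_right scaleC_scaleC)
  then show ?case using rank_one_perturbation[of "\<psi> n"] by simp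
qed

lemma partial_op_form: "cinner (partial_op \<psi> n x) y = (\<Sum>k<n. cinner x (\<psi> k) * cinner (\<psi> k) y)"
  by (simp add: partial_op_def cinner_sum_left cinner_scaleC_left)

lemma partial_op_diag: "cinner (partial_op \<psi> n x) x = complex_of_real (\<Sum>k<n. (cmod (cinner x (\<psi> k)))\<^sup>2)"
proof -
  have "cinner (\<psi> k) x = cnj (cinner x (\<psi> k))" for k by (rule cinner_commute)
  then show ?thesis by (simp add: partial_op_form complex_norm_square del: of_real_power)
qed

lemma partial_op_positive: "positive_op (partial_op \<psi> n)"
  unfolding positive_op_def
proof
  show "bounded_clinear (partial_op \<psi> n)"
  proof (rule bounded_clinearI)
    show "norm (partial_op \<psi> n x) \<le> (\<Sum>k<n. norm (\<psi> k) * norm (\<psi> k)) * norm x" for x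
      unfolding partial_op_def sum_distrib_right
    proof (rule sum_norm_le)
      fix k
      have "norm (cinner x (\<psi> k) *\<^sub>C \<psi> k) \<le> (norm x * norm (\<psi> k)) * norm (\<psi> k)"
        unfolding norm_scaleC by (intro mult_right_mono cinner_Cauchy_Schwarz) auto
      then show "norm (cinner x (\<psi> k) *\<^sub>C \<psi> k) \<le> norm (\<psi> k) * norm (\<psi> k) * norm x" by (simp add: mult_ac)
    qed
  qed (simp_all add: partial_op_def cinner_simps scaleC_add_left sum.distrib scaleC_sum_right scaleC_scaleC)
  show "\<forall>x. cinner (partial_op \<psi> n x) x \<in> \<real>\<^sub>\<ge>\<^sub>0"
    unfolding partial_op_diag by (auto simp: complex_nonneg_Reals_iff intro!: sum_nonneg)
qed

text \<open>Each rank-one step contributes one factor: solving the equation for the next resolvent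
  expresses a combination of rows whose only non-zero entry is the diagonal one.\<close>

lemma det_partial_perturbation:
  assumes A: "m_accumulative D A" and z: "Im z > 0"
  shows "Determinant.det (Matrix.mat N N (\<lambda>(n, m). (if n = m then 1 else 0) - \<i> * cinner (resolvent D A z (\<psi> n)) (\<psi> m)))
     = (\<Prod>n<N. step_det D A \<psi> n z)"
proof (induction N)
  case 0
  then show ?case by (simp add: det_dim_zero)
next
  case (Suc N)
  interpret A: m_accumulative_operator D A by unfold_locales (rule A)
  interpret AN: m_accumulative_operator D "partial_perturbation A \<psi> N"
    by unfold_locales (rule partial_perturbation_m_accumulative[OF A])
  define f where "f = (\<lambda>n m. (if n = m then 1 else 0) - \<i> * cinner (A.R z (\<psi> n)) (\<psi> m))"
  define x where "x = AN.R z (\<psi> N)"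
  define \<xi> where "\<xi> = (\<lambda>n. \<i> * cinner x (\<psi> n))"
  have xD: "x \<in> D" unfolding x_def by (rule AN.resolvent_in[OF z])
  have "A x - z *\<^sub>C x = \<psi> N + (\<Sum>k<N. \<xi> k *\<^sub>C \<psi> k)"
    using AN.resolvent_eq[OF z, of "\<psi> N"]
    by (simp add: x_def[symmetric] partial_perturbation_def partial_op_def \<xi>_def scaleC_sum_right scaleC_scaleC algebra_simps)
  from A.resolvent_unique[OF z xD this]
  have x: "x = A.R z (\<psi> N) + (\<Sum>k<N. \<xi> k *\<^sub>C A.R z (\<psi> k))"
    by (simp add: A.resolvent_linear[OF z])
  have row: "- \<i> * cinner x (\<psi> m) = - \<i> * cinner (A.R z (\<psi> N)) (\<psi> m) + (\<Sum>k<N. \<xi> k * (- \<i> * cinner (A.R z (\<psi> k)) (\<psi> m)))" for m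
    by (subst x) (simp add: cinner_add_left cinner_sum_left cinner_scaleC_left sum_distrib_left distrib_left mult_ac sum_negf)
  define f' where "f' = (\<lambda>i j. f i j + (\<Sum>l<Suc N. (if i = N \<and> l < N then \<xi> l else 0) * f l j))"
  have f'_row: "f' N m = f N m + (\<Sum>k<N. \<xi> k * f k m)" for m by (simp add: f'_def)
  have f'_eq: "f' N m = (if N = m then 1 else 0) + (if m < N then \<xi> m else 0) - \<i> * cinner x (\<psi> m)" for m
  proof -
    have "(\<Sum>k<N. \<xi> k * f k m) = (\<Sum>k<N. (if k = m then \<xi> k else 0)) + (\<Sum>k<N. \<xi> k * (- \<i> * cinner (A.R z (\<psi> k)) (\<psi> m)))"
      unfolding sum.distrib[symmetric] by (rule sum.cong) (auto simp: f_def algebra_simps)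
    then show ?thesis unfolding f'_row using row[of m] by (simp add: f_def)
  qed
  have "Determinant.det (Matrix.mat (Suc N) (Suc N) (\<lambda>(n, m). f n m))
      = Determinant.det (Matrix.mat (Suc N) (Suc N) (\<lambda>(n, m). f' n m))"
    unfolding f'_def by (rule det_unitriangular_rows[symmetric]) auto
  also have "\<dots> = f' N N * Determinant.det (Matrix.mat N N (\<lambda>(n, m). f' n m))"
    by (rule det_last_row_zero) (simp add: f'_eq \<xi>_def)
  also have "f' N N = step_det D A \<psi> N z"
    by (simp add: f'_eq AN.rank_one_det_def x_def)
  also have "Matrix.mat N N (\<lambda>(n, m). f' n m) = Matrix.mat N N (\<lambda>(n, m). f n m)"
    by (rule eq_matI) (auto simp: f'_def)
  finally show ?case using Suc by (simp add: f_def mult.commute)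
qed

text \<open>This bounds the coefficients of the adjoint of \<open>T\<close> applied to \<open>y\<close> by duality: \<open>T\<close> is tested on the vector whose
  coefficients are the conjugates of those in question.\<close>

lemma sum_basis_coefficients_le:
  assumes T: "bounded_clinear T" "\<And>x. norm (T x) \<le> K * norm x" and K: "0 \<le> K" and e: "padded_basis e"
  shows "(\<Sum>j<n. (cmod (cinner (T (e j)) y))\<^sup>2) \<le> (K * norm y)\<^sup>2"
proof -
  note lin = bounded_clinear_linear[OF T(1)]
  define s where "s = (\<Sum>j<n. (cmod (cinner (T (e j)) y))\<^sup>2)"
  define c where "c = (\<lambda>j. cnj (cinner (T (e j)) y))"
  define x where "x = (\<Sum>j<n. c j *\<^sub>C e j)"
  have s0: "0 \<le> s" unfolding s_def by (intro sum_nonneg) auto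
  have c0: "c j = 0" if "e j = 0" for j using that by (simp add: c_def lin)
  have "cinner x x = (\<Sum>j<n. c j * (\<Sum>i<n. if i = j then cnj (c j) else 0))"
    unfolding x_def cinner_sum_left cinner_sum_right cinner_scaleC_left cinner_scaleC_right
      basis_cinner[OF e] sum_distrib_left
    by (intro sum.cong refl) (auto simp: c0)
  also have "\<dots> = complex_of_real s"
    by (simp add: s_def c_def complex_norm_square mult.commute del: of_real_power)
  finally have "(norm x)\<^sup>2 = s" using Re_cinner_self[of x] by simp
  have "cinner (T x) y = complex_of_real s"
    by (simp add: x_def lin cinner_sum_left cinner_scaleC_left s_def c_def complex_norm_square mult.commute del: of_real_power)
  then have "s = cmod (cinner (T x) y)" using s0 by simp
  also have "\<dots> \<le> (K * norm x) * norm y"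
    by (rule order_trans[OF cinner_Cauchy_Schwarz]) (intro mult_right_mono T, simp)
  finally have "s\<^sup>2 \<le> ((K * norm x) * norm y)\<^sup>2" using s0 by (intro power_mono)
  also have "\<dots> = (K * norm y)\<^sup>2 * s" using \<open>(norm x)\<^sup>2 = s\<close> by (simp add: power_mult_distrib)
  finally have "s * s \<le> (K * norm y)\<^sup>2 * s" by (simp add: power2_eq_square)
  then have "s \<le> (K * norm y)\<^sup>2" using s0 by (cases "s = 0") auto
  then show ?thesis by (simp add: s_def)
qed

text \<open>Let \<open>V\<^sub>N\<close> be the sum of the first \<open>N\<close> rank-one parts of \<open>V\<close>. Its minors are eventually equal to those of
  \<open>V\<close> by triangularity, and all are bounded by the same summable majorant since \<open>V\<^sub>N \<le> V\<close> as forms. So the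
  determinants converge. For fixed \<open>N\<close>, \<open>det_one_plus_commute\<close> turns the truncated determinants into
  \<open>N \<times> N\<close> determinants, whose entries converge by expansion in the basis.\<close>

theorem perturbation_det_product:
  fixes D :: "'a::complex_hilbert set" and A H V :: "'a \<Rightarrow> 'a"
  assumes A: "m_accumulative D A" and V: "positive_op V"
    and e: "padded_basis e" "bij_betw e {n. e n \<noteq> 0} (some_onb :: 'a set)"
    and tr: "summable (\<lambda>n. Re (cinner (V (e n)) (e n)))" "summable (\<lambda>n. (norm (chol_vec V e n))\<^sup>2)"
    and H: "\<And>h. h \<in> D \<Longrightarrow> H h = A h - \<i> *\<^sub>C V h" and z: "Im z > 0"
  shows "(\<lambda>N. \<Prod>n<N. step_det D A (chol_vec V e) n z) \<longlonglongrightarrow> perturbation_det D H A z"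
proof -
  interpret A: m_accumulative_operator D A by unfold_locales (rule A)
  define \<psi> where "\<psi> = chol_vec V e"
  define R where "R = A.R z"
  note Vlin = bounded_clinear_linear[OF positive_op_clinear[OF V]]
  note Rlin = A.resolvent_linear[OF z, folded R_def]
  have Vn_le: "Re (cinner (partial_op \<psi> n x) x) \<le> Re (cinner (V x) x)" for n x
    using chol_diag[OF V, of x e n] positive_op_nonneg[OF chol_rem_positive[OF V], of e n x]
    by (simp add: partial_op_diag \<psi>_def)
  \<comment> \<open>The factor \<open>- \<i>\<close> is absorbed in the vectors, so that all minors are those of a semi-inner product.\<close>
  define u where "u = (\<lambda>i. (- \<i>) *\<^sub>C R (e i))"
  define f where "f = (\<lambda>i j. cinner (V (u i)) (e j))"
  define fN where "fN = (\<lambda>N i j. cinner (partial_op \<psi> N (u i)) (e j))"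
  define a b where "a = (\<lambda>i. Re (cinner (V (u i)) (u i)))" and "b = (\<lambda>i. Re (cinner (V (e i)) (e i)))"
  have a0: "0 \<le> a i" and b0: "0 \<le> b i" for i unfolding a_def b_def by (simp_all add: positive_op_nonneg[OF V])
  have sa: "summable a"
  proof -
    have "(\<Sum>i<n. a i) \<le> (1 / Im z)\<^sup>2 * (\<Sum>k. (norm (\<psi> k))\<^sup>2)" for n
    proof -
      have "a i = Re (cinner (V (R (e i))) (R (e i)))" for i
        by (simp add: a_def u_def Vlin cinner_simps)
      then have ai: "(\<lambda>k. (cmod (cinner (R (e i)) (\<psi> k)))\<^sup>2) sums a i" for i
        using chol_diag_sums[OF V e(1), of "R (e i)"] by (simp add: \<psi>_def)
      have 1: "(\<lambda>k. \<Sum>i<n. (cmod (cinner (R (e i)) (\<psi> k)))\<^sup>2) sums (\<Sum>i<n. a i)"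
        by (intro sums_sum ai)
      have 2: "(\<lambda>k. (1 / Im z)\<^sup>2 * (norm (\<psi> k))\<^sup>2) sums ((1 / Im z)\<^sup>2 * (\<Sum>k. (norm (\<psi> k))\<^sup>2))"
        by (intro sums_mult summable_sums) (use tr in \<open>simp add: \<psi>_def\<close>)
      have 3: "(\<Sum>i<n. (cmod (cinner (R (e i)) (\<psi> k)))\<^sup>2) \<le> (1 / Im z)\<^sup>2 * (norm (\<psi> k))\<^sup>2" for k
        using sum_basis_coefficients_le[OF A.resolvent_clinear[OF z] _ _ e(1), where K = "1 / Im z" and n = n and y = "\<psi> k"]
          A.resolvent_bound[OF z] z by (simp add: R_def power_mult_distrib power_divide)
      show ?thesis by (rule sums_le[OF 3 1 2])
    qed
    then show ?thesis by (intro summableI_nonneg_bounded a0)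
  qed
  define c where "c = (\<lambda>i. sqrt (a i) * sqrt (b i))"
  have "summable c"
  proof (rule summable_comparison_test'[OF summable_add[OF sa tr(1)[folded b_def]]])
    fix n
    have "sqrt (a n * b n) \<le> a n + b n"
      using arith_geo_mean_sqrt[OF a0[of n] b0[of n]] a0[of n] b0[of n] by (simp add: field_simps)
    then show "norm (c n) \<le> a n + b n" using a0 b0 by (simp add: c_def real_sqrt_mult)
  qed
  define g where "g = (\<lambda>S. sqrt (fact (card S)) * (\<Prod>i\<in>S. c i))"
  have g: "g summable_on {S. finite S}"
    unfolding g_def by (rule weighted_products_summable[OF _ \<open>summable c\<close>]) (simp add: c_def a0 b0)
  have bound: "cmod (minor S (\<lambda>i j. cinner (W (u i)) (e j))) \<le> g S"
    if W: "positive_op W" "\<And>x. Re (cinner (W x) x) \<le> Re (cinner (V x) x)" and S: "finite S" for W S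
  proof (rule power2_le_imp_le)
    have "(cmod (minor S (\<lambda>i j. cinner (W (u i)) (e j))))\<^sup>2
        \<le> fact (card S) * ((\<Prod>i\<in>S. Re (cinner (W (u i)) (u i))) * (\<Prod>i\<in>S. Re (cinner (W (e i)) (e i))))"
      by (rule minor_form_bound[OF W(1) S])
    also have "\<dots> \<le> fact (card S) * ((\<Prod>i\<in>S. a i) * (\<Prod>i\<in>S. b i))"
      unfolding a_def b_def
      by (intro mult_left_mono mult_mono prod_mono conjI prod_nonneg W(2) positive_op_nonneg[OF W(1)])
         (auto intro: positive_op_nonneg[OF W(1)] positive_op_nonneg[OF V])
    also have "\<dots> = (g S)\<^sup>2"
      by (simp add: g_def c_def power_mult_distrib prod.distrib prod_power_distrib a0 b0)
    finally show "(cmod (minor S (\<lambda>i j. cinner (W (u i)) (e j))))\<^sup>2 \<le> (g S)\<^sup>2" .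
    show "0 \<le> g S" by (auto simp: g_def c_def intro!: mult_nonneg_nonneg prod_nonneg a0 b0)
  qed
  have lim: "(\<lambda>N. infsum (\<lambda>S. minor S (fN N)) {S. finite S}) \<longlonglongrightarrow> infsum (\<lambda>S. minor S f) {S. finite S}"
    and sum_f: "(\<lambda>S. minor S f) summable_on {S. finite S}"
    and sum_fN: "\<And>N. (\<lambda>S. minor S (fN N)) summable_on {S. finite S}"
  proof -
    have 1: "cmod (minor S (fN N)) \<le> g S" if "S \<in> {S. finite S}" for S N
      unfolding fN_def by (rule bound) (use that in \<open>auto simp: partial_op_positive Vn_le\<close>)
    have 2: "(\<lambda>N. minor S (fN N)) \<longlonglongrightarrow> minor S f" if "S \<in> {S. finite S}" for S
    proof (rule tendsto_eventually)
      have "S \<subseteq> {..Max (insert 0 S)}" using that by auto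
      then obtain m where m: "S \<subseteq> {..m}" by blast
      show "\<forall>\<^sub>F N in sequentially. minor S (fN N) = minor S f"
      proof (rule eventually_sequentiallyI[of "Suc m"])
        fix N assume "Suc m \<le> N"
        then show "minor S (fN N) = minor S f"
          using m by (intro minor_cong) (auto simp: fN_def f_def partial_op_form \<psi>_def chol_entry[OF V, of _ N])
      qed
    qed
    show "(\<lambda>N. infsum (\<lambda>S. minor S (fN N)) {S. finite S}) \<longlonglongrightarrow> infsum (\<lambda>S. minor S f) {S. finite S}"
      by (rule infsum_dominated_convergence(1)[OF g 1 2])
    show "(\<lambda>S. minor S f) summable_on {S. finite S}" by (rule infsum_dominated_convergence(2)[OF g 1 2])
    show "\<And>N. (\<lambda>S. minor S (fN N)) summable_on {S. finite S}" by (rule infsum_dominated_convergence(3)[OF g 1 2])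
  qed
  have "perturbation_det D H A z = infsum (\<lambda>S. minor S f) {S. finite S}"
  proof -
    have Tx: "H (R x) - z *\<^sub>C R x - x = (- \<i>) *\<^sub>C V (R x)" for x
      using A.resolvent_eq[OF z, of x] H[OF A.resolvent_in[OF z]] by (simp add: R_def scaleC_minus_left algebra_simps)
    have fe: "f = (\<lambda>i j. cinner ((- \<i>) *\<^sub>C V (R (e i))) (e j))" by (simp add: f_def u_def Vlin)
    have "perturbation_det D H A z = (\<Sum>k. ext_power_trace k (\<lambda>x. (- \<i>) *\<^sub>C V (R x)))"
      using A.in_resolvent_set[OF z] by (simp add: perturbation_det_def fredholm_det_def R_def[symmetric] Tx)
    also have "\<dots> = infsum (\<lambda>S. minor S f) {S. finite S}"
      unfolding fe by (rule ext_power_trace_sums[OF e(2)]) (use sum_f in \<open>simp_all add: fe Vlin Rlin\<close>)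
    finally show ?thesis .
  qed
  moreover have "infsum (\<lambda>S. minor S (fN N)) {S. finite S} = (\<Prod>n<N. step_det D A \<psi> n z)" for N
  proof -
    let ?G = "\<lambda>n m. (if n = m then 1 else 0) - \<i> * cinner (R (\<psi> n)) (\<psi> m)"
    define X where "X = (\<lambda>i n. cinner (u i) (\<psi> n))"
    define Y where "Y = (\<lambda>n i. cinner (\<psi> n) (e i))"
    have filt: "filterlim (\<lambda>M::nat. Pow {..<M}) (finite_subsets_at_top {S. finite S}) sequentially"
      unfolding filterlim_finite_subsets_at_top
    proof (intro allI impI, elim conjE)
      fix \<S> :: "nat set set" assume \<S>: "finite \<S>" "\<S> \<subseteq> {S. finite S}"
      then have "finite (\<Union>\<S>)" by auto
      then obtain m where m: "\<Union>\<S> \<subseteq> {..<m}" using finite_nat_iff_bounded by auto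
      show "\<forall>\<^sub>F M in sequentially. finite (Pow {..<M}) \<and> \<S> \<subseteq> Pow {..<M} \<and> Pow {..<M} \<subseteq> {S. finite S}"
      proof (rule eventually_sequentiallyI[of m], intro conjI)
        fix M assume "m \<le> M"
        then have "\<Union>\<S> \<subseteq> {..<M}" using m by (meson lessThan_subset_iff subset_trans)
        then show "\<S> \<subseteq> Pow {..<M}" by blast
        show "Pow {..<M} \<subseteq> {S. finite S}" using finite_subset[OF _ finite_lessThan] by blast
      qed simp
    qed
    have "((\<lambda>S. minor S (fN N)) has_sum infsum (\<lambda>S. minor S (fN N)) {S. finite S}) {S. finite S}"
      by (rule has_sum_infsum[OF sum_fN])
    from filterlim_compose[OF this[unfolded has_sum_def] filt]
    have "(\<lambda>M. \<Sum>S\<in>Pow {..<M}. minor S (fN N)) \<longlonglongrightarrow> infsum (\<lambda>S. minor S (fN N)) {S. finite S}" .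
    also have "(\<lambda>M. \<Sum>S\<in>Pow {..<M}. minor S (fN N))
        = (\<lambda>M. minor {..<N} (\<lambda>n m. (if n = m then 1 else 0) + (\<Sum>i<M. Y n i * X i m)))"
    proof (rule ext)
      fix M
      have "fN N = (\<lambda>i j. \<Sum>n<N. X i n * Y n j)" by (simp add: fN_def partial_op_form X_def Y_def)
      then show "(\<Sum>S\<in>Pow {..<M}. minor S (fN N)) = minor {..<N} (\<lambda>n m. (if n = m then 1 else 0) + (\<Sum>i<M. Y n i * X i m))"
        unfolding minor_eq_det det_one_plus_commute[where M = N and N = M and X = Y and Y = X] by (simp add: sum_minors minor_eq_det)
    qed
    finally have 1: "(\<lambda>M. minor {..<N} (\<lambda>n m. (if n = m then 1 else 0) + (\<Sum>i<M. Y n i * X i m)))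
        \<longlonglongrightarrow> infsum (\<lambda>S. minor S (fN N)) {S. finite S}" .
    have "(\<lambda>M. \<Sum>i<M. Y n i * X i m) \<longlonglongrightarrow> - \<i> * cinner (R (\<psi> n)) (\<psi> m)" for n m
    proof -
      interpret bounded_linear R using A.resolvent_clinear[OF z] by (simp add: R_def bounded_clinear_def)
      have "(\<Sum>i<M. Y n i * X i m) = - \<i> * cinner (R (\<Sum>i<M. cinner (\<psi> n) (e i) *\<^sub>C e i)) (\<psi> m)" for M
        by (simp add: Y_def X_def u_def Rlin cinner_sum_left cinner_scaleC_left sum_distrib_left sum_negf mult_ac)
      moreover have "(\<lambda>M. - \<i> * cinner (R (\<Sum>i<M. cinner (\<psi> n) (e i) *\<^sub>C e i)) (\<psi> m)) \<longlonglongrightarrow> - \<i> * cinner (R (\<psi> n)) (\<psi> m)"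
        by (intro tendsto_mult tendsto_const tendsto_cinner_left tendsto basis_expansion[OF e(1)])
      ultimately show ?thesis by simp
    qed
    then have "(\<lambda>M. minor {..<N} (\<lambda>n m. (if n = m then 1 else 0) + (\<Sum>i<M. Y n i * X i m)))
        \<longlonglongrightarrow> minor {..<N} (\<lambda>n m. (if n = m then 1 else 0) + (- \<i> * cinner (R (\<psi> n)) (\<psi> m)))"
      unfolding minor_def by (intro tendsto_intros)
    from LIMSEQ_unique[OF 1 this] have "infsum (\<lambda>S. minor S (fN N)) {S. finite S} = minor {..<N} ?G" by simp
    also have "\<dots> = (\<Prod>n<N. step_det D A \<psi> n z)"
      unfolding minor_eq_det R_def by (rule det_partial_perturbation[OF A z])
    finally show ?thesis .
  qed
  ultimately show ?thesis using lim by (simp add: \<psi>_def)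
qed


section \<open>The Poisson kernel of the upper half-plane\<close>

text \<open>Up to constants, a majorant of every Poisson kernel; convergence in \<open>L\<^sup>1\<close> with this weight is therefore
  inherited by all Poisson integrals.\<close>

definition weight :: "real \<Rightarrow> real" where
  "weight s = 1 / (1 + s\<^sup>2)"

definition pois :: "real \<Rightarrow> real \<Rightarrow> real" where
  "pois y x = y / (pi * (x\<^sup>2 + y\<^sup>2))"

lemma weight_measurable [measurable]: "weight \<in> borel_measurable borel"
  unfolding weight_def[abs_def] by measurable

lemma pois_measurable [measurable]: "(\<lambda>x. pois y x) \<in> borel_measurable borel" "(\<lambda>s. pois y (x - s)) \<in> borel_measurable borel"
  unfolding pois_def[abs_def] by measurable

lemma one_plus_square_pos: "0 < 1 + (s::real)\<^sup>2"
  using zero_le_power2[of s] by linarith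

lemma weight_pos: "0 < weight s" and weight_le_1: "weight s \<le> 1"
  using one_plus_square_pos[of s] by (auto simp: weight_def)

lemma weight_integrable: "integrable lborel weight"
proof -
  have d: "(arctan has_real_derivative weight x) (at x)" for x
    using DERIV_arctan[of x] by (simp add: weight_def field_simps)
  have "(\<integral>\<^sup>+ x. ennreal (weight x) * indicator {0..} x \<partial>lborel) = ennreal (pi / 2 - arctan 0)"
    by (rule nn_integral_FTC_atLeast) (auto simp: d less_imp_le[OF weight_pos] tendsto_arctan_at_top)
  moreover have "(\<integral>\<^sup>+ x. ennreal (weight x) * indicator {0..} x \<partial>lborel)
      = (\<integral>\<^sup>+ x. ennreal (weight x * indicator {0..} x) \<partial>lborel)"
    by (intro nn_integral_cong) (auto simp: indicator_def)
  ultimately have eq: "(\<integral>\<^sup>+ x. ennreal (weight x * indicator {0..} x) \<partial>lborel) = ennreal (pi / 2)" by simp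
  have 1: "integrable lborel (\<lambda>x. weight x * indicator {0..} x)"
  proof (rule integrableI_nonneg)
    show "(\<integral>\<^sup>+ x. ennreal (weight x * indicator {0..} x) \<partial>lborel) < \<infinity>" unfolding eq by simp
  qed (auto simp: less_imp_le[OF weight_pos] indicator_def)
  have 2: "integrable lborel (\<lambda>x. weight (- x) * indicator {0..} (- x))"
    using lborel_integrable_real_affine[OF 1, of "-1" 0] by simp
  show ?thesis
    by (rule Bochner_Integration.integrable_bound[OF Bochner_Integration.integrable_add[OF 1 2]])
       (auto simp: weight_def indicator_def less_imp_le[OF one_plus_square_pos])
qed

lemma pois_pos: "y > 0 \<Longrightarrow> 0 < pois y x"
  unfolding pois_def by (intro divide_pos_pos mult_pos_pos add_nonneg_pos) auto

lemma pois_minus: "pois y (x - s) = pois y (s - x)"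
  by (simp add: pois_def power2_commute)

lemma pois_le_weight:
  assumes y: "y > 0"
  obtains C where "C > 0" "\<And>s. pois y (x - s) \<le> C * weight s"
proof
  let ?K = "2 + (1 + 2 * x\<^sup>2) / y\<^sup>2"
  have K: "?K > 0" by (intro add_pos_nonneg divide_nonneg_nonneg) auto
  show "y / pi * ?K > 0" using y K by (intro mult_pos_pos divide_pos_pos) auto
  fix s
  have "1 + s\<^sup>2 \<le> 1 + 2 * x\<^sup>2 + 2 * (x - s)\<^sup>2"
    using zero_le_power2[of "2 * x - s"] by (simp add: power2_eq_square algebra_simps)
  also have "\<dots> \<le> ?K * ((x - s)\<^sup>2 + y\<^sup>2)"
  proof -
    have "?K * ((x - s)\<^sup>2 + y\<^sup>2) = 2 * (x - s)\<^sup>2 + (1 + 2 * x\<^sup>2) / y\<^sup>2 * (x - s)\<^sup>2 + 2 * y\<^sup>2 + (1 + 2 * x\<^sup>2)"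
      using y by (simp add: field_simps)
    moreover have "0 \<le> (1 + 2 * x\<^sup>2) / y\<^sup>2 * (x - s)\<^sup>2" by (intro mult_nonneg_nonneg divide_nonneg_nonneg) auto
    ultimately show ?thesis using zero_le_power2[of y] by linarith
  qed
  finally have le: "1 + s\<^sup>2 \<le> ?K * ((x - s)\<^sup>2 + y\<^sup>2)" .
  have pos: "0 < (x - s)\<^sup>2 + y\<^sup>2" using y by (intro add_nonneg_pos) auto
  have "1 / ((x - s)\<^sup>2 + y\<^sup>2) \<le> ?K / (1 + s\<^sup>2)"
    using le pos one_plus_square_pos[of s] by (subst frac_le_eq) (auto simp: divide_le_0_iff mult.commute)
  from mult_left_mono[OF this, of "y / pi"] show "pois y (x - s) \<le> y / pi * ?K * weight s"
    using y by (simp add: pois_def weight_def mult.commute)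
qed

lemma pois_mult_integrable:
  fixes f :: "real \<Rightarrow> 'b::{banach, second_countable_topology}"
  assumes y: "y > 0" and f: "f \<in> borel_measurable borel" "\<And>s. norm (f s) \<le> B"
  shows "integrable lborel (\<lambda>s. pois y (x - s) *\<^sub>R f s)"
proof -
  obtain C where C: "C > 0" "\<And>s. pois y (x - s) \<le> C * weight s" using pois_le_weight[OF y, of x] by blast
  have B: "0 \<le> B" using norm_ge_zero f(2) order_trans by blast
  show ?thesis
  proof (rule Bochner_Integration.integrable_bound)
    show "integrable lborel (\<lambda>s. B * (C * weight s))" by (intro integrable_mult_right weight_integrable)
    show "AE s in lborel. norm (pois y (x - s) *\<^sub>R f s) \<le> norm (B * (C * weight s))"
    proof (rule AE_I2)
      fix s
      have "norm (pois y (x - s) *\<^sub>R f s) \<le> (C * weight s) * B"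
        using pois_pos[OF y, of "x - s"] C f(2)[of s] weight_pos[of s] by (auto intro!: mult_mono)
      also have "\<dots> \<le> norm (B * (C * weight s))" by (simp add: mult_ac)
      finally show "norm (pois y (x - s) *\<^sub>R f s) \<le> norm (B * (C * weight s))" .
    qed
  qed (use f(1) in measurable)
qed

subsection \<open>The Poisson representation of bounded analytic functions\<close>

text \<open>Cauchy's formula for \<open>F(w + \<i> \<epsilon>) y / (\<pi> (w - cnj z\<^sub>0))\<close> at \<open>z\<^sub>0 = x + \<i> y\<close>, over rectangles with base
  \<open>{-L..L}\<close> and height \<open>L\<close>. On the real axis the integrand is the Poisson kernel times \<open>F\<close>, and on the other sides
  it is of order \<open>1 / L\<^sup>2\<close>.\<close>

lemma Poisson_representation:
  fixes F :: "complex \<Rightarrow> complex"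
  assumes F: "F holomorphic_on {z. Im z > 0}" and \<epsilon>: "\<epsilon> > 0" and y: "y > 0"
    and B: "\<And>z. Im z \<ge> \<epsilon> \<Longrightarrow> cmod (F z) \<le> B"
  shows "integrable lborel (\<lambda>s. pois y (x - s) *\<^sub>R F (Complex s \<epsilon>))"
    and "(LINT s|lborel. pois y (x - s) *\<^sub>R F (Complex s \<epsilon>)) = F (Complex x (y + \<epsilon>))"
proof -
  define z0 where "z0 = Complex x y"
  define S where "S = {z. Im z > - min \<epsilon> y}"
  define g where "g = (\<lambda>w. F (w + \<i> * of_real \<epsilon>) * (of_real y / (of_real pi * (w - cnj z0))))"
  define f where "f = (\<lambda>s. pois y (x - s) *\<^sub>R F (Complex s \<epsilon>))"
  have B0: "0 \<le> B" using B[of "\<i> * of_real \<epsilon>"] by (auto intro: order_trans[OF norm_ge_zero])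
  have cont: "continuous_on UNIV (\<lambda>s. F (Complex s \<epsilon>))"
  proof (rule continuous_on_compose2[OF holomorphic_on_imp_continuous_on[OF F]])
    show "continuous_on UNIV (\<lambda>s. Complex s \<epsilon>)" by (simp add: Complex_eq) (intro continuous_intros)
  qed (use \<epsilon> in auto)
  have meas: "(\<lambda>s. F (Complex s \<epsilon>)) \<in> borel_measurable borel"
    by (rule borel_measurable_continuous_onI[OF cont])
  show int: "integrable lborel (\<lambda>s. pois y (x - s) *\<^sub>R F (Complex s \<epsilon>))"
    by (rule pois_mult_integrable[OF y meas, of B]) (use B in simp)
  have gS: "g holomorphic_on S"
  proof -
    have "(\<lambda>w. F (w + \<i> * of_real \<epsilon>)) holomorphic_on S"
      by (rule holomorphic_on_compose_gen[OF _ F, unfolded o_def, where s = S])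
         (auto simp: S_def intro!: holomorphic_intros)
    moreover have "w - cnj z0 \<noteq> 0" if "w \<in> S" for w
      using that y \<epsilon> by (auto simp: S_def z0_def complex_eq_iff)
    ultimately show ?thesis unfolding g_def by (auto intro!: holomorphic_intros)
  qed
  have convS: "convex S" unfolding S_def by (rule convex_halfspace_Im_gt)
  have openS: "open S" unfolding S_def by (rule open_halfspace_Im_gt)
  have gz0: "of_real (2 * pi) * \<i> * g z0 = F (Complex x (y + \<epsilon>))"
  proof -
    have "z0 - cnj z0 = 2 * \<i> * of_real y" "z0 + \<i> * of_real \<epsilon> = Complex x (y + \<epsilon>)"
      by (simp_all add: z0_def complex_eq_iff)
    then have "of_real (2 * pi) * \<i> * g z0
        = of_real (2 * pi) * \<i> * (F (Complex x (y + \<epsilon>)) * (of_real y / (of_real pi * (2 * \<i> * of_real y))))"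
      unfolding g_def by (simp only:)
    then show ?thesis using y by (simp add: field_simps)
  qed
  define h where "h = (\<lambda>w. g w / (w - z0))"
  have main: "cmod (integral {-L..L} f - F (Complex x (y + \<epsilon>))) \<le> (B * y * 16 / pi) / L"
    if L: "L > 2 * cmod z0" "L > 0" for L
  proof -
    define c1 c2 c3 c4 where "c1 = complex_of_real (- L)" and "c2 = complex_of_real L"
      and "c3 = Complex L L" and "c4 = Complex (- L) L"
    have rect: "rectpath c1 c3 = linepath c1 c2 +++ linepath c2 c3 +++ linepath c3 c4 +++ linepath c4 c1"
      unfolding rectpath_def Let_def c1_def c2_def c3_def c4_def by (simp add: complex_of_real_def)
    have z0L: "\<bar>x\<bar> < L" "y < L"
      using L abs_Re_le_cmod[of z0] abs_Im_le_cmod[of z0] y by (auto simp: z0_def)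
    have z0box: "z0 \<in> box c1 c3"
      using z0L y by (auto simp: in_box_complex_iff c1_def c3_def z0_def)
    have sub: "path_image (rectpath c1 c3) \<subseteq> S - {z0}"
    proof -
      have "path_image (rectpath c1 c3) \<subseteq> cbox c1 c3 - box c1 c3"
        by (subst path_image_rectpath_cbox_minus_box) (use L in \<open>auto simp: c1_def c3_def\<close>)
      moreover have "cbox c1 c3 \<subseteq> S"
        using y \<epsilon> by (auto simp: in_cbox_complex_iff c1_def c3_def S_def)
      ultimately show ?thesis using z0box by auto
    qed
    have z0S: "z0 \<in> interior S" using y \<epsilon> openS by (simp add: interior_open S_def z0_def)
    have cint: "(h has_contour_integral F (Complex x (y + \<epsilon>))) (rectpath c1 c3)"
      using Cauchy_integral_formula_convex_simple[OF convS gS z0S _ sub] z0box gz0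
      by (simp add: h_def winding_number_rectpath)
    have conth: "continuous_on (S - {z0}) h"
      unfolding h_def by (intro continuous_intros holomorphic_on_imp_continuous_on holomorphic_on_subset[OF gS]) auto
    have segs: "closed_segment c1 c2 \<subseteq> S - {z0}" "closed_segment c2 c3 \<subseteq> S - {z0}"
        "closed_segment c3 c4 \<subseteq> S - {z0}" "closed_segment c4 c1 \<subseteq> S - {z0}"
      using sub unfolding rect by (auto simp: path_image_join)
    then have ints: "h contour_integrable_on linepath c1 c2" "h contour_integrable_on linepath c2 c3"
        "h contour_integrable_on linepath c3 c4" "h contour_integrable_on linepath c4 c1"
      by (auto intro!: contour_integrable_continuous_linepath continuous_on_subset[OF conth])
    have "F (Complex x (y + \<epsilon>)) = contour_integral (rectpath c1 c3) h"
      using cint by (simp add: contour_integral_unique)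
    also have "\<dots> = contour_integral (linepath c1 c2) h + (contour_integral (linepath c2 c3) h
        + (contour_integral (linepath c3 c4) h + contour_integral (linepath c4 c1) h))"
      unfolding rect using ints by (simp add: contour_integrable_joinI)
    also have "contour_integral (linepath c1 c2) h = integral {-L..L} (\<lambda>s. h (of_real s))"
      unfolding c1_def c2_def using L by (subst contour_integral_linepath_Reals_eq) auto
    also have "(\<lambda>s. h (of_real s)) = f"
    proof
      fix s
      have "(of_real s - cnj z0) * (of_real s - z0) = complex_of_real ((x - s)\<^sup>2 + y\<^sup>2)"
        by (simp add: z0_def complex_eq_iff power2_eq_square algebra_simps)
      moreover have "of_real s + \<i> * of_real \<epsilon> = Complex s \<epsilon>" by (simp add: complex_eq_iff)
      ultimately show "h (of_real s) = f s"
        by (simp add: h_def g_def f_def pois_def scaleR_conv_of_real mult.assoc)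
    qed
    finally have eq: "integral {-L..L} f - F (Complex x (y + \<epsilon>)) = - (contour_integral (linepath c2 c3) h
        + (contour_integral (linepath c3 c4) h + contour_integral (linepath c4 c1) h))" by simp
    let ?K = "B * y * 4 / (pi * L\<^sup>2)"
    have K0: "0 \<le> ?K" using B0 y by (intro divide_nonneg_nonneg mult_nonneg_nonneg) auto
    have h_le: "cmod (h w) \<le> ?K" if "Im w \<ge> 0" "cmod w \<ge> L" for w
    proof -
      have a: "cmod (w - z0) \<ge> L / 2" "cmod (w - cnj z0) \<ge> L / 2"
        using that L norm_triangle_ineq2[of w z0] norm_triangle_ineq2[of w "cnj z0"] by (simp_all add: field_simps)
      have "(L / 2) * (L / 2) \<le> cmod (w - cnj z0) * cmod (w - z0)"
        using a L by (intro mult_mono) auto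
      then have "L\<^sup>2 / 4 \<le> cmod (w - cnj z0) * cmod (w - z0)" by (simp add: power2_eq_square)
      then have "B * y / (pi * (cmod (w - cnj z0) * cmod (w - z0))) \<le> B * y / (pi * (L\<^sup>2 / 4))"
        using B0 y L by (intro divide_left_mono mult_left_mono mult_pos_pos) (auto intro: mult_nonneg_nonneg)
      moreover have "cmod (F (w + \<i> * of_real \<epsilon>)) \<le> B" using that by (intro B) simp
      then have "cmod (F (w + \<i> * of_real \<epsilon>)) * y / (pi * (cmod (w - cnj z0) * cmod (w - z0)))
          \<le> B * y / (pi * (cmod (w - cnj z0) * cmod (w - z0)))"
        using y by (intro divide_right_mono mult_right_mono) auto
      ultimately show ?thesis using y by (simp add: h_def g_def norm_mult norm_divide mult.assoc)
    qed
    have far: "Im w \<ge> 0 \<and> cmod w \<ge> L" if "w \<in> closed_segment c2 c3 \<or> w \<in> closed_segment c3 c4 \<or> w \<in> closed_segment c4 c1" for w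
    proof -
      from that have "Im w \<ge> 0 \<and> (\<bar>Re w\<bar> = L \<or> \<bar>Im w\<bar> = L)"
        using L closed_segment_same_Re[of c2 c3] closed_segment_same_Im[of c3 c4] closed_segment_same_Re[of c4 c1]
        by (auto simp: c1_def c2_def c3_def c4_def closed_segment_eq_real_ivl)
      then show ?thesis using abs_Re_le_cmod[of w] abs_Im_le_cmod[of w] by auto
    qed
    have "c3 - c2 = \<i> * of_real L" "c4 - c3 = - of_real (2 * L)" "c1 - c4 = - (\<i> * of_real L)"
      by (simp_all add: c1_def c2_def c3_def c4_def complex_eq_iff)
    then have len: "cmod (c3 - c2) = L" "cmod (c4 - c3) = 2 * L" "cmod (c1 - c4) = L"
      using L by (simp_all add: norm_mult del: of_real_mult)
    have "cmod (contour_integral (linepath c2 c3) h) \<le> ?K * L"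
      unfolding len(1)[symmetric] by (rule contour_integral_bound_linepath) (use ints K0 h_le far len in auto)
    moreover have "cmod (contour_integral (linepath c3 c4) h) \<le> ?K * (2 * L)"
      unfolding len(2)[symmetric] by (rule contour_integral_bound_linepath) (use ints K0 h_le far len in auto)
    moreover have "cmod (contour_integral (linepath c4 c1) h) \<le> ?K * L"
      unfolding len(3)[symmetric] by (rule contour_integral_bound_linepath) (use ints K0 h_le far len in auto)
    ultimately have "cmod (integral {-L..L} f - F (Complex x (y + \<epsilon>))) \<le> ?K * L + (?K * (2 * L) + ?K * L)"
      unfolding eq norm_minus_cancel by (intro norm_triangle_le add_mono)
    also have "\<dots> = (B * y * 16 / pi) / L" using L by (simp add: field_simps power2_eq_square)
    finally show ?thesis .
  qed
  have fint: "integrable lborel f" using int by (simp add: f_def)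
  have lim1: "(\<lambda>n. LINT s|lborel. indicator {- real n..real n} s *\<^sub>R f s) \<longlonglongrightarrow> (LINT s|lborel. f s)"
  proof (rule integral_dominated_convergence[where w = "\<lambda>s. norm (f s)"])
    show "AE s in lborel. (\<lambda>n. indicator {- real n..real n} s *\<^sub>R f s) \<longlonglongrightarrow> f s"
    proof (rule AE_I2, rule tendsto_eventually)
      fix s
      obtain m :: nat where "\<bar>s\<bar> \<le> real m" using real_arch_simple by blast
      then show "\<forall>\<^sub>F n in sequentially. indicator {- real n..real n} s *\<^sub>R f s = f s"
        by (intro eventually_sequentiallyI[of m]) (auto simp: indicator_def)
    qed
  qed (use fint in \<open>auto simp: indicator_def\<close>)
  have eqI: "(LINT s|lborel. indicator {- real n..real n} s *\<^sub>R f s) = integral {- real n..real n} f" for n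
  proof -
    have "set_integrable lborel {- real n..real n} f"
      unfolding set_integrable_def by (rule integrable_mult_indicator[OF _ fint]) simp
    from set_borel_integral_eq_integral(2)[OF this] show ?thesis by (simp add: set_lebesgue_integral_def)
  qed
  have lim2: "(\<lambda>n. integral {- real n..real n} f) \<longlonglongrightarrow> F (Complex x (y + \<epsilon>))"
  proof (rule LIM_zero_cancel, rule Lim_null_comparison)
    obtain m :: nat where m: "2 * cmod z0 < real m" using reals_Archimedean2 by blast
    show "\<forall>\<^sub>F n in sequentially. norm (integral {- real n..real n} f - F (Complex x (y + \<epsilon>))) \<le> (B * y * 16 / pi) / real n"
    proof (rule eventually_sequentiallyI[of "Suc m"])
      fix n assume "Suc m \<le> n"
      then show "norm (integral {- real n..real n} f - F (Complex x (y + \<epsilon>))) \<le> (B * y * 16 / pi) / real n"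
        using m by (intro main) auto
    qed
    show "(\<lambda>n. (B * y * 16 / pi) / real n) \<longlonglongrightarrow> 0" by (rule lim_const_over_n)
  qed
  show "(LINT s|lborel. pois y (x - s) *\<^sub>R F (Complex s \<epsilon>)) = F (Complex x (y + \<epsilon>))"
    using LIMSEQ_unique[OF lim1[unfolded eqI] lim2] by (simp add: f_def)
qed


lemma Poisson_representation_Re:
  assumes F: "F holomorphic_on {z. Im z > 0}" and \<epsilon>: "\<epsilon> > 0" and y: "y > 0"
    and B: "\<And>z. Im z \<ge> \<epsilon> \<Longrightarrow> cmod (F z) \<le> B"
  shows "integrable lborel (\<lambda>s. pois y (x - s) * Re (F (Complex s \<epsilon>)))"
    and "(LINT s|lborel. pois y (x - s) * Re (F (Complex s \<epsilon>))) = Re (F (Complex x (y + \<epsilon>)))"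
proof -
  note rep = Poisson_representation[OF assms, of x]
  show "integrable lborel (\<lambda>s. pois y (x - s) * Re (F (Complex s \<epsilon>)))"
    using integrable_Re[OF rep(1)] by simp
  show "(LINT s|lborel. pois y (x - s) * Re (F (Complex s \<epsilon>))) = Re (F (Complex x (y + \<epsilon>)))"
    using integral_Re[OF rep(1)] rep(2) by simp
qed

text \<open>The kernel \<open>\<pi> y P\<^sub>y\<close> increases to \<open>1\<close>, so that the mass of a positive function can be read off
  from the decay of its Poisson integral along the imaginary axis.\<close>

lemma integral_from_Poisson_decay:
  fixes f :: "real \<Rightarrow> real"
  assumes f: "f \<in> borel_measurable borel" "\<And>s. 0 \<le> f s"
    and int: "\<And>y. y > 0 \<Longrightarrow> integrable lborel (\<lambda>s. pois y s * f s)"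
    and lim: "((\<lambda>y. y * (LINT s|lborel. pois y s * f s)) \<longlongrightarrow> c) at_top"
  shows "integrable lborel f" and "(LINT s|lborel. f s) = pi * c"
proof -
  define r where "r = (\<lambda>n::nat. real (Suc n))"
  define k where "k = (\<lambda>n s. (r n)\<^sup>2 / (s\<^sup>2 + (r n)\<^sup>2))"
  have r: "r n > 0" for n by (simp add: r_def)
  have k_pois: "k n s = pi * r n * pois (r n) s" for n s
    by (simp add: k_def pois_def power2_eq_square)
  have pos: "0 < s\<^sup>2 + (r n)\<^sup>2" for n s using r[of n] by (intro add_nonneg_pos) auto
  have k0: "0 \<le> k n s" for n s unfolding k_def using pos[of s n] by (intro divide_nonneg_pos) auto
  have mono: "k m s \<le> k n s" if "m \<le> n" for m n s
  proof -
    have "(r m)\<^sup>2 \<le> (r n)\<^sup>2" using that by (intro power_mono) (auto simp: r_def)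
    then have "(r m)\<^sup>2 * s\<^sup>2 \<le> (r n)\<^sup>2 * s\<^sup>2" by (intro mult_right_mono) auto
    then show ?thesis unfolding k_def using pos[of s m] pos[of s n]
      by (simp add: divide_le_eq le_divide_eq) (simp add: algebra_simps divide_le_eq le_divide_eq)
  qed
  have k_lim: "(\<lambda>n. k n s) \<longlonglongrightarrow> 1" for s
  proof -
    have k_alt: "k n s = 1 / (s\<^sup>2 * (inverse (r n))\<^sup>2 + 1)" for n
      using r[of n] by (simp add: k_def field_simps)
    have "(\<lambda>n. inverse (r n)) \<longlonglongrightarrow> 0" unfolding r_def by (rule LIMSEQ_inverse_real_of_nat)
    then have "(\<lambda>n. 1 / (s\<^sup>2 * (inverse (r n))\<^sup>2 + 1)) \<longlonglongrightarrow> 1 / (s\<^sup>2 * 0\<^sup>2 + 1)"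
      by (intro tendsto_intros) auto
    then show ?thesis by (simp add: k_alt)
  qed
  have "(\<lambda>n. \<integral>\<^sup>+ s. ennreal (k n s * f s) \<partial>lborel) \<longlonglongrightarrow> (\<integral>\<^sup>+ s. ennreal (f s) \<partial>lborel)"
  proof (rule nn_integral_LIMSEQ)
    show "incseq (\<lambda>n s. ennreal (k n s * f s))"
      by (auto simp: incseq_def le_fun_def intro!: ennreal_leI mult_right_mono mono f)
    show "(\<lambda>s. ennreal (k n s * f s)) \<in> borel_measurable lborel" for n
      using f(1) unfolding k_pois by measurable
    show "(\<lambda>n. ennreal (k n s * f s)) \<longlonglongrightarrow> ennreal (f s)" for s
      using tendsto_mult[OF k_lim[of s] tendsto_const[of "f s"]] by (intro tendsto_ennrealI) simp
  qed
  moreover have "(\<integral>\<^sup>+ s. ennreal (k n s * f s) \<partial>lborel) = ennreal (pi * (r n * (LINT s|lborel. pois (r n) s * f s)))" for n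
  proof -
    have "integrable lborel (\<lambda>s. pi * r n * (pois (r n) s * f s))"
      by (intro integrable_mult_right int r)
    then have "(\<integral>\<^sup>+ s. ennreal (k n s * f s) \<partial>lborel) = ennreal (LINT s|lborel. pi * r n * (pois (r n) s * f s))"
      by (subst nn_integral_eq_integral[symmetric]) (auto simp: k_pois mult.assoc less_imp_le[OF r] f less_imp_le[OF pois_pos[OF r]])
    then show ?thesis by (simp add: mult.assoc)
  qed
  moreover have "filterlim r at_top sequentially"
    unfolding r_def by (intro filterlim_compose[OF filterlim_real_sequentially] filterlim_Suc)
  then have *: "(\<lambda>n. pi * (r n * (LINT s|lborel. pois (r n) s * f s))) \<longlonglongrightarrow> pi * c"
    by (intro tendsto_mult tendsto_const filterlim_compose[OF lim])
  then have "(\<lambda>n. ennreal (pi * (r n * (LINT s|lborel. pois (r n) s * f s)))) \<longlonglongrightarrow> ennreal (pi * c)"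
    by (rule tendsto_ennrealI)
  ultimately have nn: "(\<integral>\<^sup>+ s. ennreal (f s) \<partial>lborel) = ennreal (pi * c)"
    using LIMSEQ_unique by simp
  have c0: "0 \<le> pi * c"
    by (rule tendsto_lowerbound[OF *])
       (auto intro!: always_eventually mult_nonneg_nonneg Bochner_Integration.integral_nonneg simp: less_imp_le[OF r] f less_imp_le[OF pois_pos[OF r]])
  show i: "integrable lborel f"
    by (rule integrableI_nonneg) (use f nn in auto)
  show "(LINT s|lborel. f s) = pi * c"
    using nn_integral_eq_integral[OF i] nn f(2) c0 by (simp add: Bochner_Integration.integral_nonneg)
qed

subsection \<open>Boundary values of square-integrable positive harmonic functions\<close>

text \<open>If \<open>U\<^sub>y\<close> is the restriction to the line \<open>Im z = y\<close> of a harmonic function, the symmetric semigroup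
  law \<open>U\<^bsub>a+b\<^esub> = P\<^sub>a * U\<^sub>b\<close> gives \<open>\<langle>U\<^sub>b, U\<^bsub>b+2a\<^esub>\<rangle> = \<parallel>U\<^bsub>b+a\<^esub>\<parallel>\<^sup>2\<close>. Hence \<open>\<parallel>U\<^sub>y\<parallel>\<^sup>2\<close> is convex in \<open>y\<close>; being
  bounded it decreases, and the same identity makes \<open>U\<^sub>y\<close> a Cauchy family in \<open>L\<^sup>2\<close> as \<open>y \<rightarrow> 0\<close>.\<close>

lemma L2_boundary_function:
  fixes U :: "real \<Rightarrow> real \<Rightarrow> real"
  assumes meas: "\<And>y. y > 0 \<Longrightarrow> U y \<in> borel_measurable borel"
    and nonneg: "\<And>y x. y > 0 \<Longrightarrow> 0 \<le> U y x"
    and rep_int: "\<And>a b x. a > 0 \<Longrightarrow> b > 0 \<Longrightarrow> integrable lborel (\<lambda>s. pois a (x - s) * U b s)"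
    and rep: "\<And>a b x. a > 0 \<Longrightarrow> b > 0 \<Longrightarrow> (LINT s|lborel. pois a (x - s) * U b s) = U (a + b) x"
    and sq_int: "\<And>y. y > 0 \<Longrightarrow> integrable lborel (\<lambda>s. (U y s)\<^sup>2)"
    and sq_le: "\<And>y. y > 0 \<Longrightarrow> (LINT s|lborel. (U y s)\<^sup>2) \<le> C"
    and cont: "\<And>y x \<epsilon>. y > 0 \<Longrightarrow> (\<And>n::nat. \<epsilon> n > 0) \<Longrightarrow> \<epsilon> \<longlonglongrightarrow> 0 \<Longrightarrow> (\<lambda>n. U (y + \<epsilon> n) x) \<longlonglongrightarrow> U y x"
  obtains \<zeta> where "\<zeta> \<in> borel_measurable borel" "\<And>s. 0 \<le> \<zeta> s"
    "\<And>y x. y > 0 \<Longrightarrow> integrable lborel (\<lambda>s. pois y (x - s) * \<zeta> s)"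
    "\<And>y x. y > 0 \<Longrightarrow> (LINT s|lborel. pois y (x - s) * \<zeta> s) = U y x"
proof -
  define N where "N = (\<lambda>y. LINT s|lborel. (U y s)\<^sup>2)"
  have rep_nn: "(\<integral>\<^sup>+ s. ennreal (pois a (x - s)) * ennreal (U b s) \<partial>lborel) = ennreal (U (a + b) x)"
    if "a > 0" "b > 0" for a b x
    using nn_integral_eq_integral[OF rep_int[OF that, of x]] rep[OF that, of x] that
    by (simp add: ennreal_mult[symmetric] less_imp_le[OF pois_pos] nonneg)
  have prod_int: "integrable lborel (\<lambda>s. U b s * U c s)" if bc: "b > 0" "c > 0" for b c
  proof (rule Bochner_Integration.integrable_bound[OF Bochner_Integration.integrable_add[OF sq_int[OF bc(1)] sq_int[OF bc(2)]]])
    show "(\<lambda>s. U b s * U c s) \<in> borel_measurable lborel" using meas[OF bc(1)] meas[OF bc(2)] by measurable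
    have "\<bar>U b s * U c s\<bar> \<le> (U b s)\<^sup>2 + (U c s)\<^sup>2" for s
    proof -
      have "0 \<le> (U b s - U c s)\<^sup>2" by simp
      then have "2 * (U b s * U c s) \<le> (U b s)\<^sup>2 + (U c s)\<^sup>2" by (simp add: power2_eq_square algebra_simps)
      moreover have "0 \<le> U b s * U c s" using bc by (intro mult_nonneg_nonneg nonneg)
      ultimately show ?thesis by linarith
    qed
    then show "AE s in lborel. norm (U b s * U c s) \<le> norm ((U b s)\<^sup>2 + (U c s)\<^sup>2)"
      by (intro AE_I2) (simp add: order_trans[OF _ abs_ge_self])
  qed
  have cross: "(LINT s|lborel. U b s * U (b + 2 * a) s) = N (b + a)" if ab: "a > 0" "b > 0" for a b
  proof -
    have [measurable]: "U b \<in> borel_measurable borel" "U (b + a) \<in> borel_measurable borel" "U (b + 2 * a) \<in> borel_measurable borel"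
      using meas ab by auto
    have ba: "b + a > 0" "b + 2 * a > 0" using ab by auto
    have "ennreal (N (b + a)) = (\<integral>\<^sup>+ t. ennreal ((U (b + a) t)\<^sup>2) \<partial>lborel)"
      unfolding N_def by (rule nn_integral_eq_integral[OF sq_int[OF ba(1)], symmetric]) simp
    also have "\<dots> = (\<integral>\<^sup>+ t. ennreal (U (b + a) t) * (\<integral>\<^sup>+ x. ennreal (pois a (t - x)) * ennreal (U b x) \<partial>lborel) \<partial>lborel)"
      using ab by (intro nn_integral_cong) (simp add: rep_nn power2_eq_square ennreal_mult nonneg add.commute)
    also have "\<dots> = (\<integral>\<^sup>+ t. (\<integral>\<^sup>+ x. ennreal (U (b + a) t) * (ennreal (pois a (t - x)) * ennreal (U b x)) \<partial>lborel) \<partial>lborel)"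
      by (intro nn_integral_cong nn_integral_cmult[symmetric]) measurable
    also have "\<dots> = (\<integral>\<^sup>+ x. (\<integral>\<^sup>+ t. ennreal (U (b + a) t) * (ennreal (pois a (t - x)) * ennreal (U b x)) \<partial>lborel) \<partial>lborel)"
      by (rule lborel_pair.Fubini'[symmetric]) (simp add: pois_def, measurable)
    also have "\<dots> = (\<integral>\<^sup>+ x. (\<integral>\<^sup>+ t. ennreal (U b x) * (ennreal (pois a (x - t)) * ennreal (U (b + a) t)) \<partial>lborel) \<partial>lborel)"
      by (intro nn_integral_cong) (simp add: mult_ac pois_minus)
    also have "\<dots> = (\<integral>\<^sup>+ x. ennreal (U b x) * (\<integral>\<^sup>+ t. ennreal (pois a (x - t)) * ennreal (U (b + a) t) \<partial>lborel) \<partial>lborel)"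
      by (intro nn_integral_cong nn_integral_cmult) measurable
    also have "\<dots> = (\<integral>\<^sup>+ x. ennreal (U b x * U (b + 2 * a) x) \<partial>lborel)"
    proof (rule nn_integral_cong)
      fix x
      have e: "a + (b + a) = b + 2 * a" by simp
      show "ennreal (U b x) * (\<integral>\<^sup>+ t. ennreal (pois a (x - t)) * ennreal (U (b + a) t) \<partial>lborel)
          = ennreal (U b x * U (b + 2 * a) x)"
        unfolding rep_nn[OF ab(1) ba(1), of x] e using ab ba by (simp only: ennreal_mult nonneg)
    qed
    also have "\<dots> = ennreal (LINT s|lborel. U b s * U (b + 2 * a) s)"
      by (rule nn_integral_eq_integral[OF prod_int]) (use ab ba in \<open>auto simp: nonneg\<close>)
    finally show ?thesis
      by (subst (asm) ennreal_inj) (auto simp: N_def intro!: Bochner_Integration.integral_nonneg mult_nonneg_nonneg nonneg ab ba)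
  qed
  have diff_int: "integrable lborel (\<lambda>s. (U b s - U c s)\<^sup>2)"
    and diff: "(LINT s|lborel. (U b s - U c s)\<^sup>2) = N b + N c - 2 * (LINT s|lborel. U b s * U c s)"
    if bc: "b > 0" "c > 0" for b c
  proof -
    have eq: "(\<lambda>s. (U b s - U c s)\<^sup>2) = (\<lambda>s. ((U b s)\<^sup>2 + (U c s)\<^sup>2) - 2 * (U b s * U c s))"
      by (simp add: fun_eq_iff power2_eq_square algebra_simps)
    show "integrable lborel (\<lambda>s. (U b s - U c s)\<^sup>2)"
      unfolding eq using bc by (intro Bochner_Integration.integrable_diff Bochner_Integration.integrable_add integrable_mult_right sq_int prod_int)
    show "(LINT s|lborel. (U b s - U c s)\<^sup>2) = N b + N c - 2 * (LINT s|lborel. U b s * U c s)"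
      unfolding eq N_def using bc by (simp add: sq_int prod_int)
  qed
  have convex: "2 * N (b + a) \<le> N b + N (b + 2 * a)" if ab: "a > 0" "b > 0" for a b
  proof -
    have "0 \<le> (LINT s|lborel. (U b s - U (b + 2 * a) s)\<^sup>2)" by (intro Bochner_Integration.integral_nonneg) auto
    then show ?thesis using diff[of b "b + 2 * a"] cross[OF ab] ab by simp
  qed
  \<comment> \<open>A convex function that increases somewhere grows at least linearly from there on.\<close>
  have antimono1: "N (b + a) \<le> N b" if ab: "a > 0" "b > 0" for a b
  proof (rule ccontr)
    assume "\<not> N (b + a) \<le> N b"
    define \<delta> where "\<delta> = N (b + a) - N b"
    have \<delta>: "\<delta> > 0" using \<open>\<not> N (b + a) \<le> N b\<close> by (simp add: \<delta>_def)
    have step: "\<delta> \<le> N (b + real (Suc k) * a) - N (b + real k * a)" for k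
    proof (induction k)
      case (Suc k)
      have "2 * N ((b + real k * a) + a) \<le> N (b + real k * a) + N ((b + real k * a) + 2 * a)"
        using ab by (intro convex) (auto intro: add_pos_nonneg)
      moreover have "(b + real k * a) + a = b + real (Suc k) * a" "(b + real k * a) + 2 * a = b + real (Suc (Suc k)) * a"
        by (simp_all add: algebra_simps)
      ultimately have "2 * N (b + real (Suc k) * a) \<le> N (b + real k * a) + N (b + real (Suc (Suc k)) * a)" by simp
      then show ?case using Suc by linarith
    qed (simp add: \<delta>_def)
    have grow: "real k * \<delta> + N b \<le> N (b + real k * a)" for k
    proof (induction k)
      case (Suc k)
      have "real (Suc k) * \<delta> = real k * \<delta> + \<delta>" by (simp add: algebra_simps)
      then show ?case using Suc step[of k] by linarith
    qed simp
    obtain k :: nat where k: "(C - N b) / \<delta> < real k" using reals_Archimedean2 by blast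
    have "C < real k * \<delta> + N b" using k \<delta> by (simp add: divide_less_eq algebra_simps)
    also have "\<dots> \<le> N (b + real k * a)" by (rule grow)
    also have "\<dots> \<le> C" unfolding N_def using ab by (intro sq_le add_pos_nonneg) auto
    finally show False by simp
  qed
  have antimono: "N c \<le> N b" if "0 < b" "b \<le> c" for b c
    using antimono1[of "c - b" b] that by (cases "b = c") auto
  define L where "L = (SUP y\<in>{0<..}. N y)"
  have bdd: "bdd_above (N ` {0<..})"
    using sq_le by (intro bdd_aboveI[where M = C]) (auto simp: N_def)
  have N_le_L: "N y \<le> L" if "y > 0" for y
    unfolding L_def by (rule cSUP_upper[OF _ bdd]) (use that in auto)
  have "\<exists>y. 0 < y \<and> y \<le> 1 / real (Suc k) \<and> L - (1/4)^k < N y" for k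
  proof -
    have "\<exists>y\<in>{0<..}. L - (1/4)^k < N y"
      by (rule less_cSUP_iff[THEN iffD1, OF _ bdd, folded L_def]) (auto simp: greaterThan_def intro: exI[of _ 1])
    then obtain y where y: "y > 0" "L - (1/4)^k < N y" by auto
    show ?thesis
    proof (intro exI conjI)
      show "0 < min y (1 / real (Suc k))" "min y (1 / real (Suc k)) \<le> 1 / real (Suc k)" using y by auto
      have "N y \<le> N (min y (1 / real (Suc k)))" using y by (intro antimono) auto
      then show "L - (1/4)^k < N (min y (1 / real (Suc k)))" using y by linarith
    qed
  qed
  then obtain \<epsilon> where \<epsilon>: "\<And>k. 0 < \<epsilon> k" "\<And>k. \<epsilon> k \<le> 1 / real (Suc k)" "\<And>k. L - (1/4)^k < N (\<epsilon> k)" by metis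
  have \<epsilon>_lim: "\<epsilon> \<longlonglongrightarrow> 0"
  proof (rule tendsto_sandwich[where f = "\<lambda>_. 0" and h = "\<lambda>k. 1 / real (Suc k)"])
    show "(\<lambda>k. 1 / real (Suc k)) \<longlonglongrightarrow> 0" using LIMSEQ_inverse_real_of_nat by (simp add: inverse_eq_divide)
  qed (use \<epsilon> in \<open>auto intro!: always_eventually less_imp_le\<close>)
  have D: "(LINT s|lborel. (U b s - U c s)\<^sup>2) \<le> N b - N c" if "0 < b" "b \<le> c" for b c
  proof (cases "b = c")
    case False
    have e: "b + 2 * ((c - b) / 2) = c" by (simp add: field_simps)
    have "(c - b) / 2 > 0" using that False by simp
    then have "(LINT s|lborel. U b s * U c s) = N (b + (c - b) / 2)"
      using cross[of "(c - b) / 2" b] that(1) unfolding e by simp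
    then have "(LINT s|lborel. (U b s - U c s)\<^sup>2) = N b + N c - 2 * N (b + (c - b) / 2)"
      using diff[of b c] that by simp
    moreover have "N c \<le> N (b + (c - b) / 2)" using that by (intro antimono) (auto simp: field_simps)
    ultimately show ?thesis by linarith
  qed simp
  define \<Delta> where "\<Delta> = (\<lambda>k s. U (\<epsilon> (Suc k)) s - U (\<epsilon> k) s)"
  have \<Delta>_meas [measurable]: "\<Delta> k \<in> borel_measurable borel" for k
    unfolding \<Delta>_def using meas[OF \<epsilon>(1)[of k]] meas[OF \<epsilon>(1)[of "Suc k"]] by measurable
  have \<Delta>_int: "integrable lborel (\<lambda>s. (\<Delta> k s)\<^sup>2)" for k
    unfolding \<Delta>_def by (intro diff_int \<epsilon>)
  have \<Delta>_sq: "(LINT s|lborel. (\<Delta> k s)\<^sup>2) \<le> (1/4)^k" for k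
  proof (cases "\<epsilon> (Suc k) \<le> \<epsilon> k")
    case True
    have "(LINT s|lborel. (\<Delta> k s)\<^sup>2) \<le> N (\<epsilon> (Suc k)) - N (\<epsilon> k)" unfolding \<Delta>_def by (intro D \<epsilon> True)
    then show ?thesis using N_le_L[OF \<epsilon>(1)[of "Suc k"]] \<epsilon>(3)[of k] by linarith
  next
    case False
    have "(LINT s|lborel. (\<Delta> k s)\<^sup>2) = (LINT s|lborel. (U (\<epsilon> k) s - U (\<epsilon> (Suc k)) s)\<^sup>2)"
      unfolding \<Delta>_def by (intro Bochner_Integration.integral_cong) (auto simp: power2_commute)
    also have "\<dots> \<le> N (\<epsilon> k) - N (\<epsilon> (Suc k))" using False by (intro D \<epsilon>) simp
    also have "\<dots> \<le> (1/4)^Suc k" using N_le_L[OF \<epsilon>(1)[of k]] \<epsilon>(3)[of "Suc k"] by linarith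
    also have "\<dots> \<le> (1/4)^k" by simp
    finally show ?thesis .
  qed
  have w2: "integrable lborel (\<lambda>s. (weight s)\<^sup>2)"
  proof (rule Bochner_Integration.integrable_bound[OF weight_integrable])
    show "AE s in lborel. norm ((weight s)\<^sup>2) \<le> norm (weight s)"
      using weight_pos weight_le_1 by (intro AE_I2) (simp add: power2_eq_square mult_left_le less_imp_le)
  qed measurable
  define K where "K = (LINT s|lborel. (weight s)\<^sup>2) + 1"
  \<comment> \<open>\<open>a b \<le> \<delta> a\<^sup>2 + b\<^sup>2 / \<delta>\<close> with \<open>\<delta> = 2 ^ (- k)\<close> balances the decay of \<open>\<parallel>\<Delta> k\<parallel>\<^sup>2\<close> against the fixed weight.\<close>
  have w_le: "weight s * \<bar>\<Delta> k s\<bar> \<le> (1/2)^k * (weight s)\<^sup>2 + 2^k * (\<Delta> k s)\<^sup>2" for k s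
  proof -
    have "0 \<le> (1/2)^k * (weight s - 2^k * \<bar>\<Delta> k s\<bar>)\<^sup>2" by simp
    also have "\<dots> = (1/2)^k * (weight s)\<^sup>2 + 2^k * (\<Delta> k s)\<^sup>2 - 2 * (weight s * \<bar>\<Delta> k s\<bar>)"
      by (simp add: power2_eq_square field_simps abs_mult_self_eq)
    finally have "2 * (weight s * \<bar>\<Delta> k s\<bar>) \<le> (1/2)^k * (weight s)\<^sup>2 + 2^k * (\<Delta> k s)\<^sup>2" by simp
    moreover have "0 \<le> weight s * \<bar>\<Delta> k s\<bar>" using weight_pos[of s] by simp
    ultimately show ?thesis by linarith
  qed
  have bnd_int: "integrable lborel (\<lambda>s. (1/2)^k * (weight s)\<^sup>2 + 2^k * (\<Delta> k s)\<^sup>2)" for k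
    by (intro Bochner_Integration.integrable_add integrable_mult_right w2 \<Delta>_int)
  have w\<Delta>_int: "integrable lborel (\<lambda>s. weight s * \<bar>\<Delta> k s\<bar>)" for k
  proof (rule Bochner_Integration.integrable_bound[OF bnd_int])
    show "AE s in lborel. norm (weight s * \<bar>\<Delta> k s\<bar>) \<le> norm ((1/2)^k * (weight s)\<^sup>2 + 2^k * (\<Delta> k s)\<^sup>2)"
      using w_le weight_pos by (intro AE_I2) (simp add: abs_mult less_imp_le order_trans[OF _ abs_ge_self])
  qed measurable
  have w\<Delta>_le: "(LINT s|lborel. weight s * \<bar>\<Delta> k s\<bar>) \<le> K * (1/2)^k" for k
  proof -
    have "(LINT s|lborel. weight s * \<bar>\<Delta> k s\<bar>) \<le> (LINT s|lborel. (1/2)^k * (weight s)\<^sup>2 + 2^k * (\<Delta> k s)\<^sup>2)"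
      by (rule Bochner_Integration.integral_mono[OF w\<Delta>_int bnd_int w_le])
    also have "\<dots> = (1/2)^k * (LINT s|lborel. (weight s)\<^sup>2) + 2^k * (LINT s|lborel. (\<Delta> k s)\<^sup>2)"
      using w2 \<Delta>_int[of k] by simp
    also have "\<dots> \<le> (1/2)^k * (LINT s|lborel. (weight s)\<^sup>2) + 2^k * (1/4)^k"
      by (intro add_left_mono mult_left_mono \<Delta>_sq) auto
    also have "2^k * (1/4)^k = (1/2::real)^k" by (simp add: power_mult_distrib[symmetric])
    finally show ?thesis by (simp add: K_def algebra_simps)
  qed
  have w\<Delta>_nonneg: "0 \<le> (LINT s|lborel. weight s * \<bar>\<Delta> k s\<bar>)" for k
    by (intro Bochner_Integration.integral_nonneg mult_nonneg_nonneg less_imp_le[OF weight_pos]) auto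
  have sum_w\<Delta>: "summable (\<lambda>k. LINT s|lborel. weight s * \<bar>\<Delta> k s\<bar>)"
  proof (rule summable_comparison_test')
    show "summable (\<lambda>k. K * (1/2)^k)" by (intro summable_mult summable_geometric) simp
    fix k
    show "norm (LINT s|lborel. weight s * \<bar>\<Delta> k s\<bar>) \<le> K * (1/2)^k"
      using w\<Delta>_le[of k] w\<Delta>_nonneg[of k] by simp
  qed
  have AE_sum: "AE s in lborel. summable (\<lambda>k. \<bar>\<Delta> k s\<bar>)"
  proof -
    have "(\<integral>\<^sup>+ s. (\<Sum>k. ennreal (weight s * \<bar>\<Delta> k s\<bar>)) \<partial>lborel) = (\<Sum>k. \<integral>\<^sup>+ s. ennreal (weight s * \<bar>\<Delta> k s\<bar>) \<partial>lborel)"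
      by (rule nn_integral_suminf) measurable
    also have "\<dots> = (\<Sum>k. ennreal (LINT s|lborel. weight s * \<bar>\<Delta> k s\<bar>))"
      by (intro suminf_cong nn_integral_eq_integral w\<Delta>_int) (auto intro!: mult_nonneg_nonneg less_imp_le[OF weight_pos])
    also have "\<dots> \<noteq> \<infinity>"
      using ennreal_suminf_neq_top[OF sum_w\<Delta> w\<Delta>_nonneg] by (simp add: infinity_ennreal_def)
    finally have "AE s in lborel. (\<Sum>k. ennreal (weight s * \<bar>\<Delta> k s\<bar>)) \<noteq> \<infinity>"
      by (intro nn_integral_noteq_infinite) auto
    then show ?thesis
    proof eventually_elim
      case (elim s)
      then have "summable (\<lambda>k. weight s * \<bar>\<Delta> k s\<bar>)"
        by (intro summable_suminf_not_top) (auto intro!: mult_nonneg_nonneg less_imp_le[OF weight_pos])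
      then show ?case using summable_mult_D weight_pos[of s] by fastforce
    qed
  qed
  define \<zeta>0 where "\<zeta>0 = (\<lambda>s. U (\<epsilon> 0) s + (\<Sum>k. \<Delta> k s))"
  \<comment> \<open>The limit is non-negative almost everywhere; the maximum makes it so everywhere.\<close>
  define \<zeta> where "\<zeta> = (\<lambda>s. max 0 (\<zeta>0 s))"
  have U0_meas [measurable]: "U (\<epsilon> 0) \<in> borel_measurable borel" by (rule meas[OF \<epsilon>(1)])
  have \<zeta>_meas: "\<zeta> \<in> borel_measurable borel" unfolding \<zeta>_def \<zeta>0_def by measurable
  have AE_\<zeta>: "AE s in lborel. \<zeta> s = \<zeta>0 s"
    using AE_sum
  proof eventually_elim
    case (elim s)
    have "(\<lambda>n. U (\<epsilon> 0) s + (\<Sum>k<n. \<Delta> k s)) \<longlonglongrightarrow> \<zeta>0 s"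
      unfolding \<zeta>0_def by (intro tendsto_add tendsto_const summable_LIMSEQ[OF summable_rabs_cancel[OF elim]])
    moreover have "U (\<epsilon> 0) s + (\<Sum>k<n. \<Delta> k s) = U (\<epsilon> n) s" for n
      unfolding \<Delta>_def using sum_lessThan_telescope[of "\<lambda>n. U (\<epsilon> n) s" n] by simp
    ultimately have "(\<lambda>n. U (\<epsilon> n) s) \<longlonglongrightarrow> \<zeta>0 s" by simp
    then have "0 \<le> \<zeta>0 s" by (rule tendsto_lowerbound) (auto intro!: always_eventually nonneg \<epsilon>)
    then show ?case by (simp add: \<zeta>_def)
  qed
  have main: "integrable lborel (\<lambda>s. pois y (x - s) * \<zeta> s) \<and> (LINT s|lborel. pois y (x - s) * \<zeta> s) = U y x"
    if y: "y > 0" for y x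
  proof -
    obtain A where A: "A > 0" "\<And>s. pois y (x - s) \<le> A * weight s" using pois_le_weight[OF y, of x] by blast
    define p where "p = (\<lambda>s. pois y (x - s))"
    have p0: "0 \<le> p s" for s unfolding p_def using pois_pos[OF y] by (simp add: less_imp_le)
    have [measurable]: "p \<in> borel_measurable borel" unfolding p_def by measurable
    have f_int: "integrable lborel (\<lambda>s. p s * \<Delta> k s)" for k
      unfolding p_def \<Delta>_def right_diff_distrib by (intro Bochner_Integration.integrable_diff rep_int y \<epsilon>)
    have f_val: "(LINT s|lborel. p s * \<Delta> k s) = U (y + \<epsilon> (Suc k)) x - U (y + \<epsilon> k) x" for k
      unfolding p_def \<Delta>_def right_diff_distrib
      by (subst Bochner_Integration.integral_diff) (auto intro!: rep_int y \<epsilon> simp: rep[OF y \<epsilon>(1)])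
    have f_le: "norm (p s * \<Delta> k s) \<le> A * (weight s * \<bar>\<Delta> k s\<bar>)" for k s
      using mult_right_mono[OF A(2)[of s], of "\<bar>\<Delta> k s\<bar>"] p0[of s] by (simp add: abs_mult p_def mult.assoc)
    have f_sum: "summable (\<lambda>k. LINT s|lborel. norm (p s * \<Delta> k s))"
    proof (rule summable_comparison_test'[OF summable_mult[OF sum_w\<Delta>, of A]])
      fix k
      have "(LINT s|lborel. norm (p s * \<Delta> k s)) \<le> (LINT s|lborel. A * (weight s * \<bar>\<Delta> k s\<bar>))"
        by (intro Bochner_Integration.integral_mono integrable_norm f_int integrable_mult_right w\<Delta>_int f_le)
      then show "norm (LINT s|lborel. norm (p s * \<Delta> k s)) \<le> A * (LINT s|lborel. weight s * \<bar>\<Delta> k s\<bar>)"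
        by (simp add: Bochner_Integration.integral_nonneg)
    qed
    have f_AE: "AE s in lborel. summable (\<lambda>k. norm (p s * \<Delta> k s))"
      using AE_sum by eventually_elim (simp add: abs_mult summable_mult)
    have eqAE: "AE s in lborel. p s * \<zeta> s = p s * U (\<epsilon> 0) s + (\<Sum>k. p s * \<Delta> k s)"
      using AE_sum AE_\<zeta>
    proof eventually_elim
      case (elim s)
      have "(\<Sum>k. p s * \<Delta> k s) = p s * (\<Sum>k. \<Delta> k s)" by (rule suminf_mult[OF summable_rabs_cancel[OF elim(1)]])
      then show ?case using elim(2) by (simp add: \<zeta>0_def distrib_left)
    qed
    have i1: "integrable lborel (\<lambda>s. p s * U (\<epsilon> 0) s)" unfolding p_def by (intro rep_int y \<epsilon>)
    have i2: "integrable lborel (\<lambda>s. \<Sum>k. p s * \<Delta> k s)" by (rule integrable_suminf[OF f_int f_AE f_sum])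
    have "(\<lambda>k. U (y + \<epsilon> (Suc k)) x - U (y + \<epsilon> k) x) sums (LINT s|lborel. (\<Sum>k. p s * \<Delta> k s))"
      using sums_integral[OF f_int f_AE f_sum] by (simp add: f_val)
    moreover have "(\<lambda>k. U (y + \<epsilon> (Suc k)) x - U (y + \<epsilon> k) x) sums (U y x - U (y + \<epsilon> 0) x)"
      by (rule telescope_sums) (rule cont[OF y \<epsilon>(1) \<epsilon>_lim])
    ultimately have val: "(LINT s|lborel. (\<Sum>k. p s * \<Delta> k s)) = U y x - U (y + \<epsilon> 0) x" by (rule sums_unique2)
    have "integrable lborel (\<lambda>s. p s * \<zeta> s)"
      by (rule integrable_cong_AE_imp[OF Bochner_Integration.integrable_add[OF i1 i2]])
         (use eqAE \<zeta>_meas in \<open>auto elim: eventually_mono\<close>)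
    moreover have "(LINT s|lborel. p s * \<zeta> s) = (LINT s|lborel. p s * U (\<epsilon> 0) s + (\<Sum>k. p s * \<Delta> k s))"
      by (rule integral_cong_AE) (use eqAE \<zeta>_meas in auto)
    then have "(LINT s|lborel. p s * \<zeta> s) = (LINT s|lborel. p s * U (\<epsilon> 0) s) + (LINT s|lborel. (\<Sum>k. p s * \<Delta> k s))"
      using Bochner_Integration.integral_add[OF i1 i2] by simp
    then have "(LINT s|lborel. p s * \<zeta> s) = U y x"
      using val rep[OF y \<epsilon>(1), of x 0] by (simp add: p_def)
    ultimately show ?thesis by (simp add: p_def)
  qed
  show ?thesis using that[OF \<zeta>_meas] main by (auto simp: \<zeta>_def)
qed


subsection \<open>Cauchy transforms of integrable functions\<close>

definition cauchy_transform :: "(real \<Rightarrow> real) \<Rightarrow> complex \<Rightarrow> complex" where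
  "cauchy_transform \<zeta> z = 1 / (of_real pi * \<i>) * (LINT t|lborel. of_real (\<zeta> t) / (of_real t - z))"

lemma dist_real_axis: "Im z \<le> cmod (of_real t - z)"
  using abs_Im_le_cmod[of "of_real t - z"] by simp

lemma cauchy_kernel_bound:
  assumes "Im z > 0"
  shows "cmod (complex_of_real a / (of_real t - z) ^ n) \<le> \<bar>a\<bar> / Im z ^ n"
proof -
  have "Im z ^ n \<le> cmod (of_real t - z) ^ n" using dist_real_axis[of z t] assms by (intro power_mono) auto
  moreover have "0 < Im z ^ n" using assms by simp
  ultimately show ?thesis unfolding norm_divide norm_power
    by (intro frac_le) auto
qed

lemma cauchy_integrable:
  assumes \<zeta>: "integrable lborel \<zeta>" and z: "Im z > 0"
  shows "integrable lborel (\<lambda>t. complex_of_real (\<zeta> t) / (of_real t - z))"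
proof (rule Bochner_Integration.integrable_bound)
  show "integrable lborel (\<lambda>t. \<zeta> t / Im z)" using \<zeta> by simp
  show "(\<lambda>t. complex_of_real (\<zeta> t) / (of_real t - z)) \<in> borel_measurable lborel"
    using borel_measurable_integrable[OF \<zeta>] by measurable
  show "AE t in lborel. norm (complex_of_real (\<zeta> t) / (of_real t - z)) \<le> norm (\<zeta> t / Im z)"
    using cauchy_kernel_bound[OF z, of _ _ 1] z by (intro AE_I2) simp
qed

lemma cauchy_transform_bound:
  assumes \<zeta>: "integrable lborel \<zeta>" and z: "Im z > 0"
  shows "cmod (cauchy_transform \<zeta> z) \<le> (LINT t|lborel. \<bar>\<zeta> t\<bar>) / (pi * Im z)"
proof -
  have "cmod (LINT t|lborel. complex_of_real (\<zeta> t) / (of_real t - z)) \<le> (LINT t|lborel. \<bar>\<zeta> t\<bar> / Im z)"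
  proof (rule Bochner_Integration.integral_norm_bound_integral[OF cauchy_integrable[OF \<zeta> z]])
    show "integrable lborel (\<lambda>t. \<bar>\<zeta> t\<bar> / Im z)" using \<zeta> by simp
    show "cmod (complex_of_real (\<zeta> t) / (of_real t - z)) \<le> \<bar>\<zeta> t\<bar> / Im z" for t
      using cauchy_kernel_bound[OF z, of _ _ 1] by simp
  qed
  then show ?thesis by (simp add: cauchy_transform_def norm_mult norm_divide divide_right_mono field_simps)
qed

lemma Re_cauchy_transform:
  assumes \<zeta>: "integrable lborel \<zeta>" and y: "y > 0"
  shows "Re (cauchy_transform \<zeta> (Complex x y)) = (LINT s|lborel. pois y (x - s) * \<zeta> s)"
proof -
  let ?z = "Complex x y"
  have int: "integrable lborel (\<lambda>t. complex_of_real (\<zeta> t) / (of_real t - ?z))"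
    by (rule cauchy_integrable[OF \<zeta>]) (use y in simp)
  have "Re (1 / (of_real pi * \<i>) * w) = Im w / pi" for w
    by (simp add: divide_complex_def power2_eq_square)
  then have "Re (cauchy_transform \<zeta> ?z) = Im (LINT t|lborel. complex_of_real (\<zeta> t) / (of_real t - ?z)) / pi"
    unfolding cauchy_transform_def by blast
  also have "\<dots> = (LINT t|lborel. Im (complex_of_real (\<zeta> t) / (of_real t - ?z))) / pi"
    by (simp add: integral_Im[OF int])
  also have "\<dots> = (LINT t|lborel. Im (complex_of_real (\<zeta> t) / (of_real t - ?z)) / pi)" by simp
  also have "\<dots> = (LINT s|lborel. pois y (x - s) * \<zeta> s)"
    by (intro Bochner_Integration.integral_cong refl)
       (simp add: Im_divide pois_def power2_commute[of x] power2_eq_square field_simps)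
  finally show ?thesis .
qed

lemma cauchy_transform_holomorphic:
  assumes \<zeta>: "integrable lborel \<zeta>"
  shows "cauchy_transform \<zeta> holomorphic_on {z. Im z > 0}"
proof -
  define I where "I = (\<lambda>z. LINT t|lborel. complex_of_real (\<zeta> t) / (of_real t - z))"
  have "(I has_field_derivative (LINT t|lborel. complex_of_real (\<zeta> t) / (of_real t - w)\<^sup>2)) (at w)" if w: "Im w > 0" for w
    unfolding has_field_derivative_iff
  proof (rule LIM_zero_cancel, rule Lim_null_comparison)
    let ?I' = "LINT t|lborel. complex_of_real (\<zeta> t) / (of_real t - w)\<^sup>2"
    let ?n = "LINT t|lborel. \<bar>\<zeta> t\<bar>"
    have i2: "integrable lborel (\<lambda>t. complex_of_real (\<zeta> t) / (of_real t - w)\<^sup>2)"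
    proof (rule Bochner_Integration.integrable_bound)
      show "integrable lborel (\<lambda>t. \<zeta> t / (Im w)\<^sup>2)" using \<zeta> by simp
      show "(\<lambda>t. complex_of_real (\<zeta> t) / (of_real t - w)\<^sup>2) \<in> borel_measurable lborel"
        using borel_measurable_integrable[OF \<zeta>] by measurable
      show "AE t in lborel. norm (complex_of_real (\<zeta> t) / (of_real t - w)\<^sup>2) \<le> norm (\<zeta> t / (Im w)\<^sup>2)"
        using cauchy_kernel_bound[OF w, of _ _ 2] w by (intro AE_I2) simp
    qed
    have ev: "\<forall>\<^sub>F z in at w. Im z > Im w / 2"
    proof -
      have "\<forall>\<^sub>F z in nhds w. z \<in> {z. Im z > Im w / 2}"
        by (rule eventually_nhds_in_open[OF open_halfspace_Im_gt]) (use w in simp)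
      then show ?thesis by (auto simp: eventually_at_filter elim: eventually_mono)
    qed
    show "\<forall>\<^sub>F z in at w. norm ((I z - I w) / (z - w) - ?I') \<le> cmod (z - w) * (?n / (Im w / 2 * (Im w)\<^sup>2))"
      using ev eventually_neq_at_within[of w w UNIV]
    proof eventually_elim
      case (elim z)
      then have z: "Im z > 0" "z \<noteq> w" using w by (auto simp: field_simps)
      note i1 = cauchy_integrable[OF \<zeta> z(1)] and i0 = cauchy_integrable[OF \<zeta> w]
      have nz: "of_real t - z \<noteq> 0" "of_real t - w \<noteq> 0" for t using z w by (auto simp: complex_eq_iff)
      have "(I z - I w) / (z - w) - ?I'
          = (LINT t|lborel. (complex_of_real (\<zeta> t) / (of_real t - z) - complex_of_real (\<zeta> t) / (of_real t - w)) / (z - w)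
                - complex_of_real (\<zeta> t) / (of_real t - w)\<^sup>2)"
        unfolding I_def by (simp add: Bochner_Integration.integral_diff i0 i1 i2)
      also have "\<dots> = (LINT t|lborel. (z - w) * (complex_of_real (\<zeta> t) / ((of_real t - z) * (of_real t - w)\<^sup>2)))"
      proof (intro Bochner_Integration.integral_cong refl)
        fix t
        define p q a where "p = complex_of_real t - z" and "q = complex_of_real t - w" and "a = complex_of_real (\<zeta> t)"
        have pq: "q = p + (z - w)" "p \<noteq> 0" "q \<noteq> 0" using nz[of t] by (auto simp: p_def q_def)
        have "a / p - a / q = (z - w) * (a / (p * q))"
          using pq(2,3) by (simp add: divide_simps) (simp add: pq(1) algebra_simps)
        then have 1: "(a / p - a / q) / (z - w) = a / (p * q)" using z by simp
        have 2: "a / (p * q) - a / q\<^sup>2 = (z - w) * (a / (p * q\<^sup>2))"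
          using pq(2,3) by (simp add: power2_eq_square divide_simps) (simp add: pq(1) algebra_simps)
        show "(complex_of_real (\<zeta> t) / (of_real t - z) - complex_of_real (\<zeta> t) / (of_real t - w)) / (z - w)
                - complex_of_real (\<zeta> t) / (of_real t - w)\<^sup>2
            = (z - w) * (complex_of_real (\<zeta> t) / ((of_real t - z) * (of_real t - w)\<^sup>2))"
          unfolding p_def[symmetric] q_def[symmetric] a_def[symmetric] 1 2 ..
      qed
      also have "cmod \<dots> \<le> (LINT t|lborel. cmod (z - w) * (\<bar>\<zeta> t\<bar> / (Im w / 2 * (Im w)\<^sup>2)))"
      proof (rule Bochner_Integration.integral_norm_bound_integral)
        have le: "cmod ((z - w) * (complex_of_real (\<zeta> t) / ((of_real t - z) * (of_real t - w)\<^sup>2)))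
            \<le> cmod (z - w) * (\<bar>\<zeta> t\<bar> / (Im w / 2 * (Im w)\<^sup>2))" for t
        proof -
          have "Im w / 2 * (Im w)\<^sup>2 \<le> cmod (of_real t - z) * (cmod (of_real t - w))\<^sup>2"
            using dist_real_axis[of z t] dist_real_axis[of w t] elim w
            by (intro mult_mono power_mono) auto
          then have "\<bar>\<zeta> t\<bar> / (cmod (of_real t - z) * (cmod (of_real t - w))\<^sup>2) \<le> \<bar>\<zeta> t\<bar> / (Im w / 2 * (Im w)\<^sup>2)"
            using w nz by (intro divide_left_mono mult_pos_pos) auto
          then have "cmod (z - w) * (\<bar>\<zeta> t\<bar> / (cmod (of_real t - z) * (cmod (of_real t - w))\<^sup>2))
              \<le> cmod (z - w) * (\<bar>\<zeta> t\<bar> / (Im w / 2 * (Im w)\<^sup>2))" by (rule mult_left_mono) simp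
          then show ?thesis unfolding norm_mult norm_divide norm_power norm_of_real .
        qed
        show int: "integrable lborel (\<lambda>t. cmod (z - w) * (\<bar>\<zeta> t\<bar> / (Im w / 2 * (Im w)\<^sup>2)))" using \<zeta> by simp
        show "integrable lborel (\<lambda>t. (z - w) * (complex_of_real (\<zeta> t) / ((of_real t - z) * (of_real t - w)\<^sup>2)))"
        proof (rule Bochner_Integration.integrable_bound[OF int])
          show "(\<lambda>t. (z - w) * (complex_of_real (\<zeta> t) / ((of_real t - z) * (of_real t - w)\<^sup>2))) \<in> borel_measurable lborel"
            using borel_measurable_integrable[OF \<zeta>] by measurable
        qed (rule AE_I2, rule order_trans[OF le], simp only: real_norm_def abs_ge_self)
        show "cmod ((z - w) * (complex_of_real (\<zeta> t) / ((of_real t - z) * (of_real t - w)\<^sup>2)))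
            \<le> cmod (z - w) * (\<bar>\<zeta> t\<bar> / (Im w / 2 * (Im w)\<^sup>2))" for t by (rule le)
      qed
      also have "\<dots> = cmod (z - w) * (?n / (Im w / 2 * (Im w)\<^sup>2))" by simp
      finally show ?case .
    qed
    have "((\<lambda>z. cmod (z - w) * (?n / (Im w / 2 * (Im w)\<^sup>2))) \<longlongrightarrow> cmod (w - w) * (?n / (Im w / 2 * (Im w)\<^sup>2))) (at w)"
      by (rule tendsto_mult_right, rule tendsto_norm, rule tendsto_diff, rule tendsto_ident_at, rule tendsto_const)
    then show "((\<lambda>z. cmod (z - w) * (?n / (Im w / 2 * (Im w)\<^sup>2))) \<longlongrightarrow> 0) (at w)" by simp
  qed
  then have "I holomorphic_on {z. Im z > 0}"
    by (auto simp: holomorphic_on_def field_differentiable_def intro: has_field_derivative_at_within)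
  moreover have "cauchy_transform \<zeta> = (\<lambda>z. 1 / (of_real pi * \<i>) * I z)"
    by (simp add: fun_eq_iff cauchy_transform_def I_def)
  ultimately show ?thesis by (simp only:) (intro holomorphic_on_mult holomorphic_on_const)
qed

subsection \<open>Outer functions with real part at least one\<close>

text \<open>With \<open>p\<close> the fourth root of \<open>(r + 1) / 2\<close>, \<open>r \<le> p ^ 8\<close> and \<open>ln p \<le> p - 1\<close>. Without passing to the root
  \<open>p\<close>, this estimate would leave a quadratic bound, too weak for large \<open>r\<close>.\<close>

lemma ln_square_le:
  assumes "r \<ge> (1::real)"
  shows "(ln r)\<^sup>2 \<le> 64 * (sqrt ((r + 1) / 2) - 1)"
proof -
  define q where "q = sqrt ((r + 1) / 2)"
  have q1: "q \<ge> 1" unfolding q_def using assms by simp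
  have q2: "q\<^sup>2 = (r + 1) / 2" unfolding q_def using assms by simp
  define p where "p = sqrt q"
  have p1: "p \<ge> 1" unfolding p_def using q1 by simp
  have p2: "p\<^sup>2 = q" unfolding p_def using q1 by simp
  have "r = 2 * q\<^sup>2 - 1" using q2 by simp
  also have "\<dots> \<le> (q\<^sup>2)\<^sup>2" using zero_le_power2[of "q\<^sup>2 - 1"] by (simp add: power2_eq_square algebra_simps)
  also have "\<dots> = p ^ 8" by (simp add: p2[symmetric] flip: power_mult)
  finally have "ln r \<le> ln (p ^ 8)" using assms p1 by (subst ln_le_cancel_iff) auto
  also have "\<dots> = 8 * ln p" using p1 by (subst ln_realpow) auto
  also have "\<dots> \<le> 8 * (p - 1)" using ln_le_minus_one[of p] p1 by simp
  finally have "(ln r)\<^sup>2 \<le> (8 * (p - 1))\<^sup>2" using assms by (intro power_mono) auto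
  also have "\<dots> = 64 * (p\<^sup>2 - 2 * p + 1)" by (simp add: power2_eq_square algebra_simps)
  also have "\<dots> \<le> 64 * (q - 1)" using p1 p2 by simp
  finally show ?thesis by (simp add: q_def)
qed

lemma decay_shift:
  fixes g :: "real \<Rightarrow> real"
  assumes "((\<lambda>y. y * g y) \<longlongrightarrow> c) at_top" "(g \<longlongrightarrow> 0) at_top"
  shows "((\<lambda>y. y * g (y + \<epsilon>)) \<longlongrightarrow> c) at_top"
proof -
  have sh: "filterlim (\<lambda>y::real. y + \<epsilon>) at_top at_top"
    using filterlim_tendsto_add_at_top[OF tendsto_const[of \<epsilon>] filterlim_ident] by (simp add: add.commute)
  have "((\<lambda>y. (y + \<epsilon>) * g (y + \<epsilon>) - \<epsilon> * g (y + \<epsilon>)) \<longlongrightarrow> c - \<epsilon> * 0) at_top"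
    by (intro tendsto_intros filterlim_compose[OF assms(1) sh] filterlim_compose[OF assms(2) sh])
  then show ?thesis by (simp add: algebra_simps)
qed

text \<open>Since \<open>Re M \<ge> 1\<close>, also \<open>Re \<surd>M \<ge> sqrt ((\<bar>M\<bar> + 1) / 2) \<ge> 1\<close>, and the integral of the positive
  harmonic function \<open>Re \<surd>M - 1\<close> over horizontal lines is \<open>\<pi> v / 2\<close>. It dominates
  \<open>(log \<bar>M\<bar>)\<^sup>2\<close>, which puts \<open>log \<bar>M\<bar>\<close> into \<open>L\<^sup>2\<close> uniformly and excludes a singular part.\<close>

lemma outer_representation:
  fixes M :: "complex \<Rightarrow> complex"
  assumes hol: "M holomorphic_on {z. Im z > 0}"
    and Re1: "\<And>z. Im z > 0 \<Longrightarrow> 1 \<le> Re (M z)"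
    and bnd: "\<And>z. Im z > 0 \<Longrightarrow> cmod (M z - 1) \<le> v / Im z"
    and asym: "((\<lambda>y. y *\<^sub>R (M (\<i> * of_real y) - 1)) \<longlongrightarrow> of_real v) at_top"
  obtains \<zeta> where "\<zeta> \<in> borel_measurable borel" "\<And>s. 0 \<le> \<zeta> s" "integrable lborel \<zeta>"
    "(LINT s|lborel. \<zeta> s) = pi * v" "\<And>z. Im z > 0 \<Longrightarrow> M z = exp (cauchy_transform \<zeta> z)"
proof -
  have v0: "0 \<le> v" using order_trans[OF norm_ge_zero bnd[of \<i>]] by simp
  have npos: "M z \<notin> \<real>\<^sub>\<le>\<^sub>0" if "Im z > 0" for z using Re1[OF that] by (auto simp: complex_nonpos_Reals_iff)
  have nz: "M z \<noteq> 0" if "Im z > 0" for z using Re1[OF that] by auto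
  have cm1: "1 \<le> cmod (M z)" if "Im z > 0" for z using Re1[OF that] complex_Re_le_cmod[of "M z"] by linarith
  define L where "L = (\<lambda>z. Ln (M z))"
  define r where "r = (\<lambda>z. csqrt (M z) - 1)"
  have Lhol: "L holomorphic_on {z. Im z > 0}"
    unfolding L_def by (rule holomorphic_on_Ln'[OF _ hol]) (use npos in auto)
  have rhol: "r holomorphic_on {z. Im z > 0}"
    unfolding r_def by (intro holomorphic_on_diff holomorphic_on_csqrt'[OF hol] holomorphic_on_const) (use npos in auto)
  have ReL: "Re (L z) = ln (cmod (M z))" if "Im z > 0" for z unfolding L_def using nz[OF that] by simp
  have ReL0: "0 \<le> Re (L z)" if "Im z > 0" for z using cm1[OF that] by (simp add: ReL[OF that])
  have Rer: "sqrt ((cmod (M z) + 1) / 2) - 1 \<le> Re (r z)" if "Im z > 0" for z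
    using Re1[OF that] by (simp add: r_def divide_right_mono)
  have Rer0: "0 \<le> Re (r z)" if "Im z > 0" for z
  proof -
    have "1 \<le> sqrt ((cmod (M z) + 1) / 2)" using cm1[OF that] by simp
    then show ?thesis using Rer[OF that] by linarith
  qed
  have L_sq: "(Re (L z))\<^sup>2 \<le> 64 * Re (r z)" if "Im z > 0" for z
  proof -
    have "(Re (L z))\<^sup>2 \<le> 64 * (sqrt ((cmod (M z) + 1) / 2) - 1)"
      unfolding ReL[OF that] by (rule ln_square_le[OF cm1[OF that]])
    also have "\<dots> \<le> 64 * Re (r z)" by (intro mult_left_mono Rer[OF that]) simp
    finally show ?thesis .
  qed
  have Mb: "cmod (M z) \<le> 1 + v / \<epsilon>" if "Im z \<ge> \<epsilon>" "\<epsilon> > 0" for z \<epsilon>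
  proof -
    have "cmod (M z - 1) \<le> v / Im z" using that by (intro bnd) simp
    also have "\<dots> \<le> v / \<epsilon>" using that v0 by (intro divide_left_mono) auto
    finally show ?thesis using norm_triangle_sub[of "M z" 1] by simp
  qed
  have Lb: "cmod (L z) \<le> ln (1 + v / \<epsilon>) + pi" if "Im z \<ge> \<epsilon>" "\<epsilon> > 0" for z \<epsilon>
  proof -
    have z: "Im z > 0" using that by simp
    have "\<bar>Re (L z)\<bar> \<le> ln (1 + v / \<epsilon>)"
    proof -
      have "ln (cmod (M z)) \<le> ln (1 + v / \<epsilon>)"
        using Mb[OF that] cm1[OF z] by (subst ln_le_cancel_iff) auto
      then show ?thesis using ReL0[OF z] ReL[OF z] by simp
    qed
    moreover have "\<bar>Im (L z)\<bar> \<le> pi" unfolding L_def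
      using mpi_less_Im_Ln[OF nz[OF z]] Im_Ln_le_pi[OF nz[OF z]] by simp
    ultimately show ?thesis using cmod_le[of "L z"] by linarith
  qed
  have rb: "cmod (r z) \<le> sqrt (1 + v / \<epsilon>) + 1" if "Im z \<ge> \<epsilon>" "\<epsilon> > 0" for z \<epsilon>
  proof -
    have "cmod (r z) \<le> cmod (csqrt (M z)) + 1" unfolding r_def using norm_triangle_ineq4[of "csqrt (M z)" 1] by simp
    also have "cmod (csqrt (M z)) \<le> sqrt (1 + v / \<epsilon>)" using Mb[OF that] by simp
    finally show ?thesis by simp
  qed
  define U where "U = (\<lambda>y x. Re (L (Complex x y)))"
  have line_cont: "continuous_on UNIV (\<lambda>s. Re (f (Complex s y)))" if "f holomorphic_on {z. Im z > 0}" "y > 0" for f y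
  proof (rule continuous_on_Re, rule continuous_on_compose2[OF holomorphic_on_imp_continuous_on[OF that(1)]])
    show "continuous_on UNIV (\<lambda>s. Complex s y)" by (simp add: Complex_eq) (intro continuous_intros)
  qed (use that in auto)
  have Umeas: "U y \<in> borel_measurable borel" if "y > 0" for y
    unfolding U_def by (rule borel_measurable_continuous_onI[OF line_cont[OF Lhol that]])
  have pois0: "(\<lambda>s. pois y (0 - s) * g s) = (\<lambda>s. pois y s * g s)" for y and g :: "real \<Rightarrow> real"
    by (simp add: pois_def)
  have iy: "\<i> * complex_of_real y = Complex 0 y" for y by (simp add: complex_eq_iff)
  have M1: "((\<lambda>y. M (Complex 0 y)) \<longlongrightarrow> 1) at_top"
  proof (rule LIM_zero_cancel, rule Lim_null_comparison)
    show "\<forall>\<^sub>F y in at_top. norm (M (Complex 0 y) - 1) \<le> v * inverse y"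
      using eventually_gt_at_top[of "0::real"]
      by eventually_elim (use bnd in \<open>auto simp: divide_inverse[symmetric] dest!: meta_spec[of _ "Complex 0 _"]\<close>)
    have "((\<lambda>y. v * inverse y) \<longlongrightarrow> v * 0) at_top"
      by (intro tendsto_intros tendsto_inverse_0_at_top filterlim_ident)
    then show "((\<lambda>y::real. v * inverse y) \<longlongrightarrow> 0) at_top" by simp
  qed
  have asym': "((\<lambda>y. of_real y * (M (Complex 0 y) - 1)) \<longlongrightarrow> of_real v) at_top"
    using asym by (simp add: iy scaleR_conv_of_real)
  have r_asym: "((\<lambda>y. y * Re (r (Complex 0 y))) \<longlongrightarrow> v / 2) at_top" "((\<lambda>y. Re (r (Complex 0 y))) \<longlongrightarrow> 0) at_top"
  proof -
    have cs: "((\<lambda>y. csqrt (M (Complex 0 y))) \<longlongrightarrow> csqrt 1) at_top"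
      by (rule isCont_tendsto_compose[OF _ M1]) (auto intro!: continuous_at_csqrt)
    have "((\<lambda>y. Re (csqrt (M (Complex 0 y)) - 1)) \<longlongrightarrow> Re (csqrt 1 - 1)) at_top"
      by (intro tendsto_Re tendsto_diff cs tendsto_const)
    then show "((\<lambda>y. Re (r (Complex 0 y))) \<longlongrightarrow> 0) at_top" by (simp add: r_def)
    have "((\<lambda>y. Re (of_real y * (M (Complex 0 y) - 1) / (csqrt (M (Complex 0 y)) + 1))) \<longlongrightarrow> Re (of_real v / (csqrt 1 + 1))) at_top"
      by (intro tendsto_Re tendsto_divide tendsto_add asym' cs tendsto_const) simp
    moreover have "\<forall>\<^sub>F y in at_top. Re (of_real y * (M (Complex 0 y) - 1) / (csqrt (M (Complex 0 y)) + 1)) = y * Re (r (Complex 0 y))"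
      using eventually_gt_at_top[of "0::real"]
    proof eventually_elim
      case (elim y)
      define c where "c = csqrt (M (Complex 0 y))"
      have "c\<^sup>2 = M (Complex 0 y)" by (simp add: c_def)
      moreover have "0 \<le> Re c" unfolding c_def by (rule Re_csqrt)
      then have "c + 1 \<noteq> 0" by (auto simp: complex_eq_iff)
      ultimately have "of_real y * (M (Complex 0 y) - 1) / (c + 1) = of_real y * (c - 1)"
        by (simp add: field_simps power2_eq_square)
      then show ?case by (simp add: c_def r_def)
    qed
    ultimately show "((\<lambda>y. y * Re (r (Complex 0 y))) \<longlongrightarrow> v / 2) at_top"
      using Lim_transform_eventually by fastforce
  qed
  have r_int: "integrable lborel (\<lambda>s. Re (r (Complex s y)))" "(LINT s|lborel. Re (r (Complex s y))) = pi * (v / 2)" if y: "y > 0" for y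
  proof -
    note rep = Poisson_representation_Re[OF rhol y _ rb[OF _ y], of _ 0, unfolded pois0]
    have lim: "((\<lambda>a. a * (LINT s|lborel. pois a s * Re (r (Complex s y)))) \<longlongrightarrow> v / 2) at_top"
    proof (rule Lim_transform_eventually[OF decay_shift[OF r_asym, of y]])
      show "\<forall>\<^sub>F a in at_top. a * Re (r (Complex 0 (a + y))) = a * (LINT s|lborel. pois a s * Re (r (Complex s y)))"
        using eventually_gt_at_top[of "0::real"] by eventually_elim (simp add: rep(2))
    qed
    have 1: "(\<lambda>s. Re (r (Complex s y))) \<in> borel_measurable borel"
      by (rule borel_measurable_continuous_onI[OF line_cont[OF rhol y]])
    have 2: "0 \<le> Re (r (Complex s y))" for s by (rule Rer0) (use y in simp)
    show "integrable lborel (\<lambda>s. Re (r (Complex s y)))" "(LINT s|lborel. Re (r (Complex s y))) = pi * (v / 2)"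
      using integral_from_Poisson_decay[OF 1 2 rep(1) lim] by auto
  qed
  have U_sq: "(U y s)\<^sup>2 \<le> 64 * Re (r (Complex s y))" if "y > 0" for y s unfolding U_def using L_sq that by simp
  have sq_int: "integrable lborel (\<lambda>s. (U y s)\<^sup>2)" if y: "y > 0" for y
  proof (rule Bochner_Integration.integrable_bound)
    show "integrable lborel (\<lambda>s. 64 * Re (r (Complex s y)))" using r_int[OF y] by simp
    show "(\<lambda>s. (U y s)\<^sup>2) \<in> borel_measurable lborel" using Umeas[OF y] by measurable
    show "AE s in lborel. norm ((U y s)\<^sup>2) \<le> norm (64 * Re (r (Complex s y)))"
      using U_sq[OF y] by (intro AE_I2) (simp add: order_trans[OF _ abs_ge_self])
  qed
  have sq_le: "(LINT s|lborel. (U y s)\<^sup>2) \<le> 32 * pi * v" if y: "y > 0" for y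
  proof -
    have "(LINT s|lborel. (U y s)\<^sup>2) \<le> (LINT s|lborel. 64 * Re (r (Complex s y)))"
      by (rule Bochner_Integration.integral_mono[OF sq_int[OF y] _ U_sq[OF y]]) (use r_int[OF y] in simp)
    then show ?thesis using r_int[OF y] by simp
  qed
  have cont: "(\<lambda>n. U (y + \<epsilon> n) x) \<longlonglongrightarrow> U y x"
    if "y > 0" "\<And>n::nat. \<epsilon> n > 0" "\<epsilon> \<longlonglongrightarrow> 0" for y x \<epsilon>
  proof -
    have lim: "(\<lambda>n. Complex x (y + \<epsilon> n)) \<longlonglongrightarrow> Complex x y"
      using tendsto_Complex[OF tendsto_const tendsto_add[OF tendsto_const that(3)], of x y] by simp
    have isc: "isCont L (Complex x y)"
      using continuous_on_interior[OF holomorphic_on_imp_continuous_on[OF Lhol]] that(1)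
      by (simp add: interior_open open_halfspace_Im_gt)
    from isCont_tendsto_compose[OF isc lim] show ?thesis unfolding U_def by (rule tendsto_Re)
  qed
  obtain \<zeta> where \<zeta>: "\<zeta> \<in> borel_measurable borel" "\<And>s. 0 \<le> \<zeta> s"
    "\<And>y x. y > 0 \<Longrightarrow> integrable lborel (\<lambda>s. pois y (x - s) * \<zeta> s)"
    "\<And>y x. y > 0 \<Longrightarrow> (LINT s|lborel. pois y (x - s) * \<zeta> s) = U y x"
  proof (rule L2_boundary_function[of U "32 * pi * v"])
    show "integrable lborel (\<lambda>s. pois a (x - s) * U b s)" if "a > 0" "b > 0" for a b x
      unfolding U_def by (rule Poisson_representation_Re(1)[OF Lhol that(2,1) Lb[OF _ that(2)]])
    show "(LINT s|lborel. pois a (x - s) * U b s) = U (a + b) x" if "a > 0" "b > 0" for a b x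
      unfolding U_def by (rule Poisson_representation_Re(2)[OF Lhol that(2,1) Lb[OF _ that(2)]])
    show "0 \<le> U y x" if "y > 0" for y x unfolding U_def by (rule ReL0) (use that in simp)
  qed (use Umeas sq_int sq_le cont in auto)
  have U_asym: "((\<lambda>y. y * U y 0) \<longlongrightarrow> v) at_top"
  proof -
    define \<delta> where "\<delta> = (\<lambda>y. M (Complex 0 y) - 1)"
    have \<delta>0: "(\<delta> \<longlongrightarrow> 0) at_top" unfolding \<delta>_def using tendsto_diff[OF M1 tendsto_const[of 1]] by simp
    have \<delta>v: "((\<lambda>y. of_real y * \<delta> y) \<longlongrightarrow> of_real v) at_top" using asym' by (simp add: \<delta>_def)
    have "((\<lambda>y. of_real y * (L (Complex 0 y) - \<delta> y)) \<longlongrightarrow> 0) at_top"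
    proof (rule Lim_null_comparison)
      have "\<forall>\<^sub>F y in at_top. cmod (\<delta> y) < 1" using order_tendstoD(2)[OF tendsto_norm[OF \<delta>0], of 1] by simp
      then show "\<forall>\<^sub>F y in at_top. norm (of_real y * (L (Complex 0 y) - \<delta> y)) \<le> cmod (of_real y * \<delta> y) * cmod (\<delta> y) / (1 - cmod (\<delta> y))"
      proof eventually_elim
        case (elim y)
        have "cmod (L (Complex 0 y) - \<delta> y) \<le> (cmod (\<delta> y))\<^sup>2 / (1 - cmod (\<delta> y))"
          using Ln_approx_linear[OF elim] by (simp add: L_def \<delta>_def)
        then have "\<bar>y\<bar> * cmod (L (Complex 0 y) - \<delta> y) \<le> \<bar>y\<bar> * ((cmod (\<delta> y))\<^sup>2 / (1 - cmod (\<delta> y)))"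
          by (intro mult_left_mono) auto
        then show ?case by (simp add: norm_mult power2_eq_square mult_ac)
      qed
      have "((\<lambda>y. cmod (of_real y * \<delta> y) * cmod (\<delta> y) / (1 - cmod (\<delta> y))) \<longlongrightarrow> cmod (of_real v) * cmod 0 / (1 - cmod 0)) at_top"
        by (intro tendsto_intros \<delta>v \<delta>0) auto
      then show "((\<lambda>y. cmod (of_real y * \<delta> y) * cmod (\<delta> y) / (1 - cmod (\<delta> y))) \<longlongrightarrow> 0) at_top" by simp
    qed
    from tendsto_add[OF this \<delta>v]
    have "((\<lambda>y. of_real y * L (Complex 0 y)) \<longlongrightarrow> of_real v) at_top" by (simp add: algebra_simps)
    from tendsto_Re[OF this] show ?thesis by (simp add: U_def)
  qed
  have mass: "integrable lborel \<zeta>" "(LINT s|lborel. \<zeta> s) = pi * v"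
  proof -
    have int: "integrable lborel (\<lambda>s. pois y s * \<zeta> s)" if "y > 0" for y
      using \<zeta>(3)[OF that, of 0] unfolding pois0 .
    have lim: "((\<lambda>y. y * (LINT s|lborel. pois y s * \<zeta> s)) \<longlongrightarrow> v) at_top"
    proof (rule Lim_transform_eventually[OF U_asym])
      show "\<forall>\<^sub>F y in at_top. y * U y 0 = y * (LINT s|lborel. pois y s * \<zeta> s)"
        using eventually_gt_at_top[of "0::real"] by eventually_elim (simp add: \<zeta>(4)[of _ 0, unfolded pois0])
    qed
    show "integrable lborel \<zeta>" "(LINT s|lborel. \<zeta> s) = pi * v"
      using integral_from_Poisson_decay[OF \<zeta>(1,2) int lim] by auto
  qed
  \<comment> \<open>\<open>E\<close> has modulus \<open>1\<close>, so it is constant, and the constant is its limit at infinity.\<close>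
  define E where "E = (\<lambda>z. M z * exp (- cauchy_transform \<zeta> z))"
  have Ehol: "E holomorphic_on {z. Im z > 0}"
    unfolding E_def by (intro holomorphic_intros hol cauchy_transform_holomorphic mass)
  have E1: "cmod (E z) = 1" if "Im z > 0" for z
  proof -
    have "Re (cauchy_transform \<zeta> z) = ln (cmod (M z))"
      using Re_cauchy_transform[OF mass(1) that, of "Re z"] \<zeta>(4)[OF that, of "Re z"] ReL[OF that]
      by (simp add: U_def complex_surj)
    then show ?thesis using nz[OF that] by (simp add: E_def norm_mult exp_minus norm_inverse)
  qed
  have "E constant_on {z. Im z > 0}"
    by (rule maximum_modulus_principle[OF Ehol _ _ open_halfspace_Im_gt subset_refl, of \<i>])
       (auto simp: E1 open_halfspace_Im_gt intro!: convex_connected convex_halfspace_Im_gt)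
  then obtain c where c: "\<And>z. Im z > 0 \<Longrightarrow> E z = c" by (auto simp: constant_on_def)
  have "((\<lambda>y. E (Complex 0 y)) \<longlongrightarrow> 1 * exp (- 0)) at_top"
    unfolding E_def
  proof (intro tendsto_mult tendsto_exp tendsto_minus M1)
    show "((\<lambda>y. cauchy_transform \<zeta> (Complex 0 y)) \<longlongrightarrow> 0) at_top"
    proof (rule Lim_null_comparison)
      show "\<forall>\<^sub>F y in at_top. norm (cauchy_transform \<zeta> (Complex 0 y)) \<le> (LINT t|lborel. \<bar>\<zeta> t\<bar>) / pi * inverse y"
        using eventually_gt_at_top[of "0::real"]
      proof eventually_elim
        case (elim y)
        then show ?case using cauchy_transform_bound[OF mass(1), of "Complex 0 y"] by (simp add: field_simps)
      qed
      have "((\<lambda>y. (LINT t|lborel. \<bar>\<zeta> t\<bar>) / pi * inverse y) \<longlongrightarrow> (LINT t|lborel. \<bar>\<zeta> t\<bar>) / pi * 0) at_top"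
        by (intro tendsto_mult tendsto_const tendsto_inverse_0_at_top filterlim_ident)
      then show "((\<lambda>y::real. (LINT t|lborel. \<bar>\<zeta> t\<bar>) / pi * inverse y) \<longlongrightarrow> 0) at_top" by simp
    qed
  qed
  moreover have "((\<lambda>y. E (Complex 0 y)) \<longlongrightarrow> c) at_top"
    by (rule tendsto_eventually) (use eventually_gt_at_top[of "0::real"] in eventually_elim, simp add: c)
  ultimately have "c = 1" using tendsto_unique[of at_top] trivial_limit_at_top_linorder by fastforce
  have "M z = exp (cauchy_transform \<zeta> z)" if "Im z > 0" for z
    using c[OF that] \<open>c = 1\<close> by (simp add: E_def exp_minus field_simps)
  then show ?thesis using that[OF \<zeta>(1,2) mass] by blast
qed


section \<open>Boundary values of Poisson integrals\<close>

text \<open>The one-sided averages over \<open>{x..x + h}\<close> converge almost everywhere; the left-sided ones follow by reflection.\<close>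

lemma Lebesgue_points:
  fixes f :: "real \<Rightarrow> real"
  assumes f: "integrable lborel f"
  shows "AE t in lborel. \<forall>e>0. \<exists>d>0. \<forall>r. 0 < r \<and> r < d \<longrightarrow> \<bar>integral {t - r..t + r} f - 2 * r * f t\<bar> \<le> 2 * r * e"
proof -
  have io: "g integrable_on {a..b}" if "integrable lborel g" for g :: "real \<Rightarrow> real" and a b
    by (rule set_borel_integral_eq_integral(1)) (unfold set_integrable_def, rule integrable_mult_indicator[OF _ that], simp)
  define f' where "f' = (\<lambda>x. f (- x))"
  have f': "integrable lborel f'"
    unfolding f'_def using lborel_integrable_real_affine[OF f, of "-1" 0] by simp
  obtain N where N: "negligible N" "\<And>x e. x \<notin> N \<Longrightarrow> 0 < e \<Longrightarrow>
      \<exists>d>0. \<forall>h. 0 < h \<and> h < d \<longrightarrow> norm (integral (cbox x (x + h *\<^sub>R One)) f /\<^sub>R h ^ DIM(real) - f x) < e"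
    using integrable_ccontinuous_explicit[of f] io[OF f] by (metis interval_cbox)
  obtain N' where N': "negligible N'" "\<And>x e. x \<notin> N' \<Longrightarrow> 0 < e \<Longrightarrow>
      \<exists>d>0. \<forall>h. 0 < h \<and> h < d \<longrightarrow> norm (integral (cbox x (x + h *\<^sub>R One)) f' /\<^sub>R h ^ DIM(real) - f' x) < e"
    using integrable_ccontinuous_explicit[of f'] io[OF f'] by (metis interval_cbox)
  have "negligible (N \<union> uminus ` N')"
    using N(1) N'(1)
    by (intro negligible_Un negligible_differentiable_image_negligible)
       (auto simp: differentiable_on_def intro!: derivative_intros)
  then obtain Z where Z: "Z \<in> null_sets lborel" "N \<union> uminus ` N' \<subseteq> Z"
    by (auto simp: negligible_iff_null_sets null_sets_completion_iff2)
  define Q where "Q = (\<lambda>t. \<forall>e>0. \<exists>d>0. \<forall>r. 0 < r \<and> r < d \<longrightarrow> \<bar>integral {t - r..t + r} f - 2 * r * f t\<bar> \<le> 2 * r * e)"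
  have "AE t in lborel. Q t"
  proof (rule AE_I'[OF Z(1)], rule subsetI, rule ccontr)
    fix t assume t: "t \<in> {t \<in> space lborel. \<not> Q t}" and "t \<notin> Z"
    then have tN: "t \<notin> N" "- t \<notin> N'" using Z(2) by (auto simp: image_iff)
    have "\<exists>d>0. \<forall>r. 0 < r \<and> r < d \<longrightarrow> \<bar>integral {t - r..t + r} f - 2 * r * f t\<bar> \<le> 2 * r * e" if e: "e > 0" for e
    proof -
      obtain d1 where d1: "d1 > 0" "\<And>h. 0 < h \<Longrightarrow> h < d1 \<Longrightarrow> \<bar>integral {t..t + h} f / h - f t\<bar> < e"
        using N(2)[OF tN(1) e] by (auto simp: divide_inverse mult.commute)
      obtain d2 where d2: "d2 > 0" "\<And>h. 0 < h \<Longrightarrow> h < d2 \<Longrightarrow> \<bar>integral {- t..- t + h} f' / h - f' (- t)\<bar> < e"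
        using N'(2)[OF tN(2) e] by (auto simp: divide_inverse mult.commute)
      have "\<bar>integral {t - r..t + r} f - 2 * r * f t\<bar> \<le> 2 * r * e" if r: "0 < r" "r < min d1 d2" for r
      proof -
        have scale: "\<bar>I - r * c\<bar> \<le> r * e" if "\<bar>I / r - c\<bar> < e" for I c
        proof -
          have "I - r * c = r * (I / r - c)" using r by (simp add: field_simps)
          then have "\<bar>I - r * c\<bar> = r * \<bar>I / r - c\<bar>" using r by (simp add: abs_mult)
          then show ?thesis using that r by (simp add: mult_left_mono)
        qed
        have 1: "\<bar>integral {t..t + r} f - r * f t\<bar> \<le> r * e" using d1(2)[of r] r by (intro scale) auto
        have refl: "integral {- t..- t + r} f' = integral {t - r..t} f"
          unfolding f'_def using Henstock_Kurzweil_Integration.integral_reflect_real[of "t" "t - r" f] by simp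
        have 2: "\<bar>integral {t - r..t} f - r * f t\<bar> \<le> r * e"
          using d2(2)[of r] r unfolding refl by (intro scale) (auto simp: f'_def)
        have "integral {t - r..t + r} f = integral {t - r..t} f + integral {t..t + r} f"
          using r io[OF f] by (intro Henstock_Kurzweil_Integration.integral_combine[symmetric]) auto
        then show ?thesis using 1 2 by (simp add: abs_le_iff)
      qed
      then show ?thesis using d1 d2 by (intro exI[of _ "min d1 d2"]) auto
    qed
    then have "Q t" unfolding Q_def by blast
    with t show False by simp
  qed
  then show ?thesis by (simp only: Q_def)
qed

text \<open>Minus the derivative of \<open>pois \<epsilon>\<close> on the positive half-line: the density with which the Poisson kernel is a
  mixture of the indicator functions of \<open>{- r..r}\<close>.\<close>

definition pois_layer :: "real \<Rightarrow> real \<Rightarrow> real" where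
  "pois_layer \<epsilon> r = (if 0 \<le> r then 2 * \<epsilon> * r / (pi * (r\<^sup>2 + \<epsilon>\<^sup>2)\<^sup>2) else 0)"

lemma pois_layer_measurable [measurable]: "pois_layer \<epsilon> \<in> borel_measurable borel"
  unfolding pois_layer_def[abs_def] by measurable

lemma pois_layer_nonneg: "\<epsilon> > 0 \<Longrightarrow> 0 \<le> pois_layer \<epsilon> r"
  by (simp add: pois_layer_def)

lemma pois_eq_layers:
  assumes \<epsilon>: "\<epsilon> > 0"
  shows "ennreal (pois \<epsilon> x) = (\<integral>\<^sup>+ r. ennreal (pois_layer \<epsilon> r) * (if \<bar>x\<bar> \<le> r then 1 else 0) \<partial>lborel)"
proof -
  let ?q = "\<lambda>r. 2 * \<epsilon> * r / (pi * (r\<^sup>2 + \<epsilon>\<^sup>2)\<^sup>2)"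
  have pos: "0 < r\<^sup>2 + \<epsilon>\<^sup>2" for r using \<epsilon> by (intro add_nonneg_pos) auto
  have "(\<integral>\<^sup>+ r. ennreal (?q r) * indicator {\<bar>x\<bar>..} r \<partial>lborel) = ennreal (0 - (- pois \<epsilon> \<bar>x\<bar>))"
  proof (rule nn_integral_FTC_atLeast)
    show "?q \<in> borel_measurable borel" by measurable
    show "((\<lambda>r. - pois \<epsilon> r) has_real_derivative ?q r) (at r)" for r
    proof -
      have "((\<lambda>r. - (\<epsilon> / pi * inverse (r\<^sup>2 + \<epsilon>\<^sup>2))) has_real_derivative \<epsilon> / pi * (2 * r) * (inverse (r\<^sup>2 + \<epsilon>\<^sup>2))\<^sup>2) (at r)"
        using pos[of r] by (auto intro!: derivative_eq_intros simp: power2_eq_square[of "inverse _"])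
      moreover have "?q r = \<epsilon> / pi * (2 * r) * (inverse (r\<^sup>2 + \<epsilon>\<^sup>2))\<^sup>2"
        by (simp add: divide_inverse power_inverse mult_ac)
      moreover have "(\<lambda>r. - pois \<epsilon> r) = (\<lambda>r. - (\<epsilon> / pi * inverse (r\<^sup>2 + \<epsilon>\<^sup>2)))"
        by (simp add: fun_eq_iff pois_def divide_inverse mult_ac)
      ultimately show ?thesis by simp
    qed
    show "0 \<le> ?q r" if "\<bar>x\<bar> \<le> r" for r using that \<epsilon> by (intro divide_nonneg_nonneg mult_nonneg_nonneg) auto
    have "((\<lambda>r. \<epsilon> / pi * inverse (r\<^sup>2 + \<epsilon>\<^sup>2)) \<longlongrightarrow> \<epsilon> / pi * 0) at_top"
      by (intro tendsto_mult tendsto_const tendsto_inverse_0_at_top)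
         (intro filterlim_at_top_add_at_top filterlim_tendsto_add_at_top[OF tendsto_const, of _ _ "\<epsilon>\<^sup>2", unfolded add.commute[of "\<epsilon>\<^sup>2"]] filterlim_pow_at_top filterlim_ident, auto)
    then have "((\<lambda>r. - (\<epsilon> / pi * inverse (r\<^sup>2 + \<epsilon>\<^sup>2))) \<longlongrightarrow> - 0) at_top" by (intro tendsto_minus) simp
    then show "((\<lambda>r. - pois \<epsilon> r) \<longlongrightarrow> 0) at_top" by (simp add: pois_def divide_inverse mult_ac)
  qed
  also have "0 - (- pois \<epsilon> \<bar>x\<bar>) = pois \<epsilon> x" by (simp add: pois_def)
  finally have "(\<integral>\<^sup>+ r. ennreal (?q r) * indicator {\<bar>x\<bar>..} r \<partial>lborel) = ennreal (pois \<epsilon> x)" .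
  moreover have "(\<integral>\<^sup>+ r. ennreal (pois_layer \<epsilon> r) * (if \<bar>x\<bar> \<le> r then 1 else 0) \<partial>lborel)
      = (\<integral>\<^sup>+ r. ennreal (?q r) * indicator {\<bar>x\<bar>..} r \<partial>lborel)"
    by (intro nn_integral_cong) (auto simp: pois_layer_def indicator_def)
  ultimately show ?thesis by simp
qed

lemma Poisson_integral_layers:
  assumes \<epsilon>: "\<epsilon> > 0" and f [measurable]: "f \<in> borel_measurable borel"
  shows "(\<integral>\<^sup>+ s. ennreal (pois \<epsilon> (t - s)) * f s \<partial>lborel)
     = (\<integral>\<^sup>+ r. ennreal (pois_layer \<epsilon> r) * (\<integral>\<^sup>+ s. f s * (if \<bar>t - s\<bar> \<le> r then 1 else 0) \<partial>lborel) \<partial>lborel)"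
proof -
  have "(\<integral>\<^sup>+ s. ennreal (pois \<epsilon> (t - s)) * f s \<partial>lborel)
      = (\<integral>\<^sup>+ s. (\<integral>\<^sup>+ r. ennreal (pois_layer \<epsilon> r) * (if \<bar>t - s\<bar> \<le> r then 1 else 0) * f s \<partial>lborel) \<partial>lborel)"
    by (subst pois_eq_layers[OF \<epsilon>]) (intro nn_integral_cong nn_integral_multc[symmetric], measurable)
  also have "\<dots> = (\<integral>\<^sup>+ r. (\<integral>\<^sup>+ s. ennreal (pois_layer \<epsilon> r) * (if \<bar>t - s\<bar> \<le> r then 1 else 0) * f s \<partial>lborel) \<partial>lborel)"
    by (rule lborel_pair.Fubini'[symmetric]) measurable
  also have "\<dots> = (\<integral>\<^sup>+ r. (\<integral>\<^sup>+ s. ennreal (pois_layer \<epsilon> r) * (f s * (if \<bar>t - s\<bar> \<le> r then 1 else 0)) \<partial>lborel) \<partial>lborel)"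
    by (simp add: mult_ac)
  also have "\<dots> = (\<integral>\<^sup>+ r. ennreal (pois_layer \<epsilon> r) * (\<integral>\<^sup>+ s. f s * (if \<bar>t - s\<bar> \<le> r then 1 else 0) \<partial>lborel) \<partial>lborel)"
    by (intro nn_integral_cong nn_integral_cmult) measurable
  finally show ?thesis .
qed

lemma pois_layer_tail:
  assumes \<epsilon>: "\<epsilon> > 0" and d: "d > 0"
  shows "(\<integral>\<^sup>+ r. ennreal (pois_layer \<epsilon> r * (2 * r)) * indicator {d..} r \<partial>lborel) \<le> ennreal (4 * \<epsilon> / (pi * d))"
proof -
  have "(\<integral>\<^sup>+ r. ennreal (4 * \<epsilon> / (pi * r\<^sup>2)) * indicator {d..} r \<partial>lborel) = ennreal (0 - (- (4 * \<epsilon> / (pi * d))))"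
  proof (rule nn_integral_FTC_atLeast)
    show "((\<lambda>r. - (4 * \<epsilon> / (pi * r))) has_real_derivative 4 * \<epsilon> / (pi * r\<^sup>2)) (at r)" if "d \<le> r" for r
      using that d by (auto intro!: derivative_eq_intros simp: power2_eq_square field_simps)
    have "((\<lambda>r::real. - (4 * \<epsilon> / pi * inverse r)) \<longlongrightarrow> - (4 * \<epsilon> / pi * 0)) at_top"
      by (intro tendsto_intros tendsto_inverse_0_at_top filterlim_ident)
    then show "((\<lambda>r. - (4 * \<epsilon> / (pi * r))) \<longlongrightarrow> 0) at_top" by (simp add: divide_inverse mult_ac)
  qed (use \<epsilon> in auto)
  moreover have "(\<integral>\<^sup>+ r. ennreal (pois_layer \<epsilon> r * (2 * r)) * indicator {d..} r \<partial>lborel)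
      \<le> (\<integral>\<^sup>+ r. ennreal (4 * \<epsilon> / (pi * r\<^sup>2)) * indicator {d..} r \<partial>lborel)"
  proof (intro nn_integral_mono)
    fix r
    show "ennreal (pois_layer \<epsilon> r * (2 * r)) * indicator {d..} r \<le> ennreal (4 * \<epsilon> / (pi * r\<^sup>2)) * indicator {d..} r"
    proof (cases "d \<le> r")
      case True
      then have r: "r > 0" using d by simp
      have "r\<^sup>2 * r\<^sup>2 \<le> (r\<^sup>2 + \<epsilon>\<^sup>2)\<^sup>2" unfolding power2_eq_square[of "r\<^sup>2 + \<epsilon>\<^sup>2"] by (intro mult_mono) auto
      then have "4 * \<epsilon> * r\<^sup>2 / (pi * (r\<^sup>2 + \<epsilon>\<^sup>2)\<^sup>2) \<le> 4 * \<epsilon> * r\<^sup>2 / (pi * (r\<^sup>2 * r\<^sup>2))"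
        using \<epsilon> r by (intro divide_left_mono mult_left_mono mult_pos_pos zero_less_power add_pos_nonneg) auto
      also have "\<dots> = 4 * \<epsilon> / (pi * r\<^sup>2)" using r by (simp add: field_simps)
      finally have "pois_layer \<epsilon> r * (2 * r) \<le> 4 * \<epsilon> / (pi * r\<^sup>2)"
        using r by (simp add: pois_layer_def power2_eq_square[of r] mult_ac)
      then show ?thesis by (intro mult_right_mono ennreal_leI) auto
    qed simp
  qed
  ultimately show ?thesis by simp
qed

text \<open>By the layer formula, \<open>(P\<^sub>\<epsilon> * \<zeta>)(t) - \<zeta>(t)\<close> is an average, with the probability density
  \<open>2 * r * pois_layer \<epsilon> r\<close>, of the deviation of the mean of \<open>\<zeta>\<close> over \<open>{t - r..t + r}\<close> from \<open>\<zeta> t\<close>. At a Lebesgue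
  point it is small for \<open>r < d\<close>, and the density gives the rest a mass of order \<open>\<epsilon> / d\<close>.\<close>

lemma Fatou_Poisson:
  fixes \<zeta> :: "real \<Rightarrow> real"
  assumes \<zeta>: "integrable lborel \<zeta>" and nonneg: "\<And>s. 0 \<le> \<zeta> s" and [measurable]: "\<zeta> \<in> borel_measurable borel"
    and int: "\<And>\<epsilon> t. \<epsilon> > 0 \<Longrightarrow> integrable lborel (\<lambda>s. pois \<epsilon> (t - s) * \<zeta> s)"
    and pois1: "\<And>\<epsilon> t. \<epsilon> > 0 \<Longrightarrow> integrable lborel (\<lambda>s. pois \<epsilon> (t - s))" "\<And>\<epsilon> t. \<epsilon> > 0 \<Longrightarrow> (LINT s|lborel. pois \<epsilon> (t - s)) = 1"
  shows "AE t in lborel. ((\<lambda>\<epsilon>. LINT s|lborel. pois \<epsilon> (t - s) * \<zeta> s) \<longlongrightarrow> \<zeta> t) (at_right 0)"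
  using Lebesgue_points[OF \<zeta>]
proof eventually_elim
  case (elim t)
  define n where "n = (LINT s|lborel. \<zeta> s)"
  have n0: "0 \<le> n" unfolding n_def by (intro Bochner_Integration.integral_nonneg nonneg)
  define \<Phi> where "\<Phi> = (\<lambda>r. LINT s|lborel. \<zeta> s * (if \<bar>t - s\<bar> \<le> r then 1 else 0))"
  have cut_int: "integrable lborel (\<lambda>s. \<zeta> s * (if \<bar>t - s\<bar> \<le> r then 1 else 0))" for r
    by (rule Bochner_Integration.integrable_bound[OF \<zeta>]) (auto intro!: AE_I2)
  have \<Phi>0: "0 \<le> \<Phi> r" for r unfolding \<Phi>_def by (intro Bochner_Integration.integral_nonneg) (auto simp: nonneg)
  have \<Phi>_le: "\<Phi> r \<le> n" for r unfolding \<Phi>_def n_def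
    by (rule Bochner_Integration.integral_mono[OF cut_int \<zeta>]) (auto simp: nonneg)
  have \<Phi>_nn: "(\<integral>\<^sup>+ s. ennreal (\<zeta> s) * (if \<bar>t - s\<bar> \<le> r then 1 else 0) \<partial>lborel) = ennreal (\<Phi> r)" for r
  proof -
    have "(\<integral>\<^sup>+ s. ennreal (\<zeta> s) * (if \<bar>t - s\<bar> \<le> r then 1 else 0) \<partial>lborel)
        = (\<integral>\<^sup>+ s. ennreal (\<zeta> s * (if \<bar>t - s\<bar> \<le> r then 1 else 0)) \<partial>lborel)"
      by (intro nn_integral_cong) auto
    also have "\<dots> = ennreal (\<Phi> r)" unfolding \<Phi>_def
      by (rule nn_integral_eq_integral[OF cut_int]) (auto simp: nonneg)
    finally show ?thesis .
  qed
  have \<Phi>_meas [measurable]: "\<Phi> \<in> borel_measurable borel"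
  proof -
    have "(\<lambda>r. enn2real (\<integral>\<^sup>+ s. ennreal (\<zeta> s) * (if \<bar>t - s\<bar> \<le> r then 1 else 0) \<partial>lborel)) \<in> borel_measurable borel"
      by measurable
    then show ?thesis unfolding \<Phi>_nn by (simp add: \<Phi>0)
  qed
  have \<Phi>_HK: "\<Phi> r = integral {t - r..t + r} \<zeta>" for r
  proof -
    have "set_integrable lborel {t - r..t + r} \<zeta>"
      unfolding set_integrable_def by (rule integrable_mult_indicator[OF _ \<zeta>]) simp
    from set_borel_integral_eq_integral(2)[OF this]
    have "integral {t - r..t + r} \<zeta> = (LINT s|lborel. indicator {t - r..t + r} s *\<^sub>R \<zeta> s)"
      by (simp add: set_lebesgue_integral_def)
    also have "\<dots> = \<Phi> r" unfolding \<Phi>_def by (intro Bochner_Integration.integral_cong) (auto simp: indicator_def abs_le_iff)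
    finally show ?thesis by simp
  qed
  let ?P = "\<lambda>\<epsilon>. LINT s|lborel. pois \<epsilon> (t - s) * \<zeta> s"
  have est: "\<bar>?P \<epsilon> - \<zeta> t\<bar> \<le> e + (n / (2 * d) + \<zeta> t) * (4 * \<epsilon> / (pi * d))"
    if \<epsilon>: "\<epsilon> > 0" and e: "e > 0" and d: "d > 0" "\<And>r. 0 < r \<Longrightarrow> r < d \<Longrightarrow> \<bar>\<Phi> r - 2 * r * \<zeta> t\<bar> \<le> 2 * r * e" for \<epsilon> e d
  proof -
    let ?q = "pois_layer \<epsilon>"
    note q0 = pois_layer_nonneg[OF \<epsilon>]
    have p0: "0 \<le> pois \<epsilon> x" for x using pois_pos[OF \<epsilon>, of x] by simp
    have "(\<integral>\<^sup>+ r. ennreal (?q r * \<Phi> r) \<partial>lborel) = (\<integral>\<^sup>+ s. ennreal (pois \<epsilon> (t - s) * \<zeta> s) \<partial>lborel)"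
      using Poisson_integral_layers[OF \<epsilon>, of "\<lambda>s. ennreal (\<zeta> s)" t]
      by (simp add: \<Phi>_nn ennreal_mult q0 \<Phi>0 p0 nonneg)
    also have "\<dots> = ennreal (?P \<epsilon>)" by (rule nn_integral_eq_integral[OF int[OF \<epsilon>]]) (simp add: p0 nonneg)
    finally have q\<Phi>: "(\<integral>\<^sup>+ r. ennreal (?q r * \<Phi> r) \<partial>lborel) = ennreal (?P \<epsilon>)" .
    have P0: "0 \<le> ?P \<epsilon>" by (intro Bochner_Integration.integral_nonneg mult_nonneg_nonneg p0 nonneg)
    have i1: "integrable lborel (\<lambda>r. ?q r * \<Phi> r)"
      by (rule integrableI_nonneg) (use q\<Phi> in \<open>auto simp: q0 \<Phi>0\<close>)
    have v1: "(LINT r|lborel. ?q r * \<Phi> r) = ?P \<epsilon>"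
      using nn_integral_eq_integral[OF i1] q\<Phi> P0
      by (simp add: q0 \<Phi>0 Bochner_Integration.integral_nonneg)
    have len: "ennreal (?q r) * (\<integral>\<^sup>+ s. 1 * (if \<bar>t - s\<bar> \<le> r then 1 else 0) \<partial>lborel) = ennreal (?q r * (2 * r))" for r
    proof (cases "0 \<le> r")
      case True
      have "(\<integral>\<^sup>+ s. 1 * (if \<bar>t - s\<bar> \<le> r then 1 else 0) \<partial>lborel) = (\<integral>\<^sup>+ s. indicator {t - r..t + r} s \<partial>lborel)"
        by (intro nn_integral_cong) (auto simp: indicator_def abs_le_iff)
      then show ?thesis using True by (simp add: ennreal_mult q0)
    qed (simp add: pois_layer_def)
    have "(\<integral>\<^sup>+ r. ennreal (?q r * (2 * r)) \<partial>lborel) = (\<integral>\<^sup>+ s. ennreal (pois \<epsilon> (t - s)) * 1 \<partial>lborel)"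
      using Poisson_integral_layers[OF \<epsilon>, of "\<lambda>s. 1" t] unfolding len by simp
    also have "\<dots> = ennreal 1"
      using nn_integral_eq_integral[OF pois1(1)[OF \<epsilon>, of t]] pois1(2)[OF \<epsilon>, of t] p0 by simp
    finally have q1: "(\<integral>\<^sup>+ r. ennreal (?q r * (2 * r)) \<partial>lborel) = ennreal 1" .
    have qr0: "0 \<le> ?q r * (2 * r)" for r
    proof (cases "0 \<le> r")
      case True
      then show ?thesis by (intro mult_nonneg_nonneg q0) auto
    qed (simp add: pois_layer_def)
    have i2: "integrable lborel (\<lambda>r. ?q r * (2 * r))"
      by (rule integrableI_nonneg) (use q1 qr0 in auto)
    have v2: "(LINT r|lborel. ?q r * (2 * r)) = 1"
      using nn_integral_eq_integral[OF i2] q1 qr0 by (simp add: Bochner_Integration.integral_nonneg)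
    let ?tail = "\<lambda>r. (?q r * (2 * r)) * indicator {d..} r"
    have i3: "integrable lborel ?tail"
      by (rule Bochner_Integration.integrable_bound[OF i2]) (auto intro!: AE_I2 simp: indicator_def)
    have v3: "(LINT r|lborel. ?tail r) \<le> 4 * \<epsilon> / (pi * d)"
    proof -
      have "ennreal (LINT r|lborel. ?tail r) = (\<integral>\<^sup>+ r. ennreal (?tail r) \<partial>lborel)"
        by (rule nn_integral_eq_integral[OF i3, symmetric]) (use qr0 in \<open>auto simp: indicator_def\<close>)
      also have "\<dots> = (\<integral>\<^sup>+ r. ennreal (?q r * (2 * r)) * indicator {d..} r \<partial>lborel)"
        by (intro nn_integral_cong) (auto simp: indicator_def)
      also have "\<dots> \<le> ennreal (4 * \<epsilon> / (pi * d))" by (rule pois_layer_tail[OF \<epsilon> d(1)])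
      finally show ?thesis using \<epsilon> d by (subst (asm) ennreal_le_iff) auto
    qed
    let ?K = "n / (2 * d) + \<zeta> t"
    have K0: "0 \<le> ?K" using n0 d nonneg by simp
    have A: "?P \<epsilon> - \<zeta> t = (LINT r|lborel. ?q r * \<Phi> r - \<zeta> t * (?q r * (2 * r)))"
      using i1 i2 v1 v2 by simp
    have "\<bar>LINT r|lborel. ?q r * \<Phi> r - \<zeta> t * (?q r * (2 * r))\<bar> \<le> (LINT r|lborel. e * (?q r * (2 * r)) + ?K * ?tail r)"
      unfolding real_norm_def[symmetric]
    proof (rule Bochner_Integration.integral_norm_bound_integral)
      show "integrable lborel (\<lambda>r. ?q r * \<Phi> r - \<zeta> t * (?q r * (2 * r)))" using i1 i2 by simp
      show "integrable lborel (\<lambda>r. e * (?q r * (2 * r)) + ?K * ?tail r)" using i2 i3 by simp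
      fix r
      have eq: "?q r * \<Phi> r - \<zeta> t * (?q r * (2 * r)) = ?q r * (\<Phi> r - 2 * r * \<zeta> t)" by (simp add: algebra_simps)
      have "\<bar>?q r * (\<Phi> r - 2 * r * \<zeta> t)\<bar> = ?q r * \<bar>\<Phi> r - 2 * r * \<zeta> t\<bar>" using q0[of r] by (simp add: abs_mult)
      also have "\<dots> \<le> e * (?q r * (2 * r)) + ?K * ?tail r"
      proof (cases "r \<le> 0")
        case True
        then have "?q r = 0" by (auto simp: pois_layer_def)
        then show ?thesis by simp
      next
        case False
        show ?thesis
        proof (cases "r < d")
          case True
          then have "?q r * \<bar>\<Phi> r - 2 * r * \<zeta> t\<bar> \<le> ?q r * (2 * r * e)" using False by (intro mult_left_mono d q0) auto
          then show ?thesis using True by (simp add: algebra_simps)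
        next
          case rd: False
          have "n \<le> n / (2 * d) * (2 * r)" using rd d(1) mult_left_mono[OF _ n0, of d r] by (simp add: field_simps)
          moreover have "\<bar>\<Phi> r - 2 * r * \<zeta> t\<bar> \<le> n + 2 * r * \<zeta> t"
          proof -
            have "0 \<le> 2 * r * \<zeta> t" using False nonneg[of t] by simp
            then show ?thesis using \<Phi>0[of r] \<Phi>_le[of r] by (simp add: abs_le_iff)
          qed
          ultimately have "\<bar>\<Phi> r - 2 * r * \<zeta> t\<bar> \<le> ?K * (2 * r)" by (simp add: algebra_simps)
          then have "?q r * \<bar>\<Phi> r - 2 * r * \<zeta> t\<bar> \<le> ?q r * (?K * (2 * r))" by (intro mult_left_mono q0)
          also have "\<dots> = ?K * ?tail r" using rd by simp
          also have "\<dots> \<le> e * (?q r * (2 * r)) + ?K * ?tail r" using e qr0[of r] by simp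
          finally show ?thesis .
        qed
      qed
      finally show "norm (?q r * \<Phi> r - \<zeta> t * (?q r * (2 * r))) \<le> e * (?q r * (2 * r)) + ?K * ?tail r" unfolding eq by simp
    qed
    also have "\<dots> = (LINT r|lborel. e * (?q r * (2 * r))) + (LINT r|lborel. ?K * ?tail r)"
      by (rule Bochner_Integration.integral_add) (rule integrable_mult_right, rule i2 i3)+
    also have "\<dots> = e * 1 + ?K * (LINT r|lborel. ?tail r)"
      by (simp only: Bochner_Integration.integral_mult_right_zero v2)
    also have "\<dots> \<le> e + ?K * (4 * \<epsilon> / (pi * d))" using mult_left_mono[OF v3 K0] by simp
    finally show ?thesis unfolding A .
  qed
  show ?case
  proof (rule tendstoI)
    fix e :: real assume "e > 0"
    then have e2: "e / 2 > 0" by simp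
    then obtain d where d: "d > 0" "\<And>r. 0 < r \<Longrightarrow> r < d \<Longrightarrow> \<bar>\<Phi> r - 2 * r * \<zeta> t\<bar> \<le> 2 * r * (e / 2)"
      using elim unfolding \<Phi>_HK by blast
    let ?K = "n / (2 * d) + \<zeta> t"
    have "((\<lambda>\<epsilon>. e / 2 + ?K * (4 * \<epsilon> / (pi * d))) \<longlongrightarrow> e / 2 + ?K * (4 * 0 / (pi * d))) (at_right 0)"
      by (intro tendsto_intros) (use d in auto)
    then have "\<forall>\<^sub>F \<epsilon> in at_right 0. e / 2 + ?K * (4 * \<epsilon> / (pi * d)) < e"
      by (rule order_tendstoD) (use \<open>e > 0\<close> in simp)
    then show "\<forall>\<^sub>F \<epsilon> in at_right 0. dist (?P \<epsilon>) (\<zeta> t) < e"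
      using eventually_at_right_less[of 0]
    proof eventually_elim
      case (elim \<epsilon>)
      then show ?case using est[OF elim(2) e2 d] by (simp add: dist_real_def)
    qed
  qed
qed


section \<open>The perturbation determinant is outer\<close>

lemma pois_total: 
  assumes "\<epsilon> > 0"
  shows "integrable lborel (\<lambda>s. pois \<epsilon> (t - s))" "(LINT s|lborel. pois \<epsilon> (t - s)) = 1"
  using Poisson_representation_Re[of "\<lambda>_. 1" 1 \<epsilon> 1 t] assms by auto

lemma pois_mult_integrable_real:
  assumes \<epsilon>: "\<epsilon> > 0" and \<zeta>: "integrable lborel \<zeta>"
  shows "integrable lborel (\<lambda>s. pois \<epsilon> (t - s) * \<zeta> s)"
proof (rule Bochner_Integration.integrable_bound)
  show "integrable lborel (\<lambda>s. 1 / (pi * \<epsilon>) * \<zeta> s)" using \<zeta> by simp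
  show "(\<lambda>s. pois \<epsilon> (t - s) * \<zeta> s) \<in> borel_measurable lborel"
    using borel_measurable_integrable[OF \<zeta>] by measurable
  have "pois \<epsilon> x \<le> 1 / (pi * \<epsilon>)" for x
  proof -
    have "\<epsilon> / (pi * (x\<^sup>2 + \<epsilon>\<^sup>2)) \<le> \<epsilon> / (pi * \<epsilon>\<^sup>2)"
      using \<epsilon> by (intro divide_left_mono mult_left_mono mult_pos_pos add_nonneg_pos) auto
    also have "\<dots> = 1 / (pi * \<epsilon>)" using \<epsilon> by (simp add: power2_eq_square)
    finally show ?thesis by (simp add: pois_def)
  qed
  then have "\<bar>pois \<epsilon> (t - s)\<bar> * \<bar>\<zeta> s\<bar> \<le> 1 / (pi * \<epsilon>) * \<bar>\<zeta> s\<bar>" for s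
    using pois_pos[OF \<epsilon>, of "t - s"] by (intro mult_right_mono) auto
  then show "AE s in lborel. norm (pois \<epsilon> (t - s) * \<zeta> s) \<le> norm (1 / (pi * \<epsilon>) * \<zeta> s)"
    using \<epsilon> by (intro AE_I2) (simp add: abs_mult)
qed

lemma cauchy_transform_boundary:
  assumes \<zeta>: "integrable lborel \<zeta>" "\<zeta> \<in> borel_measurable borel" "\<And>s. 0 \<le> \<zeta> s"
  shows "AE t in lborel. ((\<lambda>\<epsilon>. Re (cauchy_transform \<zeta> (Complex t \<epsilon>))) \<longlongrightarrow> \<zeta> t) (at_right 0)"
proof -
  have "AE t in lborel. ((\<lambda>\<epsilon>. LINT s|lborel. pois \<epsilon> (t - s) * \<zeta> s) \<longlongrightarrow> \<zeta> t) (at_right 0)"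
    by (rule Fatou_Poisson) (use \<zeta> pois_total pois_mult_integrable_real in auto)
  then show ?thesis
  proof eventually_elim
    case (elim t)
    show ?case
    proof (rule Lim_transform_eventually[OF elim])
      show "\<forall>\<^sub>F \<epsilon> in at_right 0. (LINT s|lborel. pois \<epsilon> (t - s) * \<zeta> s) = Re (cauchy_transform \<zeta> (Complex t \<epsilon>))"
        using eventually_at_right_less[of 0] by eventually_elim (simp add: Re_cauchy_transform[OF \<zeta>(1)])
    qed
  qed
qed

text \<open>Monotone convergence. The sum is taken in the extended reals first, so that the density is defined, and
  non-negative, also on the null set where the series diverges.\<close>

lemma cauchy_transform_sum:
  fixes Z :: "nat \<Rightarrow> real \<Rightarrow> real"
  assumes meas: "\<And>n. Z n \<in> borel_measurable borel" and nonneg: "\<And>n s. 0 \<le> Z n s"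
    and int: "\<And>n. integrable lborel (Z n)" and sums: "(\<lambda>n. LINT s|lborel. Z n s) sums S"
  obtains \<zeta> where "\<zeta> \<in> borel_measurable borel" "\<And>s. 0 \<le> \<zeta> s" "integrable lborel \<zeta>"
    "(LINT s|lborel. \<zeta> s) = S"
    "\<And>z. Im z > 0 \<Longrightarrow> (\<lambda>n. cauchy_transform (Z n) z) sums cauchy_transform \<zeta> z"
proof -
  define \<zeta> where "\<zeta> = (\<lambda>s. enn2real (\<Sum>n. ennreal (Z n s)))"
  have \<zeta>_meas: "\<zeta> \<in> borel_measurable borel" unfolding \<zeta>_def using meas by measurable
  have I0: "0 \<le> (LINT s|lborel. Z n s)" for n by (intro Bochner_Integration.integral_nonneg nonneg)
  have "(\<integral>\<^sup>+ s. (\<Sum>n. ennreal (Z n s)) \<partial>lborel) = (\<Sum>n. \<integral>\<^sup>+ s. ennreal (Z n s) \<partial>lborel)"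
    by (rule nn_integral_suminf) (use meas in measurable)
  also have "\<dots> = (\<Sum>n. ennreal (LINT s|lborel. Z n s))"
    by (intro suminf_cong nn_integral_eq_integral int) (simp add: nonneg)
  also have "\<dots> = ennreal S" by (rule suminf_ennreal_eq[OF I0 sums])
  finally have "(\<integral>\<^sup>+ s. (\<Sum>n. ennreal (Z n s)) \<partial>lborel) \<noteq> \<infinity>" by simp
  then have "AE s in lborel. (\<Sum>n. ennreal (Z n s)) \<noteq> \<infinity>"
    by (intro nn_integral_noteq_infinite) (use meas in measurable)
  then have AE: "AE s in lborel. summable (\<lambda>n. Z n s) \<and> \<zeta> s = (\<Sum>n. Z n s)"
  proof eventually_elim
    case (elim s)
    then have s: "summable (\<lambda>n. Z n s)" by (intro summable_suminf_not_top nonneg) auto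
    then show ?case unfolding \<zeta>_def by (simp add: suminf_ennreal2[OF nonneg s] suminf_nonneg[OF s nonneg])
  qed
  have AEs: "AE s in lborel. summable (\<lambda>n. norm (Z n s))"
    using AE by eventually_elim (simp add: nonneg)
  have sumI: "summable (\<lambda>n. LINT s|lborel. norm (Z n s))"
    using sums by (simp add: nonneg sums_iff)
  note ser = integrable_suminf[OF int AEs sumI] sums_integral[OF int AEs sumI]
  have \<zeta>_int: "integrable lborel \<zeta>"
    by (rule integrable_cong_AE_imp[OF ser(1)]) (use AE \<zeta>_meas in \<open>auto elim: eventually_mono\<close>)
  have "(LINT s|lborel. \<zeta> s) = (LINT s|lborel. (\<Sum>n. Z n s))"
    by (rule integral_cong_AE) (use AE \<zeta>_meas ser(1) in \<open>auto elim: eventually_mono\<close>)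
  then have \<zeta>_val: "(LINT s|lborel. \<zeta> s) = S" using sums_unique2[OF ser(2) sums] by simp
  have "(\<lambda>n. cauchy_transform (Z n) z) sums cauchy_transform \<zeta> z" if z: "Im z > 0" for z
  proof -
    let ?f = "\<lambda>n t. complex_of_real (Z n t) / (of_real t - z)"
    have fi: "integrable lborel (?f n)" for n by (rule cauchy_integrable[OF int z])
    have f_le: "norm (?f n t) \<le> Z n t / Im z" for n t
      using cauchy_kernel_bound[OF z, of "Z n t" t 1] nonneg[of n t] by simp
    have fs: "AE t in lborel. summable (\<lambda>n. norm (?f n t))"
      using AE
    proof eventually_elim
      case (elim t)
      then have "summable (\<lambda>n. Z n t / Im z)" by (intro summable_divide) simp
      then show ?case by (rule summable_comparison_test'[where N = 0]) (use f_le in simp)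
    qed
    have fS: "summable (\<lambda>n. LINT t|lborel. norm (?f n t))"
    proof (rule summable_comparison_test')
      show "summable (\<lambda>n. (LINT s|lborel. Z n s) / Im z)" using sums by (intro summable_divide) (simp add: sums_iff)
      fix n
      have "(LINT t|lborel. norm (?f n t)) \<le> (LINT t|lborel. Z n t / Im z)"
        by (intro Bochner_Integration.integral_mono integrable_norm fi f_le) (use int in simp)
      then show "norm (LINT t|lborel. norm (?f n t)) \<le> (LINT s|lborel. Z n s) / Im z"
        by (simp add: Bochner_Integration.integral_nonneg)
    qed
    have "(LINT t|lborel. complex_of_real (\<zeta> t) / (of_real t - z)) = (LINT t|lborel. (\<Sum>n. ?f n t))"
    proof (rule integral_cong_AE)
      show "(\<lambda>t. complex_of_real (\<zeta> t) / (of_real t - z)) \<in> borel_measurable lborel"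
        using cauchy_integrable[OF \<zeta>_int z] by simp
      show "(\<lambda>t. \<Sum>n. ?f n t) \<in> borel_measurable lborel" using integrable_suminf[OF fi fs fS] by simp
      show "AE t in lborel. complex_of_real (\<zeta> t) / (of_real t - z) = (\<Sum>n. ?f n t)"
        using AE
      proof eventually_elim
        case (elim t)
        then have "(\<lambda>n. Z n t) sums \<zeta> t" by (simp add: sums_iff)
        then have "(\<lambda>n. ?f n t) sums (complex_of_real (\<zeta> t) / (of_real t - z))"
          by (intro sums_divide sums_of_real)
        then show ?case by (simp add: sums_iff)
      qed
    qed
    then have "(\<lambda>n. LINT t|lborel. ?f n t) sums (LINT t|lborel. complex_of_real (\<zeta> t) / (of_real t - z))"
      using sums_integral[OF fi fs fS] by simp
    then show ?thesis unfolding cauchy_transform_def by (rule sums_mult)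
  qed
  then show ?thesis using that[OF \<zeta>_meas _ \<zeta>_int \<zeta>_val] by (auto simp: \<zeta>_def)
qed

lemma outer_function_exp_cauchy:
  assumes \<zeta>: "integrable lborel \<zeta>" "\<zeta> \<in> borel_measurable borel" "\<And>s. 0 \<le> \<zeta> s"
    and F: "\<And>z. Im z > 0 \<Longrightarrow> F z = exp (cauchy_transform \<zeta> z)"
  shows "outer_function F"
  unfolding outer_function_def upper_half_plane_def
proof (intro conjI exI)
  have "(\<lambda>z. exp (cauchy_transform \<zeta> z)) holomorphic_on {z. Im z > 0}"
    by (intro holomorphic_intros cauchy_transform_holomorphic \<zeta>)
  then have "F holomorphic_on {z. Im z > 0}" by (rule holomorphic_transform) (simp add: F)
  then show "F analytic_on {z. 0 < Im z}" by (simp add: analytic_on_open open_halfspace_Im_gt)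
  show "AE t in lborel. ((\<lambda>\<epsilon>. cmod (F (Complex t \<epsilon>))) \<longlongrightarrow> exp (\<zeta> t)) (at_right 0)"
    using cauchy_transform_boundary[OF \<zeta>]
  proof eventually_elim
    case (elim t)
    show ?case
    proof (rule Lim_transform_eventually[OF tendsto_exp[OF elim]])
      show "\<forall>\<^sub>F \<epsilon> in at_right 0. exp (Re (cauchy_transform \<zeta> (Complex t \<epsilon>))) = cmod (F (Complex t \<epsilon>))"
        using eventually_at_right_less[of 0] by eventually_elim (simp add: F)
    qed
  qed
  show "AE t in lborel. 0 < exp (\<zeta> t)" by simp
  show "integrable lborel (\<lambda>t. ln (exp (\<zeta> t)) / (1 + t\<^sup>2))"
  proof (rule Bochner_Integration.integrable_bound[OF \<zeta>(1)])
    have "\<zeta> t / (1 + t\<^sup>2) \<le> \<zeta> t" for t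
      using \<zeta>(3)[of t] mult_left_mono[OF weight_le_1[of t] \<zeta>(3)[of t]] by (simp add: weight_def)
    then show "AE t in lborel. norm (ln (exp (\<zeta> t)) / (1 + t\<^sup>2)) \<le> norm (\<zeta> t)"
      using \<zeta>(3) one_plus_square_pos by (intro AE_I2) (simp add: less_imp_le)
  qed (use \<zeta>(2) in measurable)
  \<comment> \<open>The constant by which the two normalizations of the Cauchy kernel differ becomes the phase.\<close>
  define B where "B = (LINT t|lborel. t / (1 + t\<^sup>2) * \<zeta> t)"
  have Bi: "integrable lborel (\<lambda>t. t / (1 + t\<^sup>2) * \<zeta> t)"
  proof (rule Bochner_Integration.integrable_bound[OF \<zeta>(1)])
    have "\<bar>t / (1 + t\<^sup>2)\<bar> \<le> 1" for t :: real
    proof -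
      have "0 \<le> (1 - \<bar>t\<bar>)\<^sup>2" by simp
      then have "\<bar>t\<bar> \<le> 1 + t\<^sup>2" by (simp add: power2_eq_square algebra_simps)
      then show ?thesis using one_plus_square_pos[of t] by (simp add: abs_divide)
    qed
    then show "AE t in lborel. norm (t / (1 + t\<^sup>2) * \<zeta> t) \<le> norm (\<zeta> t)"
      by (intro AE_I2) (metis abs_ge_zero abs_mult mult_left_le_one_le real_norm_def)
  qed (use \<zeta>(2) in measurable)
  show "\<forall>z\<in>{z. 0 < Im z}. F z = exp (\<i> * of_real (- B / pi)) *
      exp (1 / (of_real pi * \<i>) * (LINT t|lborel. (1 / (of_real t - z) - of_real (t / (1 + t\<^sup>2))) * of_real (ln (exp (\<zeta> t)))))"
  proof
    fix z assume "z \<in> {z. 0 < Im z}"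
    then have z: "Im z > 0" by simp
    have "(LINT t|lborel. (1 / (of_real t - z) - of_real (t / (1 + t\<^sup>2))) * of_real (ln (exp (\<zeta> t))))
        = (LINT t|lborel. complex_of_real (\<zeta> t) / (of_real t - z) - complex_of_real (t / (1 + t\<^sup>2) * \<zeta> t))"
      by (intro Bochner_Integration.integral_cong refl) (simp add: left_diff_distrib)
    also have "\<dots> = (LINT t|lborel. complex_of_real (\<zeta> t) / (of_real t - z)) - (LINT t|lborel. complex_of_real (t / (1 + t\<^sup>2) * \<zeta> t))"
      by (rule Bochner_Integration.integral_diff[OF cauchy_integrable[OF \<zeta>(1) z] integrable_of_real[OF Bi]])
    also have "(LINT t|lborel. complex_of_real (t / (1 + t\<^sup>2) * \<zeta> t)) = of_real B"
      unfolding B_def by (rule integral_complex_of_real)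
    finally have I: "1 / (of_real pi * \<i>) * (LINT t|lborel. (1 / (of_real t - z) - of_real (t / (1 + t\<^sup>2))) * of_real (ln (exp (\<zeta> t))))
        = cauchy_transform \<zeta> z - of_real B / (of_real pi * \<i>)"
      by (simp add: cauchy_transform_def right_diff_distrib)
    have e: "\<i> * of_real (- B / pi) + (cauchy_transform \<zeta> z - of_real B / (of_real pi * \<i>)) = cauchy_transform \<zeta> z"
      by (simp add: field_simps)
    show "F z = exp (\<i> * of_real (- B / pi)) *
      exp (1 / (of_real pi * \<i>) * (LINT t|lborel. (1 / (of_real t - z) - of_real (t / (1 + t\<^sup>2))) * of_real (ln (exp (\<zeta> t)))))"
      unfolding I exp_add[symmetric] F[OF z] e ..
  qed
qed

theorem theorem3p2:
  fixes D :: "'a::complex_hilbert set" and H0 H V :: "'a \<Rightarrow> 'a"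
  assumes separable: "separable_space (euclidean :: 'a topology)"
    and H0: "maximal_accumulative D H0"
    and V_pos: "positive_op V"
    and V_sa: "self_adjoint_op V"
    and V_tc: "trace_class V"
    and H: "\<And>h. h \<in> D \<Longrightarrow> H h = H0 h - \<i> *\<^sub>C V h"
  shows "outer_function (perturbation_det D H H0) \<and>
    (\<exists>\<zeta>::real \<Rightarrow> real.
       (AE t in lborel. ((\<lambda>\<epsilon>. ln (cmod (perturbation_det D H H0 (Complex t \<epsilon>)))) \<longlongrightarrow> \<zeta> t) (at_right 0)
          \<and> 0 \<le> \<zeta> t) \<and>
       integrable lborel \<zeta> \<and>
       complex_of_real (LINT t|lborel. \<bar>\<zeta> t\<bar>) = of_real pi * op_trace V \<and>
       (\<forall>z\<in>upper_half_plane. perturbation_det D H H0 z =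
          exp (1 / (of_real pi * \<i>) * (LINT t|lborel. of_real (\<zeta> t) / (of_real t - z)))))"
proof -
  have A: "m_accumulative D H0" by (rule maximal_accumulative_imp_m_accumulative[OF H0])
  have dense: "closure D = UNIV" using H0 by (simp add: maximal_accumulative_def accumulative_def)
  obtain e where e: "padded_basis e" "bij_betw e {n. e n \<noteq> 0} (some_onb :: 'a set)"
    and tr: "summable (\<lambda>n. Re (cinner (V (e n)) (e n)))"
      "(\<lambda>n. (norm (chol_vec V e n))\<^sup>2) sums Re (op_trace V)" "Im (op_trace V) = 0"
    using trace_class_cholesky[OF separable V_pos V_tc] by blast
  define \<psi> where "\<psi> = chol_vec V e"
  define F where "F = perturbation_det D H H0"
  have "\<exists>Z. Z \<in> borel_measurable borel \<and> (\<forall>s. 0 \<le> Z s) \<and> integrable lborel Z \<and>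
      (LINT s|lborel. Z s) = pi * (norm (\<psi> n))\<^sup>2 \<and>
      (\<forall>z. Im z > 0 \<longrightarrow> step_det D H0 \<psi> n z = exp (cauchy_transform Z z))" for n
  proof -
    interpret m_accumulative_operator D "partial_perturbation H0 \<psi> n"
      by unfold_locales (rule partial_perturbation_m_accumulative[OF A])
    show ?thesis
      by (rule outer_representation[OF rank_one_det_holomorphic Re_rank_one_det rank_one_det_bound
            rank_one_det_asymptotics[OF dense], of "\<psi> n"]) blast+
  qed
  then obtain Z where Z: "\<And>n. Z n \<in> borel_measurable borel" "\<And>n s. 0 \<le> Z n s" "\<And>n. integrable lborel (Z n)"
    "\<And>n. (LINT s|lborel. Z n s) = pi * (norm (\<psi> n))\<^sup>2"
    "\<And>n z. Im z > 0 \<Longrightarrow> step_det D H0 \<psi> n z = exp (cauchy_transform (Z n) z)" by metis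
  have "(\<lambda>n. LINT s|lborel. Z n s) sums (pi * Re (op_trace V))"
    unfolding Z(4) \<psi>_def by (intro sums_mult tr)
  from cauchy_transform_sum[OF Z(1,2,3) this] obtain \<zeta>
    where \<zeta>: "\<zeta> \<in> borel_measurable borel" "\<And>s. 0 \<le> \<zeta> s" "integrable lborel \<zeta>"
    "(LINT s|lborel. \<zeta> s) = pi * Re (op_trace V)"
    "\<And>z. Im z > 0 \<Longrightarrow> (\<lambda>n. cauchy_transform (Z n) z) sums cauchy_transform \<zeta> z" by metis
  have F: "F z = exp (cauchy_transform \<zeta> z)" if z: "Im z > 0" for z
  proof -
    have "(\<lambda>N. \<Prod>n<N. step_det D H0 \<psi> n z) \<longlonglongrightarrow> F z"
      unfolding F_def \<psi>_def
      by (rule perturbation_det_product[OF A V_pos e tr(1) _ H z]) (use tr(2) in \<open>auto simp: sums_iff\<close>)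
    moreover have "(\<Prod>n<N. step_det D H0 \<psi> n z) = exp (\<Sum>n<N. cauchy_transform (Z n) z)" for N
      by (simp add: Z(5)[OF z] exp_sum)
    moreover have "(\<lambda>N. exp (\<Sum>n<N. cauchy_transform (Z n) z)) \<longlonglongrightarrow> exp (cauchy_transform \<zeta> z)"
      using \<zeta>(5)[OF z] by (intro tendsto_exp) (simp add: sums_def)
    ultimately show ?thesis using LIMSEQ_unique by simp
  qed
  have "AE t in lborel. ((\<lambda>\<epsilon>. ln (cmod (F (Complex t \<epsilon>)))) \<longlongrightarrow> \<zeta> t) (at_right 0) \<and> 0 \<le> \<zeta> t"
    using cauchy_transform_boundary[OF \<zeta>(3,1,2)]
  proof eventually_elim
    case (elim t)
    have "((\<lambda>\<epsilon>. ln (cmod (F (Complex t \<epsilon>)))) \<longlongrightarrow> \<zeta> t) (at_right 0)"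
    proof (rule Lim_transform_eventually[OF elim])
      show "\<forall>\<^sub>F \<epsilon> in at_right 0. Re (cauchy_transform \<zeta> (Complex t \<epsilon>)) = ln (cmod (F (Complex t \<epsilon>)))"
        using eventually_at_right_less[of 0] by eventually_elim (simp add: F)
    qed
    then show ?case by (simp add: \<zeta>(2))
  qed
  moreover have "complex_of_real (LINT t|lborel. \<bar>\<zeta> t\<bar>) = of_real pi * op_trace V"
    using \<zeta>(2,4) tr(3) by (simp add: complex_eq_iff)
  moreover have "outer_function F" by (rule outer_function_exp_cauchy[OF \<zeta>(3,1,2) F])
  ultimately show ?thesis
    using \<zeta>(3) F unfolding F_def[symmetric] upper_half_plane_def cauchy_transform_def by blast
qed

end
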